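(* For each $n\ge 1$ let $\boldsymbol{\sigma}_n$ be a uniform random separable permutation of size $n$. There exists a collection of random variables $(\Lambda_\pi)$, with $\pi$ ranging over all permutations of all sizes, defined on the same probability space, such that $0\le \Lambda_\pi\le 1$ for all $\pi$, and: (1) If $\pi$ is a separable permutation of size at least $2$, then $\Lambda_\pi$ is a non-deterministic random variable. If $\pi$ is the permutation of size $1$, then $\Lambda_\pi=1$. If $\pi$ is not separable, then $\Lambda_\pi=0$. (2) For all $\pi$, $\widetilde{\mathrm{occ}}(\pi,\boldsymbol{\sigma}_n)\to\Lambda_\pi$ in distribution as $n\to+\infty$. (3) Moreover, the convergence holds jointly: for any finite sequence of permutations $(\pi_1,\dots,\pi_r)$, $$\big(\widetilde{\mathrm{occ}}(\pi_1,\boldsymbol{\sigma}_n),\dots,\widetilde{\mathrm{occ}}(\pi_r,\boldsymbol{\sigma}_n)\big)\to(\Lambda_{\pi_1},\dots,\Lambda_{\pi_r})$$ in distribution as $n\to+\infty$.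
   Context: A permutation of size $n$ is a permutation $\sigma=\sigma_1\sigma_2\cdots\sigma_n$ of $[n]=\{1,\dots,n\}$. For $I\subset[n]$ with $|I|=k$, $\mathrm{pat}_I(\sigma)$ is the permutation of size $k$ whose values are in the same relative order as the subsequence $(\sigma_i)_{i\in I}$. For $\pi$ of size $k\le n$, $\widetilde{\mathrm{occ}}(\pi,\sigma)=\binom{n}{k}^{-1}\,\mathrm{card}\{I\subset[n]:|I|=k,\ \mathrm{pat}_I(\sigma)=\pi\}$; if $k>n$, $\widetilde{\mathrm{occ}}(\pi,\sigma)=0$. A permutation $\sigma$ avoids $\tau$ if $\widetilde{\mathrm{occ}}(\tau,\sigma)=0$; it is separable if it avoids both $2413$ and $3142$. "Non-deterministic" means not almost surely equal to a constant. *)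

theory Defs
  imports "HOL-Probability.Probability" "HOL-Combinatorics.Multiset_Permutations"
begin

text \<open>
  A permutation of size \<open>n\<close> is written in one-line notation, as a list in
  \<open>permutations_of_set {1..n}\<close>; its size is its length.
\<close>

definition all_perms :: "nat list set" where
  "all_perms = (\<Union>n\<in>{1..}. permutations_of_set {1..n})"

text \<open>Each entry is replaced by its rank; see \<open>standardize_perm\<close> and
  \<open>standardize_same_order\<close> below.\<close>

definition standardize :: "nat list \<Rightarrow> nat list" where
  "standardize xs = map (\<lambda>x. card {y \<in> set xs. y \<le> x}) xs"

text \<open>Values are in \<open>{1..n}\<close>, but index sets follow the library's list positions, that is,
  they are subsets of \<open>{..<n}\<close>.\<close>

definition pat :: "nat set \<Rightarrow> nat list \<Rightarrow> nat list" where
  "pat I \<sigma> = standardize (nths \<sigma> I)"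

definition occ :: "nat list \<Rightarrow> nat list \<Rightarrow> real" where
  "occ \<pi> \<sigma> =
     (if length \<pi> \<le> length \<sigma>
      then real (card {I. I \<subseteq> {..<length \<sigma>} \<and> card I = length \<pi> \<and> pat I \<sigma> = \<pi>})
             / real (length \<sigma> choose length \<pi>)
      else 0)"

definition avoids :: "nat list \<Rightarrow> nat list \<Rightarrow> bool" where
  "avoids \<sigma> \<tau> \<longleftrightarrow> occ \<tau> \<sigma> = 0"

definition separable :: "nat list \<Rightarrow> bool" where
  "separable \<sigma> \<longleftrightarrow> avoids \<sigma> [2, 4, 1, 3] \<and> avoids \<sigma> [3, 1, 4, 2]"

definition separable_perms :: "nat \<Rightarrow> nat list set" where
  "separable_perms n = {\<sigma> \<in> permutations_of_set {1..n}. separable \<sigma>}"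

text \<open>The support is finite and nonempty (\<open>finite_separable_perms\<close>,
  \<open>separable_perms_nonempty\<close>), so this is the uniform distribution.\<close>

definition uniform_separable :: "nat \<Rightarrow> nat list pmf" where
  "uniform_separable n = pmf_of_set (separable_perms n)"

definition (in prob_space) non_deterministic :: "('a \<Rightarrow> real) \<Rightarrow> bool" where
  "non_deterministic X \<longleftrightarrow> \<not> (\<exists>c. AE \<omega> in M. X \<omega> = c)"

text \<open>\<open>\<real>\<^sup>r\<close> with \<open>r\<close> a term: its points are the functions that are \<open>undefined\<close>
  outside \<open>{..<r}\<close>.\<close>

abbreviation real_space :: "nat \<Rightarrow> (nat \<Rightarrow> real) topology" where
  "real_space r \<equiv> product_topology (\<lambda>_. euclideanreal) {..<r}"

text \<open>The library's \<open>weak_conv_m\<close> covers only real-valued random variables; for random vectors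
  we take convergence of the expectations of all bounded continuous functions. Here \<open>X n\<close>
  lives on \<open>N n\<close> and \<open>Y\<close> on \<open>M\<close>; both are meant to be random vectors in \<open>real_space r\<close>.\<close>

definition vector_conv_in_distribution ::
  "nat \<Rightarrow> (nat \<Rightarrow> 'a measure) \<Rightarrow> (nat \<Rightarrow> 'a \<Rightarrow> nat \<Rightarrow> real)
     \<Rightarrow> 'b measure \<Rightarrow> ('b \<Rightarrow> nat \<Rightarrow> real) \<Rightarrow> bool" where
  "vector_conv_in_distribution r N X M Y \<longleftrightarrow>
     (\<forall>f. continuous_map (real_space r) euclideanreal f
          \<and> bounded (f ` topspace (real_space r))
        \<longrightarrow> (\<lambda>n. \<integral>\<omega>. f (X n \<omega>) \<partial>N n) \<longlonglongrightarrow> (\<integral>\<omega>. f (Y \<omega>) \<partial>M))"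

lemma length_standardize [simp]: "length (standardize xs) = length xs"
  by (simp add: standardize_def)

lemma rank_less_iff:
  assumes "finite A" "x \<in> A" "y \<in> A"
  shows "card {z \<in> A. z \<le> (x::nat)} < card {z \<in> A. z \<le> y} \<longleftrightarrow> x < y"
proof
  assume "x < y"
  with assms show "card {z \<in> A. z \<le> x} < card {z \<in> A. z \<le> y}"
    by (intro psubset_card_mono) (auto intro!: psubsetI dest: leD)
next
  assume *: "card {z \<in> A. z \<le> x} < card {z \<in> A. z \<le> y}"
  show "x < y"
  proof (rule ccontr)
    assume "\<not> x < y"
    hence "card {z \<in> A. z \<le> y} \<le> card {z \<in> A. z \<le> x}"
      using assms by (intro card_mono) auto
    with * show False by simp
  qed
qed

lemma standardize_same_order:
  assumes "i < length xs" "j < length xs"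
  shows "standardize xs ! i < standardize xs ! j \<longleftrightarrow> xs ! i < xs ! j"
  using assms by (simp add: standardize_def rank_less_iff)

lemma standardize_perm:
  assumes "distinct xs"
  shows "standardize xs \<in> permutations_of_set {1..length xs}"
proof -
  let ?f = "\<lambda>x. card {y \<in> set xs. y \<le> x}"
  have inj: "inj_on ?f (set xs)"
  proof (rule inj_onI)
    fix x y assume "x \<in> set xs" "y \<in> set xs" "?f x = ?f y"
    then show "x = y"
      using rank_less_iff[of "set xs" x y] rank_less_iff[of "set xs" y x]
      by (metis List.finite_set less_irrefl linorder_neqE_nat)
  qed
  have "?f ` set xs \<subseteq> {1..length xs}"
  proof
    fix k assume "k \<in> ?f ` set xs"
    then obtain x where x: "x \<in> set xs" "k = ?f x" by blast
    have "k \<noteq> 0" using x by auto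
    moreover have "k \<le> card (set xs)" using x by (auto intro!: card_mono)
    ultimately show "k \<in> {1..length xs}"
      using card_length[of xs] by auto
  qed
  moreover have "card (?f ` set xs) = card {1..length xs}"
    using inj assms by (simp add: card_image distinct_card)
  ultimately have "?f ` set xs = {1..length xs}"
    by (simp add: card_subset_eq)
  thus ?thesis
    using inj assms by (simp add: permutations_of_set_def standardize_def distinct_map)
qed

lemma finite_separable_perms: "finite (separable_perms n)"
  unfolding separable_perms_def by (rule finite_subset[of _ "permutations_of_set {1..n}"]) auto

lemma separable_perms_nonempty: "separable_perms n \<noteq> {}"
proof -
  let ?\<sigma> = "[1..<Suc n]"
  have less: "nths ?\<sigma> I ! i < nths ?\<sigma> I ! j"
    if "i < j" "j < length (nths ?\<sigma> I)" for I i j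
  proof -
    have "sorted (nths ?\<sigma> I)" "distinct (nths ?\<sigma> I)"
      by (auto intro: sorted_nths distinct_nthsI simp del: upt_Suc)
    thus ?thesis
      using that by (metis sorted_wrt_nth_less strict_sorted_iff)
  qed
  have no_descent: "pat I ?\<sigma> \<noteq> \<pi>" if "i < j" "j < length \<pi>" "\<pi> ! j < \<pi> ! i" for I \<pi> i j
  proof
    assume eq: "pat I ?\<sigma> = \<pi>"
    hence "\<pi> ! i < \<pi> ! j"
      using that less[of i j I] standardize_same_order[of i "nths ?\<sigma> I" j]
      unfolding pat_def by (metis length_standardize order.strict_trans)
    with that show False by simp
  qed
  have "pat I ?\<sigma> \<noteq> [2, 4, 1, 3]" "pat I ?\<sigma> \<noteq> [3, 1, 4, 2]" for I
    using no_descent[of 0 2 "[2, 4, 1, 3]" I] no_descent[of 0 1 "[3, 1, 4, 2]" I]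
    by (simp_all add: numeral_2_eq_2)
  hence "separable ?\<sigma>"
    by (simp add: separable_def avoids_def occ_def del: upt_Suc)
  moreover have "?\<sigma> \<in> permutations_of_set {1..n}"
    by (auto simp: permutations_of_set_def simp del: upt_Suc)
  ultimately show ?thesis
    unfolding separable_perms_def by blast
qed

end

theory Submission
  imports Defs "HOL-Library.Sublist" "HOL-Computational_Algebra.Polynomial_FPS"
    "HOL-Real_Asymp.Real_Asymp"
begin

text \<open>
  All statistics lie in \<open>[0, 1]\<close>, so joint convergence follows from convergence of all mixed
  moments. The moment of \<open>\<pi>\<^sub>1, \<dots>, \<pi>\<^sub>r\<close> counts separable permutations with one marked occurrence of each
  \<open>\<pi>\<^sub>i\<close>. Splitting off the first sum-indecomposable (respectively skew-indecomposable) component gives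
  a linear equation for the generating function \<open>A\<close> of these objects,
  \<open>D A = \<epsilon> z (1 + S) + R\<^sup>+ + R\<^sup>-\<close>, where \<open>D\<^sup>2 = 1 - 6 z + z\<^sup>2\<close>, \<open>S\<close> counts separable permutations and
  \<open>R\<^sup>+, R\<^sup>-\<close> are sums of products of smaller instances over the nontrivial ways to split all \<open>\<pi>\<^sub>i\<close>
  simultaneously. Hence \<open>A D\<^bsup>2k-1\<^esup>\<close>, with \<open>k\<close> the total size, has the form \<open>p + r D\<close> with polynomials
  \<open>p, r\<close>, and the coefficients of \<open>A\<close> are asymptotically \<open>p(\<rho>)\<close> times those of \<open>D\<^bsup>1-2k\<^esup>\<close>, whose growth
  follows from elementary recurrences.

  The limit law is obtained on the line: a space-filling curve maps the line onto the Hilbert cube,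
  Helly's theorem gives a limit point, and its moments determine it by the Stone-Weierstrass theorem.

  For non-determinism, if \<open>\<Lambda>\<^sub>\<pi>\<close> were constant then \<open>E[\<Lambda>\<^sub>\<rho> \<Lambda>\<^sub>\<pi>] = E[\<Lambda>\<^sub>\<rho>] E[\<Lambda>\<^sub>\<pi>]\<close> for every \<open>\<rho>\<close>. When \<open>\<pi>\<close> contains
  an ascent take \<open>\<rho>\<close> decreasing of size \<open>N\<close>: then \<open>\<Lambda>\<^sub>\<pi> \<le> C \<Lambda>\<^bsub>12\<^esub>\<close>, and the leading coefficients satisfy
  quadratic recurrences showing \<open>E[\<Lambda>\<^sub>\<rho> \<Lambda>\<^bsub>12\<^esub>] / E[\<Lambda>\<^sub>\<rho>] = O(N\<^bsup>-1/2\<^esup>)\<close>.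
\<close>

text \<open>The exponent \<open>2k-1\<close> is what the linear equation dictates: a split into
  total sizes \<open>i + j = k\<close> contributes \<open>(2i-1) + (2j-1) = 2k-2\<close> powers of
  \<open>1/D\<close>, and solving for \<open>A\<close> adds one more. The inhomogeneous term is less
  singular as soon as \<open>k > 1\<close>. Since \<open>D\<close> vanishes at \<rho>, passing to
  \<open>p(\<rho>)\<close> is multiplicative, so the constants alone obey a closed quadratic
  recursion, \<open>lead\<close>. The obstacle is non-determinism. Comparing the second moment of a
  single variable with the square of its mean would require control of how two copies of an
  arbitrary pattern split simultaneously. Testing constancy against a second, monotone pattern
  replaces this by one explicit family, the constants of a monotone pattern paired with a pattern of
  size 2, whose generating functions are rational in a single square root. Of \<pi> itself only the
  order of its first two entries and the positivity of its mean enter.\<close>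

unbundle no vec_syntax
unbundle fps_syntax

section \<open>Patterns and order isomorphism\<close>

text \<open>Ranging over all ordered pairs \<open>(i, j)\<close>, the condition on \<open><\<close>
  also fixes equality. The two entry types may differ, so integer patterns can be matched directly
  against permutations of natural numbers.\<close>

definition order_iso :: "'a::linorder list \<Rightarrow> 'b::linorder list \<Rightarrow> bool" where
  "order_iso xs ys \<longleftrightarrow> length xs = length ys \<and>
     (\<forall>i<length xs. \<forall>j<length xs. xs ! i < xs ! j \<longleftrightarrow> ys ! i < ys ! j)"

definition list_below :: "'a::linorder list \<Rightarrow> 'a list \<Rightarrow> bool" (infix "\<lless>" 50) where
  "us \<lless> vs \<longleftrightarrow> (\<forall>u\<in>set us. \<forall>v\<in>set vs. u < v)"

text \<open>No cardinality is prescribed as in \<open>occ\<close>: the isomorphism forces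
  \<open>card I = length \<pi>\<close> (\<open>occs_card\<close>).\<close>

definition occs :: "'a::linorder list \<Rightarrow> 'b::linorder list \<Rightarrow> nat set set" where
  "occs \<pi> xs = {I. I \<subseteq> {..<length xs} \<and> order_iso \<pi> (nths xs I)}"

text \<open>The ways in which an occurrence of \<pi> can be distributed over a lower left and an
  upper right block; either part may be empty.\<close>

definition splits1 :: "'a::linorder list \<Rightarrow> ('a list \<times> 'a list) set" where
  "splits1 \<pi> = {(a, b). a @ b = \<pi> \<and> a \<lless> b}"

lemma order_iso_length: "order_iso xs ys \<Longrightarrow> length xs = length ys"
  by (simp add: order_iso_def)

lemma order_iso_sym: "order_iso xs ys \<Longrightarrow> order_iso ys xs"
  by (auto simp: order_iso_def)

lemma order_iso_trans: "order_iso xs ys \<Longrightarrow> order_iso ys zs \<Longrightarrow> order_iso xs zs"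
  by (auto simp: order_iso_def)

lemma order_iso_nil [simp]: "order_iso [] ys \<longleftrightarrow> ys = []" "order_iso xs [] \<longleftrightarrow> xs = []"
  by (auto simp: order_iso_def)

lemma order_iso_map_mono:
  assumes "\<And>x y. x \<in> set xs \<Longrightarrow> y \<in> set xs \<Longrightarrow> f x < f y \<longleftrightarrow> x < y"
  shows "order_iso (map f xs) xs"
  using assms by (auto simp: order_iso_def)

lemma order_iso_map_antimono:
  assumes "order_iso xs ys"
    and "\<And>x y. x \<in> set xs \<Longrightarrow> y \<in> set xs \<Longrightarrow> f x < f y \<longleftrightarrow> y < x"
    and "\<And>x y. x \<in> set ys \<Longrightarrow> y \<in> set ys \<Longrightarrow> g x < g y \<longleftrightarrow> y < x"
  shows "order_iso (map f xs) (map g ys)"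
  using assms by (auto simp: order_iso_def)

text \<open>Quantifying over pairs of entries instead of indices turns concatenation into a union of
  sets, which is the form that \<open>order_iso_append\<close> takes apart.\<close>

lemma order_iso_zip:
  "order_iso xs ys \<longleftrightarrow> length xs = length ys \<and>
     (\<forall>p\<in>set (zip xs ys). \<forall>q\<in>set (zip xs ys). fst p < fst q \<longleftrightarrow> snd p < snd q)"
proof (cases "length xs = length ys")
  case True
  then have "set (zip xs ys) = (\<lambda>i. (xs ! i, ys ! i)) ` {..<length xs}" by (auto simp: set_zip)
  with True show ?thesis by (auto simp: order_iso_def)
qed (simp add: order_iso_def)

text \<open>Pairs within a block give the two isomorphisms. A pair across the blocks is ascending in
  \<open>x @ y\<close>, so it matches exactly if it is ascending in \<open>a @ b\<close>.\<close>

lemma order_iso_append: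
  assumes xy: "x \<lless> y" and len: "length a = length x"
  shows "order_iso (a @ b) (x @ y) \<longleftrightarrow> order_iso a x \<and> order_iso b y \<and> a \<lless> b"
proof (cases "length b = length y")
  case True
  let ?P = "\<lambda>p q. fst p < fst q \<longleftrightarrow> snd p < snd q"
  have cross: "(\<forall>p\<in>set (zip a x). \<forall>q\<in>set (zip b y). ?P p q \<and> ?P q p) \<longleftrightarrow> a \<lless> b"
  proof
    assume L: "\<forall>p\<in>set (zip a x). \<forall>q\<in>set (zip b y). ?P p q \<and> ?P q p"
    show "a \<lless> b" unfolding list_below_def
    proof (intro ballI)
      fix u v assume "u \<in> set a" "v \<in> set b"
      then have "u \<in> fst ` set (zip a x)" "v \<in> fst ` set (zip b y)"
        using len True by (simp_all flip: set_map)
      then obtain s t where "(u, s) \<in> set (zip a x)" "(v, t) \<in> set (zip b y)" by auto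
      moreover from this have "s < t" using xy by (meson list_below_def set_zip_rightD)
      ultimately show "u < v" using L by fastforce
    qed
  next
    assume "a \<lless> b"
    then show "\<forall>p\<in>set (zip a x). \<forall>q\<in>set (zip b y). ?P p q \<and> ?P q p"
      using xy unfolding list_below_def
      by (metis order.asym prod.collapse set_zip_leftD set_zip_rightD)
  qed
  show ?thesis
    unfolding order_iso_zip cross[symmetric] using len True by (simp add: ball_Un) blast
qed (use len in \<open>auto simp: order_iso_def\<close>)

lemma list_below_nths:
  "us \<lless> vs \<Longrightarrow> nths us I \<lless> nths vs J"
  unfolding list_below_def by (meson in_set_nthsD)

lemma finite_occs [simp]: "finite (occs \<pi> xs)"
  unfolding occs_def by (rule finite_subset[of _ "Pow {..<length xs}"]) auto

lemma splits1_subset: "splits1 \<pi> \<subseteq> (\<lambda>i. (take i \<pi>, drop i \<pi>)) ` {..length \<pi>}"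
proof
  fix p assume "p \<in> splits1 \<pi>"
  then obtain a b where "p = (a, b)" "a @ b = \<pi>" by (auto simp: splits1_def)
  then show "p \<in> (\<lambda>i. (take i \<pi>, drop i \<pi>)) ` {..length \<pi>}"
    by (intro image_eqI[of _ _ "length a"]) auto
qed

lemma finite_splits1 [simp]: "finite (splits1 \<pi>)"
  by (rule finite_subset[OF splits1_subset]) auto

text \<open>Cutting an index set at \<open>n = length us\<close> yields an occurrence of a prefix of
  \<pi> in \<open>us\<close> and one of the remaining suffix in \<open>vs\<close>. Here
  \<open>g\<close> cuts and \<open>h\<close> glues; the length of the prefix is read off from the
  left part.\<close>

lemma card_occs_append:
  assumes below: "us \<lless> vs"
  shows "card (occs \<pi> (us @ vs)) = (\<Sum>(a, b)\<in>splits1 \<pi>. card (occs a us) * card (occs b vs))"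
proof -
  define n where "n = length us"
  define Z where "Z = (SIGMA ab:splits1 \<pi>. occs (fst ab) us \<times> occs (snd ab) vs)"
  define h where "h = (\<lambda>(ab :: 'b list \<times> 'b list, IJ). fst IJ \<union> (+) n ` snd IJ)"
  define g where "g = (\<lambda>I. ((take (length (nths us I)) \<pi>, drop (length (nths us I)) \<pi>),
                            (I \<inter> {..<n}, {j. j + n \<in> I})))"
  have restr: "nths us (I \<inter> {..<n}) = nths us I" for I
    unfolding n_def nths_def by (rule arg_cong[where f = "map fst"], rule filter_cong) (auto simp: set_zip)
  have shift: "nths (us @ vs) I = nths us I @ nths vs {j. j + n \<in> I}" for I
    by (simp add: nths_append n_def)
  have "bij_betw h Z (occs \<pi> (us @ vs))"
  proof (rule bij_betw_byWitness[where f' = g])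
    have hsplit: "nths us (I \<union> (+) n ` J) = nths us I" "{j. j + n \<in> I \<union> (+) n ` J} = J"
      "(I \<union> (+) n ` J) \<inter> {..<n} = I" if "I \<subseteq> {..<n}" for I J
    proof -
      show 3: "(I \<union> (+) n ` J) \<inter> {..<n} = I" using that by auto
      show "nths us (I \<union> (+) n ` J) = nths us I"
        using restr[of "I \<union> (+) n ` J"] 3 by simp
      show "{j. j + n \<in> I \<union> (+) n ` J} = J" using that by (auto simp: add.commute)
    qed
    show "\<forall>z\<in>Z. g (h z) = z"
    proof
      fix z assume "z \<in> Z"
      then obtain a b I J where z: "z = ((a, b), (I, J))" "(a, b) \<in> splits1 \<pi>"
        "I \<in> occs a us" "J \<in> occs b vs" unfolding Z_def by (cases z) auto
      then have I: "I \<subseteq> {..<n}" by (simp add: occs_def n_def)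
      have "length (nths us I) = length a" using z by (simp add: occs_def order_iso_def)
      then show "g (h z) = z" using z hsplit[OF I, of J] by (auto simp: h_def g_def splits1_def)
    qed
    show "\<forall>I\<in>occs \<pi> (us @ vs). h (g I) = I"
    proof
      fix I assume "I \<in> occs \<pi> (us @ vs)"
      have "I \<inter> {..<n} \<union> (+) n ` {j. j + n \<in> I} = I"
      proof (intro equalityI subsetI)
        fix x assume "x \<in> I"
        then show "x \<in> I \<inter> {..<n} \<union> (+) n ` {j. j + n \<in> I}"
          by (cases "x < n") (auto intro!: image_eqI[of _ _ "x - n"])
      qed (auto simp: add.commute)
      then show "h (g I) = I" by (simp add: h_def g_def)
    qed
    show "h ` Z \<subseteq> occs \<pi> (us @ vs)"
    proof
      fix K assume "K \<in> h ` Z"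
      then obtain a b I J where z: "K = I \<union> (+) n ` J" "(a, b) \<in> splits1 \<pi>"
        "I \<in> occs a us" "J \<in> occs b vs" unfolding Z_def h_def by auto
      then have I: "I \<subseteq> {..<n}" by (simp add: occs_def n_def)
      have J: "J \<subseteq> {..<length vs}" using z by (simp add: occs_def)
      have "order_iso \<pi> (nths us I @ nths vs J)"
        using z order_iso_append[OF list_below_nths[OF below, of I J], of a b]
        by (auto simp: occs_def splits1_def order_iso_length)
      then show "K \<in> occs \<pi> (us @ vs)"
        using z(1) I J hsplit[OF I, of J] by (auto simp: occs_def shift n_def)
    qed
    show "g ` occs \<pi> (us @ vs) \<subseteq> Z"
    proof
      fix z assume "z \<in> g ` occs \<pi> (us @ vs)"
      then obtain I where I: "I \<in> occs \<pi> (us @ vs)" "z = g I" by blast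
      define l where "l = length (nths us I)"
      have iso: "order_iso (take l \<pi> @ drop l \<pi>) (nths us I @ nths vs {j. j + n \<in> I})"
        using I by (simp add: occs_def shift)
      then have len: "length (take l \<pi>) = length (nths us I)"
        using order_iso_length[OF iso] by (auto simp: l_def)
      have "order_iso (take l \<pi>) (nths us I) \<and> order_iso (drop l \<pi>) (nths vs {j. j + n \<in> I})
            \<and> take l \<pi> \<lless> drop l \<pi>"
        using iso order_iso_append[OF list_below_nths[OF below] len] by blast
      moreover have "{j. j + n \<in> I} \<subseteq> {..<length vs}"
        using I by (auto simp: occs_def n_def)
      ultimately show "z \<in> Z"
        using I by (auto simp: g_def Z_def occs_def splits1_def n_def l_def restr[unfolded n_def])
    qed
  qed
  then have "card (occs \<pi> (us @ vs)) = card Z" using bij_betw_same_card by metis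
  also have "\<dots> = (\<Sum>ab\<in>splits1 \<pi>. card (occs (fst ab) us) * card (occs (snd ab) vs))"
    unfolding Z_def by (simp add: card_cartesian_product)
  finally show ?thesis by (simp add: case_prod_beta)
qed

lemma card_occs_nil [simp]: "card (occs ([] :: 'a::linorder list) xs) = 1"
proof -
  have "occs ([] :: 'a list) xs = {{}}"
  proof (intro equalityI subsetI)
    fix I assume "I \<in> occs ([] :: 'a list) xs"
    then have "I \<subseteq> {..<length xs}" "length (nths xs I) = 0" by (auto simp: occs_def)
    moreover have "{i. i < length xs \<and> i \<in> I} = I" using calculation by auto
    ultimately show "I \<in> {{}}" using finite_subset[of I] by (auto simp: length_nths)
  qed (simp add: occs_def)
  then show ?thesis by simp
qed

lemma occs_card: "I \<in> occs \<pi> xs \<Longrightarrow> card I = length \<pi>"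
proof -
  assume I: "I \<in> occs \<pi> xs"
  then have "{i. i < length xs \<and> i \<in> I} = I" by (auto simp: occs_def)
  with I show ?thesis by (auto simp: occs_def order_iso_def length_nths)
qed

lemma occs_long: "length xs < length \<pi> \<Longrightarrow> occs \<pi> xs = {}"
proof -
  assume a: "length xs < length \<pi>"
  have False if "I \<in> occs \<pi> xs" for I
  proof -
    have "card I \<le> card {..<length xs}" using that by (intro card_mono) (auto simp: occs_def)
    then show False using occs_card[OF that] a by simp
  qed
  then show ?thesis by blast
qed

lemma card_occs_singleton:
  "card (occs \<pi> [x]) = (if length \<pi> \<le> 1 then 1 else 0)"
proof (cases "length \<pi> \<le> 1")
  case True
  show ?thesis
  proof (cases \<pi>)
    case Nil then show ?thesis by simp
  next
    case (Cons a p)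
    then have [simp]: "\<pi> = [a]" using True by simp
    have "occs \<pi> [x] = {{0}}"
    proof (intro equalityI subsetI)
      fix I assume I: "I \<in> occs \<pi> [x]"
      then have "I \<subseteq> {0}" "card I = 1" using occs_card[OF I] by (auto simp: occs_def)
      then show "I \<in> {{0}}" by (auto simp: subset_singleton_iff)
    qed (auto simp: occs_def order_iso_def)
    then show ?thesis by simp
  qed
next
  case False
  then show ?thesis using occs_long[of "[x]" \<pi>] by simp
qed

lemma occs_cong_left: "order_iso \<pi> \<rho> \<Longrightarrow> occs \<pi> xs = occs \<rho> xs"
  unfolding occs_def by (metis order_iso_trans order_iso_sym)

lemma order_iso_nths: "order_iso xs ys \<Longrightarrow> order_iso (nths xs I) (nths ys I)"
proof -
  assume iso: "order_iso xs ys"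
  then have len: "length xs = length ys" by (simp add: order_iso_def)
  then have "zip (nths xs I) (nths ys I) = nths (zip xs ys) I"
    by (induction xs ys arbitrary: I rule: list_induct2) (auto simp: nths_Cons)
  then show ?thesis
    using iso len unfolding order_iso_zip by (auto simp: length_nths dest: in_set_nthsD)
qed

lemma occs_cong_right:
  assumes "order_iso xs ys"
  shows "occs \<pi> xs = occs \<pi> ys"
proof -
  have "order_iso \<pi> (nths xs I) \<longleftrightarrow> order_iso \<pi> (nths ys I)" for I
    using order_iso_nths[OF assms, of I] by (metis order_iso_trans order_iso_sym)
  then show ?thesis by (simp add: occs_def order_iso_length[OF assms])
qed

text \<open>Complementation of text and pattern. The two order-reversing maps are independent
  because permutations are complemented by \<open>Suc n - x\<close> and patterns by
  negation.\<close>

lemma occs_antimono: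
  assumes "\<And>x y. x \<in> set xs \<Longrightarrow> y \<in> set xs \<Longrightarrow> f x < f y \<longleftrightarrow> y < x"
    and "\<And>x y. x \<in> set \<pi> \<Longrightarrow> y \<in> set \<pi> \<Longrightarrow> g x < g y \<longleftrightarrow> y < x"
  shows "occs (map g \<pi>) (map f xs) = occs \<pi> xs"
proof -
  have "order_iso (map g \<pi>) (map f (nths xs I)) \<longleftrightarrow> order_iso \<pi> (nths xs I)" for I
  proof -
    have s: "set (nths xs I) \<subseteq> set xs" by (rule set_nths_subset)
    have f': "\<And>x y. x \<in> set (nths xs I) \<Longrightarrow> y \<in> set (nths xs I) \<Longrightarrow> f x < f y \<longleftrightarrow> y < x"
      using assms(1) s by blast
    show ?thesis
    proof
      assume "order_iso \<pi> (nths xs I)"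
      then show "order_iso (map g \<pi>) (map f (nths xs I))"
        by (rule order_iso_map_antimono) (use f' assms(2) in auto)
    next
      assume "order_iso (map g \<pi>) (map f (nths xs I))"
      then have *: "length \<pi> = length (nths xs I)"
        "\<And>i j. i < length \<pi> \<Longrightarrow> j < length \<pi> \<Longrightarrow>
           g (\<pi> ! i) < g (\<pi> ! j) \<longleftrightarrow> f (nths xs I ! i) < f (nths xs I ! j)"
        by (auto simp: order_iso_def)
      have "\<pi> ! i < \<pi> ! j \<longleftrightarrow> nths xs I ! i < nths xs I ! j" if "i < length \<pi>" "j < length \<pi>" for i j
        using that *(1) *(2)[of j i] assms(2)[of "\<pi> ! j" "\<pi> ! i"]
          f'[of "nths xs I ! j" "nths xs I ! i"] by simp
      then show "order_iso \<pi> (nths xs I)" using *(1) by (simp add: order_iso_def)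
    qed
  qed
  then show ?thesis by (simp add: occs_def nths_map)
qed

section \<open>Decomposition of separable permutations\<close>

text \<open>Stated for lists over any linear order, so that it applies to blocks and to negated
  lists without standardizing them.\<close>

definition avoiding :: "'a::linorder list \<Rightarrow> bool" where
  "avoiding xs \<longleftrightarrow> occs [2, 4, 1, 3 :: int] xs = {} \<and> occs [3, 1, 4, 2 :: int] xs = {}"

definition sum_dec :: "'a::linorder list \<Rightarrow> bool" where
  "sum_dec xs \<longleftrightarrow> (\<exists>us vs. us \<noteq> [] \<and> vs \<noteq> [] \<and> xs = us @ vs \<and> us \<lless> vs)"

definition skew_dec :: "'a::linorder list \<Rightarrow> bool" where
  "skew_dec xs \<longleftrightarrow> (\<exists>us vs. us \<noteq> [] \<and> vs \<noteq> [] \<and> xs = us @ vs \<and> vs \<lless> us)"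

lemma occs_empty_iff: "occs \<pi> xs = {} \<longleftrightarrow> \<not> (\<exists>ys. subseq ys xs \<and> order_iso \<pi> ys)"
proof -
  have "I \<inter> {..<length xs} \<in> occs \<pi> xs" if "order_iso \<pi> (nths xs I)" for I
  proof -
    have "nths xs (I \<inter> {..<length xs}) = nths xs I"
      unfolding nths_def by (rule arg_cong[where f = "map fst"], rule filter_cong) (auto simp: set_zip)
    then show ?thesis using that by (simp add: occs_def)
  qed
  then show ?thesis
    by (auto simp: subseq_conv_nths occs_def)
qed

lemma avoiding_subseq: "avoiding xs \<Longrightarrow> subseq ys xs \<Longrightarrow> avoiding ys"
  unfolding avoiding_def occs_empty_iff using subseq_order.trans by blast

lemma splits1_trivial:
  assumes "\<And>i. 0 < i \<Longrightarrow> i < length \<pi> \<Longrightarrow> \<not> take i \<pi> \<lless> drop i \<pi>"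
  shows "splits1 \<pi> = {([], \<pi>), (\<pi>, [])}"
proof (intro equalityI subsetI)
  fix p assume p: "p \<in> splits1 \<pi>"
  then obtain i where i: "i \<le> length \<pi>" "p = (take i \<pi>, drop i \<pi>)" using splits1_subset by blast
  then have "take i \<pi> \<lless> drop i \<pi>" using p by (simp add: splits1_def)
  then have "i = 0 \<or> i = length \<pi>" using assms[of i] i by linarith
  then show "p \<in> {([], \<pi>), (\<pi>, [])}" using i by auto
qed (auto simp: splits1_def list_below_def)

text \<open>Both 2413 and 3142 are sum-indecomposable: they split only trivially, hence an
  occurrence in a direct sum lies entirely in one of the two blocks.\<close>

lemma avoiding_append:
  assumes "us \<lless> vs"
  shows "avoiding (us @ vs) \<longleftrightarrow> avoiding us \<and> avoiding vs"
proof -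
  have "take i [2, 4, 1, 3 :: int] \<lless> drop i [2, 4, 1, 3] \<Longrightarrow> i = 0 \<or> i \<ge> 4" for i
    by (cases i rule: nat.exhaust; simp; rename_tac j; case_tac j; simp add: list_below_def;
        rename_tac k; case_tac k; simp; rename_tac l; case_tac l; simp)
  then have 1: "splits1 [2, 4, 1, 3 :: int] = {([], [2, 4, 1, 3]), ([2, 4, 1, 3], [])}"
    by (intro splits1_trivial) force
  have "take i [3, 1, 4, 2 :: int] \<lless> drop i [3, 1, 4, 2] \<Longrightarrow> i = 0 \<or> i \<ge> 4" for i
    by (cases i rule: nat.exhaust; simp; rename_tac j; case_tac j; simp add: list_below_def;
        rename_tac k; case_tac k; simp; rename_tac l; case_tac l; simp)
  then have 2: "splits1 [3, 1, 4, 2 :: int] = {([], [3, 1, 4, 2]), ([3, 1, 4, 2], [])}"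
    by (intro splits1_trivial) force
  have *: "occs \<pi> (us @ vs) = {} \<longleftrightarrow> occs \<pi> us = {} \<and> occs \<pi> vs = {}"
    if "splits1 \<pi> = {([], \<pi>), (\<pi>, [])}" "\<pi> \<noteq> []" for \<pi> :: "int list"
  proof -
    have "card (occs \<pi> (us @ vs)) = card (occs \<pi> vs) + card (occs \<pi> us)"
      using card_occs_append[OF assms, of \<pi>] that by simp
    then show ?thesis by (metis add_is_0 card_0_eq finite_occs)
  qed
  show ?thesis
    unfolding avoiding_def using *[OF 1] *[OF 2] by auto
qed

lemma avoiding_cong: "order_iso xs ys \<Longrightarrow> avoiding xs \<longleftrightarrow> avoiding ys"
  by (simp add: avoiding_def occs_cong_right)

lemma avoiding_antimono:
  assumes "\<And>x y. x \<in> set xs \<Longrightarrow> y \<in> set xs \<Longrightarrow> f x < f y \<longleftrightarrow> y < x"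
  shows "avoiding (map f xs) \<longleftrightarrow> avoiding xs"
proof -
  have *: "occs (map uminus \<pi>) (map f xs) = occs \<pi> xs" for \<pi> :: "int list"
    by (rule occs_antimono) (use assms in auto)
  have "order_iso [3, 1, 4, 2 :: int] (map uminus [2, 4, 1, 3 :: int])"
    "order_iso [2, 4, 1, 3 :: int] (map uminus [3, 1, 4, 2 :: int])"
    by (auto simp: order_iso_def less_Suc_eq numeral_eq_Suc)
  then show ?thesis
    unfolding avoiding_def using *[of "[2, 4, 1, 3]"] *[of "[3, 1, 4, 2]"] occs_cong_left by blast
qed

text \<open>A shortest admissible first block works, since decomposing it further would produce a
  shorter one.\<close>

lemma sum_dec_first_component:
  assumes "sum_dec xs"
  obtains a b where "a \<noteq> []" "b \<noteq> []" "xs = a @ b" "a \<lless> b" "\<not> sum_dec a"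
proof -
  define P where "P l \<longleftrightarrow> (\<exists>us vs. length us = l \<and> us \<noteq> [] \<and> vs \<noteq> [] \<and> xs = us @ vs \<and> us \<lless> vs)" for l
  have "\<exists>l. P l" using assms by (auto simp: P_def sum_dec_def)
  then have "P (LEAST l. P l)" by (rule LeastI_ex)
  then obtain a b where ab: "length a = (LEAST l. P l)" "a \<noteq> []" "b \<noteq> []" "xs = a @ b" "a \<lless> b"
    by (auto simp: P_def)
  have "\<not> sum_dec a"
  proof
    assume "sum_dec a"
    then obtain us vs where uv: "us \<noteq> []" "vs \<noteq> []" "a = us @ vs" "us \<lless> vs" by (auto simp: sum_dec_def)
    have "us \<lless> vs @ b" using uv ab by (auto simp: list_below_def)
    then have "P (length us)" unfolding P_def using uv ab by (intro exI[of _ us] exI[of _ "vs @ b"]) auto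
    then have "length a \<le> length us" unfolding ab(1) by (rule Least_le)
    then show False using uv by simp
  qed
  then show ?thesis using ab that by blast
qed

text \<open>If the last entry \<open>v\<close> separates the values of the first component \<open>a\<close>, then an entry of \<open>a\<close>
  above \<open>v\<close>, one below \<open>v\<close>, a later entry and \<open>v\<close> itself form the pattern 3142.\<close>

lemma avoiding_dec_snoc:
  fixes ys :: "'a::linorder list"
  assumes dist: "distinct (ys @ [v])" and av: "avoiding (ys @ [v])" and dec: "sum_dec ys"
    and IH: "\<And>xs :: 'a list. distinct xs \<Longrightarrow> avoiding xs \<Longrightarrow> 2 \<le> length xs \<Longrightarrow> length xs \<le> length ys \<Longrightarrow>
               sum_dec xs \<or> skew_dec xs"
  shows "sum_dec (ys @ [v]) \<or> skew_dec (ys @ [v])"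
proof -
  obtain a b where ab: "a \<noteq> []" "b \<noteq> []" "ys = a @ b" "a \<lless> b" and indec: "\<not> sum_dec a"
    by (rule sum_dec_first_component[OF dec])
  show ?thesis
  proof (cases "a \<lless> [v]")
    case True
    then have "a \<lless> b @ [v]" using ab by (auto simp: list_below_def)
    then show ?thesis using ab unfolding sum_dec_def
      by (intro disjI1 exI[of _ a] exI[of _ "b @ [v]"]) auto
  next
    case False
    then obtain x where x: "x \<in> set a" "\<not> x < v" by (auto simp: list_below_def)
    then have xv: "v < x" using dist ab by auto
    show ?thesis
    proof (cases "[v] \<lless> ys")
      case True
      moreover have "ys \<noteq> []" using ab by simp
      ultimately show ?thesis unfolding skew_dec_def by blast
    next
      case False
      then obtain y where y: "y \<in> set ys" "\<not> v < y" by (auto simp: list_below_def)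
      then have yv: "y < v" using dist by (metis distinct_append list.set_intros(1) disjoint_iff linorder_neqE)
      have "y \<notin> set b" using xv yv x ab(4) by (force simp: list_below_def)
      then have ya: "y \<in> set a" using y ab by auto
      have "x \<noteq> y" using xv yv by auto
      have "2 \<le> length a"
        using x ya \<open>x \<noteq> y\<close> by (cases a; cases "tl a") auto
      moreover have "avoiding a" by (rule avoiding_subseq[OF av]) (simp add: ab prefix_imp_subseq)
      ultimately have "skew_dec a" using IH[of a] indec dist ab by auto
      then obtain g1 g2 where g: "g1 \<noteq> []" "g2 \<noteq> []" "a = g1 @ g2" "g2 \<lless> g1"
        by (auto simp: skew_dec_def)
      \<comment> \<open>All of \<open>g1\<close> exceeds all of \<open>g2\<close>, so an entry above
        \<open>v\<close> can be moved into \<open>g1\<close> and, below, one under \<open>v\<close>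
        into \<open>g2\<close>. This puts the high entry before the low one, as 3142
        requires.\<close>
      have "\<exists>x'\<in>set g1. v < x'"
      proof (cases "x \<in> set g1")
        case False
        then have "x \<in> set g2" using x g by auto
        then show ?thesis using g xv by (metis hd_in_set list_below_def order.strict_trans)
      qed (use xv in auto)
      then obtain x' where x': "x' \<in> set g1" "v < x'" by blast
      have "\<exists>y'\<in>set g2. y' < v"
      proof (cases "y \<in> set g2")
        case False
        then have "y \<in> set g1" using ya g by auto
        then show ?thesis using g yv by (metis hd_in_set list_below_def order.strict_trans)
      qed (use yv in auto)
      then obtain y' where y': "y' \<in> set g2" "y' < v" by blast
      obtain d where d: "d \<in> set b" using ab by (meson list.set_sel(1))
      have "x' < d" using d x' ab g by (auto simp: list_below_def)
      have "subseq ([x'] @ [y'] @ [d] @ [v]) (g1 @ g2 @ b @ [v])"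
        using x' y' d by (intro list_emb_append_mono) (auto simp: subseq_singleton_left)
      moreover have "order_iso [3, 1, 4, 2 :: int] ([x'] @ [y'] @ [d] @ [v])"
        using x' y' \<open>x' < d\<close> by (auto simp: order_iso_def less_Suc_eq numeral_eq_Suc)
      ultimately have "\<not> avoiding (ys @ [v])"
        unfolding avoiding_def occs_empty_iff using ab g by auto
      then show ?thesis using av by simp
    qed
  qed
qed

lemma sum_dec_antimono:
  assumes "\<And>x y. x \<in> set xs \<Longrightarrow> y \<in> set xs \<Longrightarrow> f x < f y \<longleftrightarrow> y < x"
  shows "sum_dec (map f xs) \<longleftrightarrow> skew_dec xs"
proof
  assume "sum_dec (map f xs)"
  then obtain us vs where uv: "us \<noteq> []" "vs \<noteq> []" "map f xs = us @ vs" "us \<lless> vs"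
    by (auto simp: sum_dec_def)
  then obtain us' vs' where "xs = us' @ vs'" "us = map f us'" "vs = map f vs'"
    by (auto simp: map_eq_append_conv)
  then show "skew_dec xs" using uv assms unfolding skew_dec_def
    by (intro exI[of _ us'] exI[of _ vs']) (auto simp: list_below_def)
next
  assume "skew_dec xs"
  then obtain us vs where uv: "us \<noteq> []" "vs \<noteq> []" "xs = us @ vs" "vs \<lless> us"
    by (auto simp: skew_dec_def)
  then show "sum_dec (map f xs)" using assms unfolding sum_dec_def
    by (intro exI[of _ "map f us"] exI[of _ "map f vs"]) (auto simp: list_below_def)
qed

lemma skew_dec_antimono:
  assumes "\<And>x y. x \<in> set xs \<Longrightarrow> y \<in> set xs \<Longrightarrow> f x < f y \<longleftrightarrow> y < x"
  shows "skew_dec (map f xs) \<longleftrightarrow> sum_dec xs"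
proof
  assume "skew_dec (map f xs)"
  then obtain us vs where uv: "us \<noteq> []" "vs \<noteq> []" "map f xs = us @ vs" "vs \<lless> us"
    by (auto simp: skew_dec_def)
  then obtain us' vs' where "xs = us' @ vs'" "us = map f us'" "vs = map f vs'"
    by (auto simp: map_eq_append_conv)
  then show "sum_dec xs" using uv assms unfolding sum_dec_def
    by (intro exI[of _ us'] exI[of _ vs']) (auto simp: list_below_def)
next
  assume "sum_dec xs"
  then obtain us vs where uv: "us \<noteq> []" "vs \<noteq> []" "xs = us @ vs" "us \<lless> vs"
    by (auto simp: sum_dec_def)
  then show "skew_dec (map f xs)" using assms unfolding skew_dec_def
    by (intro exI[of _ "map f us"] exI[of _ "map f vs"]) (auto simp: list_below_def)
qed

text \<open>Induction on the list without its last entry. If that shorter list is skew-decomposable,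
  negation turns it into the sum-decomposable case, which is why the entries are integers.\<close>

lemma avoiding_decomposable_int:
  fixes xs :: "int list"
  shows "distinct xs \<Longrightarrow> avoiding xs \<Longrightarrow> 2 \<le> length xs \<Longrightarrow> sum_dec xs \<or> skew_dec xs"
proof (induction "length xs" arbitrary: xs rule: less_induct)
  case less
  obtain ys v where ys: "xs = ys @ [v]" using less.prems(3) by (cases xs rule: rev_cases) auto
  show ?case
  proof (cases "length ys \<ge> 2")
    case True
    have av: "avoiding ys" by (rule avoiding_subseq[OF less.prems(2)]) (simp add: ys prefix_imp_subseq)
    have IH: "sum_dec zs \<or> skew_dec zs"
      if "distinct zs" "avoiding zs" "2 \<le> length zs" "length zs \<le> length ys" for zs :: "int list"
      using less.hyps[of zs] that ys by simp
    consider "sum_dec ys" | "skew_dec ys" using IH[of ys] True less.prems av ys by auto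
    then show ?thesis
    proof cases
      case 1
      then show ?thesis using avoiding_dec_snoc[of ys v] less.prems IH ys by blast
    next
      case 2
      have "sum_dec (map uminus ys)" using 2 by (subst sum_dec_antimono) auto
      moreover have "avoiding (map uminus xs)" using less.prems(2) by (subst avoiding_antimono) auto
      moreover have "distinct (map uminus xs)" using less.prems(1) by (simp add: distinct_map)
      ultimately have "sum_dec (map uminus xs) \<or> skew_dec (map uminus xs)"
        using avoiding_dec_snoc[of "map uminus ys" "- v"] IH ys by simp
      then show ?thesis
        using sum_dec_antimono[of xs uminus] skew_dec_antimono[of xs uminus] by auto
    qed
  next
    case False
    then obtain u where "ys = [u]" using less.prems ys by (cases ys; cases "tl ys") auto
    then have "xs = [u] @ [v]" "u \<noteq> v" using ys less.prems by auto
    then have "[u] \<lless> [v] \<or> [v] \<lless> [u]" by (auto simp: list_below_def)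
    then show ?thesis unfolding sum_dec_def skew_dec_def \<open>xs = [u] @ [v]\<close> by blast
  qed
qed

text \<open>Transfer from the integers along the order-reversing map \<open>- int x\<close>, which
  exchanges the two alternatives.\<close>

lemma avoiding_decomposable:
  fixes xs :: "nat list"
  assumes "distinct xs" "avoiding xs" "2 \<le> length xs"
  shows "sum_dec xs \<or> skew_dec xs"
proof -
  have anti: "- int x < - int y \<longleftrightarrow> y < x" for x y by auto
  define f where "f = (\<lambda>x. - int x)"
  have "sum_dec (map f xs) \<or> skew_dec (map f xs)"
    by (rule avoiding_decomposable_int) (use assms anti in \<open>auto simp: f_def avoiding_antimono distinct_map inj_on_def\<close>)
  then show ?thesis
    using sum_dec_antimono[of xs f] skew_dec_antimono[of xs f] anti by (auto simp: f_def)
qed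

text \<open>A sum decomposition puts the first entry below the last one, a skew decomposition puts
  it above.\<close>

lemma not_sum_and_skew: "\<not> (sum_dec xs \<and> skew_dec xs)"
proof
  assume "sum_dec xs \<and> skew_dec xs"
  then obtain us vs us' vs' where *: "us \<noteq> []" "vs \<noteq> []" "xs = us @ vs" "us \<lless> vs"
    "us' \<noteq> []" "vs' \<noteq> []" "xs = us' @ vs'" "vs' \<lless> us'" by (auto simp: sum_dec_def skew_dec_def)
  have "hd xs \<in> set us" "last xs \<in> set vs" "hd xs \<in> set us'" "last xs \<in> set vs'"
    using * by (metis hd_append2 hd_in_set last_appendR last_in_set)+
  then show False using *(4,8) by (meson list_below_def order.asym)
qed

section \<open>Standardization, pattern densities and separability in terms of order
  isomorphism\<close>

lemma order_iso_standardize: "order_iso (standardize xs) xs"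
  by (auto simp: order_iso_def standardize_same_order)

text \<open>For distinct entries the rank of a value equals the number of positions with a value at
  most as large, and this number depends only on the relative order.\<close>

lemma standardize_cong:
  assumes iso: "order_iso xs ys" and dist: "distinct xs"
  shows "standardize xs = standardize ys"
proof -
  have len: "length xs = length ys" using iso by (simp add: order_iso_def)
  have lt: "xs ! i < xs ! j \<longleftrightarrow> ys ! i < ys ! j" if "i < length xs" "j < length xs" for i j
    using iso that by (simp add: order_iso_def)
  have le: "xs ! j \<le> xs ! i \<longleftrightarrow> ys ! j \<le> ys ! i" if "i < length xs" "j < length xs" for i j
    using lt[OF that] by linarith
  have dist': "distinct ys"
    unfolding distinct_conv_nth
    by (metis dist distinct_conv_nth lt len linorder_neqE order.irrefl)
  have card: "card {y \<in> set zs. y \<le> zs ! i} = card {j. j < length zs \<and> zs ! j \<le> zs ! i}"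
    if "distinct zs" for zs :: "nat list" and i
  proof -
    have "{y \<in> set zs. y \<le> zs ! i} = (!) zs ` {j. j < length zs \<and> zs ! j \<le> zs ! i}"
      by (auto simp: in_set_conv_nth)
    moreover have "inj_on ((!) zs) {j. j < length zs \<and> zs ! j \<le> zs ! i}"
      using that by (auto simp: inj_on_def nth_eq_iff_index_eq)
    ultimately show ?thesis by (simp add: card_image)
  qed
  show ?thesis
  proof (rule nth_equalityI)
    fix i assume i: "i < length (standardize xs)"
    then have "{j. j < length xs \<and> xs ! j \<le> xs ! i} = {j. j < length ys \<and> ys ! j \<le> ys ! i}"
      using le len by auto
    then show "standardize xs ! i = standardize ys ! i"
      using i len by (simp add: standardize_def card[OF dist] card[OF dist'])
  qed (use len in simp)
qed

lemma standardize_perm_id: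
  assumes "\<pi> \<in> permutations_of_set {1..n}"
  shows "standardize \<pi> = \<pi>"
proof -
  have "set \<pi> = {1..n}" using assms by (simp add: permutations_of_set_def)
  then have "card {y \<in> set \<pi>. y \<le> x} = x" if "x \<in> set \<pi>" for x
  proof -
    have "{y \<in> set \<pi>. y \<le> x} = {1..x}" using that \<open>set \<pi> = {1..n}\<close> by auto
    then show ?thesis by simp
  qed
  then show ?thesis unfolding standardize_def by (simp add: map_idI)
qed

lemma pat_eq_iff:
  assumes "\<pi> \<in> permutations_of_set {1..n}"
  shows "pat I \<sigma> = \<pi> \<longleftrightarrow> order_iso \<pi> (nths \<sigma> I)"
proof
  assume "pat I \<sigma> = \<pi>"
  then show "order_iso \<pi> (nths \<sigma> I)" using order_iso_standardize by (auto simp: pat_def)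
next
  assume "order_iso \<pi> (nths \<sigma> I)"
  then show "pat I \<sigma> = \<pi>"
    using standardize_cong[of \<pi>] standardize_perm_id[OF assms] assms
    by (auto simp: pat_def permutations_of_set_def)
qed

text \<open>The case distinction in \<open>occ\<close> disappears: a pattern longer than \<sigma>
  has no occurrence, and the quotient is then 0 divided by 0, which is 0.\<close>

lemma occ_eq_card_occs:
  assumes "\<pi> \<in> permutations_of_set {1..n}"
  shows "occ \<pi> \<sigma> = real (card (occs (map int \<pi>) \<sigma>)) / real (length \<sigma> choose length \<pi>)"
proof -
  have "order_iso (map int \<pi>) \<pi>" by (auto simp: order_iso_def)
  then have *: "occs (map int \<pi>) \<sigma> = occs \<pi> \<sigma>" by (rule occs_cong_left)
  have "{I. I \<subseteq> {..<length \<sigma>} \<and> card I = length \<pi> \<and> pat I \<sigma> = \<pi>} = occs \<pi> \<sigma>"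
    using occs_card[of _ \<pi> \<sigma>] by (auto simp: pat_eq_iff[OF assms] occs_def)
  then show ?thesis
    unfolding occ_def * by (auto simp: occs_long)
qed

lemma separable_iff_avoiding: "separable \<sigma> \<longleftrightarrow> avoiding \<sigma>"
proof -
  have p1: "[2, 4, 1, 3 :: nat] \<in> permutations_of_set {1..4}"
    and p2: "[3, 1, 4, 2 :: nat] \<in> permutations_of_set {1..4}"
    by (auto simp: permutations_of_set_def)
  have *: "occ \<pi> \<sigma> = 0 \<longleftrightarrow> occs (map int \<pi>) \<sigma> = {}" if "\<pi> \<in> permutations_of_set {1..n}" for \<pi> n
  proof (cases "length \<pi> \<le> length \<sigma>")
    case True
    then show ?thesis using occ_eq_card_occs[OF that, of \<sigma>] by simp
  next
    case False
    then show ?thesis using occ_eq_card_occs[OF that, of \<sigma>] occs_long[of \<sigma> "map int \<pi>"] by simp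
  qed
  show ?thesis
    using *[OF p1] *[OF p2] by (simp add: separable_def avoids_def avoiding_def)
qed

section \<open>Joint occurrences of several patterns in a direct sum\<close>

definition occ_prod :: "int list list \<Rightarrow> 'a::linorder list \<Rightarrow> real" where
  "occ_prod q \<sigma> = (\<Prod>\<pi>\<leftarrow>q. real (card (occs \<pi> \<sigma>)))"

text \<open>One split per pattern, chosen independently. As a list of pairs, its projections
  \<open>map fst\<close> and \<open>map snd\<close> are again lists of patterns, one for each
  block.\<close>

definition splits :: "int list list \<Rightarrow> (int list \<times> int list) list set" where
  "splits q = listset (map splits1 q)"

lemma splits_Nil [simp]: "splits [] = {[]}"
  by (simp add: splits_def)

lemma splits_Cons: "splits (\<pi> # q) = (\<lambda>(x, p). x # p) ` (splits1 \<pi> \<times> splits q)"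
  by (auto simp: splits_def set_Cons_def)

lemma finite_splits [simp]: "finite (splits q)"
  by (induction q) (simp_all add: splits_Cons)

lemma sum_splits_Cons:
  "(\<Sum>p\<in>splits (\<pi> # q). f p) = (\<Sum>x\<in>splits1 \<pi>. \<Sum>p\<in>splits q. f (x # p))"
proof -
  have "inj_on (\<lambda>(x, p). x # p) (splits1 \<pi> \<times> splits q)" by (auto simp: inj_on_def)
  then have "(\<Sum>p\<in>splits (\<pi> # q). f p) = (\<Sum>z\<in>splits1 \<pi> \<times> splits q. f (case z of (x, p) \<Rightarrow> x # p))"
    unfolding splits_Cons by (rule sum.reindex_cong) auto
  then show ?thesis by (simp add: sum.cartesian_product case_prod_beta)
qed

lemma occ_prod_append:
  assumes "us \<lless> vs"
  shows "occ_prod q (us @ vs) = (\<Sum>p\<in>splits q. occ_prod (map fst p) us * occ_prod (map snd p) vs)"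
proof (induction q)
  case Nil
  then show ?case by (simp add: occ_prod_def)
next
  case (Cons \<pi> q)
  have "occ_prod (\<pi> # q) (us @ vs) = real (card (occs \<pi> (us @ vs))) * occ_prod q (us @ vs)"
    by (simp add: occ_prod_def)
  also have "real (card (occs \<pi> (us @ vs)))
     = (\<Sum>x\<in>splits1 \<pi>. real (card (occs (fst x) us)) * real (card (occs (snd x) vs)))"
    by (simp add: card_occs_append[OF assms] case_prod_beta)
  also have "\<dots> * occ_prod q (us @ vs) = (\<Sum>x\<in>splits1 \<pi>. \<Sum>p\<in>splits q.
      (real (card (occs (fst x) us)) * real (card (occs (snd x) vs))) *
      (occ_prod (map fst p) us * occ_prod (map snd p) vs))"
    unfolding Cons.IH by (rule sum_product)
  also have "\<dots> = (\<Sum>p\<in>splits (\<pi> # q). occ_prod (map fst p) us * occ_prod (map snd p) vs)"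
    by (simp add: sum_splits_Cons occ_prod_def mult_ac)
  finally show ?case .
qed

lemma occ_prod_cong_right: "order_iso xs ys \<Longrightarrow> occ_prod q xs = occ_prod q ys"
  by (simp add: occ_prod_def occs_cong_right)

definition indec_perms :: "nat \<Rightarrow> nat list set" where
  "indec_perms n = {\<sigma> \<in> separable_perms n. \<not> sum_dec \<sigma>}"

lemma separable_perms_iff:
  "\<sigma> \<in> separable_perms n \<longleftrightarrow> distinct \<sigma> \<and> set \<sigma> = {1..n} \<and> avoiding \<sigma>"
  by (auto simp: separable_perms_def permutations_of_set_def separable_iff_avoiding)

lemma separable_perms_length: "\<sigma> \<in> separable_perms n \<Longrightarrow> length \<sigma> = n"
  unfolding separable_perms_iff by (metis card_atLeastAtMost diff_Suc_1 distinct_card)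

lemma finite_indec_perms [simp]: "finite (indec_perms n)"
  by (simp add: indec_perms_def finite_separable_perms)

lemma order_iso_map_plus: "order_iso (map ((+) (n::nat)) xs) xs"
  by (rule order_iso_map_mono) auto

text \<open>A sum-decomposable permutation is, in exactly one way, a sum-indecomposable first
  component followed by a shifted nonempty separable permutation.\<close>

lemma sum_over_sum_dec:
  fixes f :: "nat list \<Rightarrow> 'a::comm_monoid_add"
  shows "(\<Sum>\<sigma> | \<sigma> \<in> separable_perms n \<and> sum_dec \<sigma>. f \<sigma>) =
         (\<Sum>i=1..<n. \<Sum>\<tau>\<in>indec_perms i. \<Sum>\<rho>\<in>separable_perms (n - i). f (\<tau> @ map ((+) i) \<rho>))"
proof -
  define Z where "Z = (SIGMA i:{1..<n}. indec_perms i \<times> separable_perms (n - i))"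
  define h where "h = (\<lambda>(i::nat, t :: nat list, r). t @ map ((+) i) r)"
  define T where "T = {\<sigma> \<in> separable_perms n. sum_dec \<sigma>}"
  have "inj_on h Z"
  proof (rule inj_onI)
    fix z z' assume zz: "z \<in> Z" "z' \<in> Z" "h z = h z'"
    obtain i t r where z: "z = (i, t, r)" by (cases z) auto
    obtain i' t' r' where z': "z' = (i', t', r')" by (cases z') auto
    have i: "length t = i" "length t' = i'" "1 \<le> i" "1 \<le> i'"
      "t \<in> indec_perms i" "t' \<in> indec_perms i'" "set t = {1..i}" "set t' = {1..i'}"
      using zz separable_perms_length
      by (auto simp: z z' Z_def indec_perms_def separable_perms_iff)
    have eq: "t @ map ((+) i) r = t' @ map ((+) i') r'" using zz by (simp add: h_def z z')
    \<comment> \<open>Of two candidate first components the shorter is a prefix of the longer. Its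
      values are an initial interval, so the longer one would be sum-decomposable.\<close>
    have key: False if hyp: "length t1 < length t2" "t1 @ s1 = t2 @ s2" "t1 \<noteq> []" "\<not> sum_dec t2" "set t1 = {1..l}"
       "distinct t2" "set t2 = {1..m}" for t1 t2 s1 s2 :: "nat list" and l m
    proof -
      obtain w where w: "t2 = t1 @ w" using hyp(1,2) by (auto simp: append_eq_append_conv2)
      have "w \<noteq> []" using w that by auto
      moreover have "t1 \<lless> w" unfolding list_below_def
      proof (intro ballI)
        fix u v assume uv: "u \<in> set t1" "v \<in> set w"
        then have "v \<notin> set t1" "v \<in> set t2" using w that(6) by auto
        then show "u < v" using uv that by auto
      qed
      ultimately show False using w that unfolding sum_dec_def by blast
    qed
    have "length t = length t'"
    proof (rule ccontr)
      assume "length t \<noteq> length t'"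
      then consider "length t < length t'" | "length t' < length t" by linarith
      then show False
      proof cases
        case 1 show False
          by (rule key[OF 1 eq]) (use i in \<open>auto simp: indec_perms_def separable_perms_iff\<close>)
      next
        case 2 show False
          by (rule key[OF 2 eq[symmetric]]) (use i in \<open>auto simp: indec_perms_def separable_perms_iff\<close>)
      qed
    qed
    then have "i = i'" "t = t'" "map ((+) i) r = map ((+) i') r'" using eq i by auto
    then show "z = z'" by (auto simp: z z' inj_on_def dest!: map_injective)
  qed
  moreover have "h ` Z = T"
  proof (intro equalityI subsetI)
    fix s assume "s \<in> h ` Z"
    then obtain i t r where s: "s = t @ map ((+) i) r" "1 \<le> i" "i < n" "t \<in> indec_perms i"
      "r \<in> separable_perms (n - i)" by (auto simp: Z_def h_def)
    then have t: "distinct t" "set t = {1..i}" "avoiding t"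
      and r: "distinct r" "set r = {1..n - i}" "avoiding r"
      by (auto simp: indec_perms_def separable_perms_iff)
    have below: "t \<lless> map ((+) i) r" using t r by (auto simp: list_below_def)
    have "avoiding (map ((+) i) r)" using r avoiding_cong[OF order_iso_map_plus] by blast
    then have "avoiding s" using below t s(1) by (simp add: avoiding_append)
    moreover have "set s = {1..n}"
    proof -
      have "(+) i ` {1..n - i} = {i + 1..n}" using s(3) by (simp add: image_add_atLeastAtMost)
      then show ?thesis using s(1,2,3) t r by auto
    qed
    moreover have "distinct s" using s(1) t r by (auto simp: distinct_map)
    moreover have "sum_dec s"
      unfolding sum_dec_def using below s t r
      by (intro exI[of _ t] exI[of _ "map ((+) i) r"]) auto
    ultimately show "s \<in> T" by (simp add: T_def separable_perms_iff)
  next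
    fix s assume "s \<in> T"
    then have s: "distinct s" "set s = {1..n}" "avoiding s" "sum_dec s"
      by (auto simp: T_def separable_perms_iff)
    obtain a b where ab: "a \<noteq> []" "b \<noteq> []" "s = a @ b" "a \<lless> b" and indec: "\<not> sum_dec a"
      by (rule sum_dec_first_component[OF s(4)])
    \<comment> \<open>The first block lies below the rest, so its values form an initial interval of
      \<open>{1..n}\<close>, and the largest of them is the size of the block.\<close>
    define i where "i = Max (set a)"
    have mi: "i \<in> set a" "\<And>x. x \<in> set a \<Longrightarrow> x \<le> i" using ab by (auto simp: i_def)
    have sa: "set a = {1..i}" "set b = {i + 1..n}"
    proof -
      have u: "set a \<union> set b = {1..n}" using s ab by simp
      have bi: "x > i" if "x \<in> set b" for x using that ab mi by (auto simp: list_below_def)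
      have "i \<le> n" using mi u by auto
      show "set a = {1..i}"
      proof (intro equalityI subsetI)
        fix x assume "x \<in> {1..i}"
        then have "x \<in> set a \<union> set b" using u \<open>i \<le> n\<close> by auto
        then show "x \<in> set a" using bi[of x] \<open>x \<in> {1..i}\<close> by auto
      qed (use mi u in auto)
      show "set b = {i + 1..n}"
      proof (intro equalityI subsetI)
        fix x assume "x \<in> {i + 1..n}"
        then have "x \<in> set a \<union> set b" using u by auto
        then show "x \<in> set b" using mi(2)[of x] \<open>x \<in> {i + 1..n}\<close> by auto
      qed (use bi u in force)
    qed
    have "b = map ((+) i) (map (\<lambda>x. x - i) b)" unfolding map_map
      by (rule map_idI[symmetric]) (use sa in auto)
    moreover have "map (\<lambda>x. x - i) b \<in> separable_perms (n - i)"
      unfolding separable_perms_iff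
    proof (intro conjI)
      show "distinct (map (\<lambda>x. x - i) b)" using s ab sa by (auto simp: distinct_map inj_on_def)
      show "set (map (\<lambda>x. x - i) b) = {1..n - i}"
      proof -
        have "(\<lambda>x. x - i) ` {i + 1..n} = {1..n - i}"
        proof (intro equalityI subsetI)
          fix y assume "y \<in> {1..n - i}"
          then show "y \<in> (\<lambda>x. x - i) ` {i + 1..n}" by (intro image_eqI[of _ _ "y + i"]) auto
        qed auto
        then show ?thesis using sa by simp
      qed
      have "avoiding b" using s(3) ab by (simp add: avoiding_append)
      moreover have "order_iso (map (\<lambda>x. x - i) b) b" by (rule order_iso_map_mono) (use sa in auto)
      ultimately show "avoiding (map (\<lambda>x. x - i) b)" using avoiding_cong by blast
    qed
    moreover have "a \<in> indec_perms i"
      using s ab sa indec by (simp add: indec_perms_def separable_perms_iff avoiding_append)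
    moreover have "1 \<le> i" using mi(1) sa(1) by simp
    moreover have "i < n" using hd_in_set[OF ab(2)] sa(2) by simp
    ultimately have "(i, a, map (\<lambda>x. x - i) b) \<in> Z" "s = h (i, a, map (\<lambda>x. x - i) b)"
      using ab by (auto simp: Z_def h_def)
    then show "s \<in> h ` Z" by blast
  qed
  ultimately have "sum f T = (\<Sum>z\<in>Z. f (h z))" by (intro sum.reindex_cong) auto
  also have "\<dots> = (\<Sum>i=1..<n. \<Sum>\<tau>\<in>indec_perms i. \<Sum>\<rho>\<in>separable_perms (n - i). f (\<tau> @ map ((+) i) \<rho>))"
    unfolding Z_def h_def
    by (simp add: sum.Sigma sum.cartesian_product case_prod_beta finite_separable_perms)
  finally show ?thesis by (simp add: T_def)
qed

section \<open>Generating functions with marked patterns\<close>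

text \<open>Coefficient 0 excludes the empty permutation, because both blocks of a decomposition are
  nonempty.\<close>

definition sep_gf :: "int list list \<Rightarrow> real fps" where
  "sep_gf q = Abs_fps (\<lambda>n. if n = 0 then 0 else \<Sum>\<sigma>\<in>separable_perms n. occ_prod q \<sigma>)"

definition indec_gf :: "int list list \<Rightarrow> real fps" where
  "indec_gf q = Abs_fps (\<lambda>n. if n = 0 then 0 else \<Sum>\<sigma>\<in>indec_perms n. occ_prod q \<sigma>)"

text \<open>Patterns are lists of integers, up to order isomorphism, so that complementation is negation.\<close>

definition neg :: "int list list \<Rightarrow> int list list" where
  "neg q = map (map uminus) q"

definition weight :: "int list list \<Rightarrow> nat" where
  "weight q = sum_list (map length q)"

lemma neg_neg [simp]: "neg (neg q) = q"
  by (induction q) (simp_all add: neg_def comp_def)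

lemma weight_neg [simp]: "weight (neg q) = weight q"
  by (induction q) (simp_all add: neg_def weight_def)

text \<open>Either the permutation is sum-indecomposable, or its first component is cut off and the
  marked occurrences are distributed over the two blocks according to an element of
  \<open>splits q\<close>.\<close>

lemma sep_gf_decomp:
  "sep_gf q = indec_gf q + (\<Sum>p\<in>splits q. indec_gf (map fst p) * sep_gf (map snd p))"
proof (rule fps_ext)
  fix n
  show "sep_gf q $ n = (indec_gf q + (\<Sum>p\<in>splits q. indec_gf (map fst p) * sep_gf (map snd p))) $ n"
  proof (cases "n = 0")
    case True
    then show ?thesis by (simp add: sep_gf_def indec_gf_def fps_sum_nth fps_mult_nth)
  next
    case False
    define f where "f \<sigma> = occ_prod q \<sigma>" for \<sigma> :: "nat list"
    have conv: "(indec_gf a * sep_gf b) $ n =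
      (\<Sum>i=1..<n. \<Sum>\<tau>\<in>indec_perms i. \<Sum>\<rho>\<in>separable_perms (n - i). occ_prod a \<tau> * occ_prod b \<rho>)" for a b
    proof -
      have "(indec_gf a * sep_gf b) $ n = (\<Sum>i=0..n. indec_gf a $ i * sep_gf b $ (n - i))"
        by (simp add: fps_mult_nth)
      also have "\<dots> = (\<Sum>i=1..<n. indec_gf a $ i * sep_gf b $ (n - i))"
        by (rule sum.mono_neutral_right) (auto simp: indec_gf_def sep_gf_def not_le not_less)
      also have "\<dots> = (\<Sum>i=1..<n. \<Sum>\<tau>\<in>indec_perms i. \<Sum>\<rho>\<in>separable_perms (n - i). occ_prod a \<tau> * occ_prod b \<rho>)"
        by (rule sum.cong) (auto simp: indec_gf_def sep_gf_def sum_product)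
      finally show ?thesis .
    qed
    have "(\<Sum>\<sigma>\<in>separable_perms n. f \<sigma>) = (\<Sum>\<sigma>\<in>indec_perms n \<union> {\<sigma> \<in> separable_perms n. sum_dec \<sigma>}. f \<sigma>)"
      by (rule sum.cong) (auto simp: indec_perms_def)
    also have "\<dots> = (\<Sum>\<sigma>\<in>indec_perms n. f \<sigma>) + (\<Sum>\<sigma> | \<sigma> \<in> separable_perms n \<and> sum_dec \<sigma>. f \<sigma>)"
      by (rule sum.union_disjoint) (auto simp: indec_perms_def finite_separable_perms)
    also have "(\<Sum>\<sigma> | \<sigma> \<in> separable_perms n \<and> sum_dec \<sigma>. f \<sigma>) =
      (\<Sum>i=1..<n. \<Sum>\<tau>\<in>indec_perms i. \<Sum>\<rho>\<in>separable_perms (n - i). f (\<tau> @ map ((+) i) \<rho>))"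
      by (rule sum_over_sum_dec)
    also have "\<dots> = (\<Sum>i=1..<n. \<Sum>\<tau>\<in>indec_perms i. \<Sum>\<rho>\<in>separable_perms (n - i).
         \<Sum>p\<in>splits q. occ_prod (map fst p) \<tau> * occ_prod (map snd p) \<rho>)"
    proof (intro sum.cong refl)
      fix i t r assume "i \<in> {1..<n}" "t \<in> indec_perms i" "r \<in> separable_perms (n - i)"
      then have "t \<lless> map ((+) i) r"
        by (auto simp: list_below_def indec_perms_def separable_perms_iff)
      then show "f (t @ map ((+) i) r) = (\<Sum>p\<in>splits q. occ_prod (map fst p) t * occ_prod (map snd p) r)"
        by (simp add: f_def occ_prod_append occ_prod_cong_right[OF order_iso_map_plus])
    qed
    also have "\<dots> = (\<Sum>p\<in>splits q. (indec_gf (map fst p) * sep_gf (map snd p)) $ n)"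
      unfolding conv
      by (subst sum.swap[of _ _ "splits q"], rule sum.cong[OF refl],
          subst sum.swap[of _ _ "splits q"], rule sum.cong[OF refl],
          subst sum.swap[of _ _ "splits q"], rule refl)
    finally show ?thesis
      using False by (simp add: sep_gf_def indec_gf_def fps_sum_nth f_def)
  qed
qed

section \<open>Symmetry under complementation\<close>

lemma occ_prod_antimono:
  assumes "\<And>x y. x \<in> set xs \<Longrightarrow> y \<in> set xs \<Longrightarrow> f x < f y \<longleftrightarrow> y < x"
  shows "occ_prod (neg q) (map f xs) = occ_prod q xs"
proof -
  have "occs (map uminus \<pi>) (map f xs) = occs \<pi> xs" for \<pi> :: "int list"
    by (rule occs_antimono) (use assms in auto)
  then show ?thesis by (simp add: occ_prod_def neg_def comp_def)
qed

text \<open>Complementing the values is an involution on separable permutations that exchanges sum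
  and skew decomposability.\<close>

lemma
  shows separable_perms_compl: "bij_betw (map (\<lambda>x. Suc n - x)) (separable_perms n) (separable_perms n)"
    and indec_perms_compl:
      "bij_betw (map (\<lambda>x. Suc n - x)) {\<sigma> \<in> separable_perms n. \<not> skew_dec \<sigma>} (indec_perms n)"
proof -
  define c where "c = map (\<lambda>x. Suc n - x)"
  have anti: "Suc n - x < Suc n - y \<longleftrightarrow> y < x" if "x \<in> set \<sigma>" "y \<in> set \<sigma>" "\<sigma> \<in> separable_perms n" for x y \<sigma>
    using that unfolding separable_perms_iff by auto
  have cc: "c (c \<sigma>) = \<sigma>" if "\<sigma> \<in> separable_perms n" for \<sigma>
  proof -
    have "set \<sigma> = {1..n}" using that by (simp add: separable_perms_iff)
    then show ?thesis unfolding c_def map_map by (intro map_idI) auto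
  qed
  have c: "c \<sigma> \<in> separable_perms n" if s: "\<sigma> \<in> separable_perms n" for \<sigma>
  proof -
    have "(\<lambda>x. Suc n - x) ` {1..n} = {1..n}"
    proof (intro equalityI subsetI)
      fix y assume "y \<in> {1..n}"
      then show "y \<in> (\<lambda>x. Suc n - x) ` {1..n}" by (intro image_eqI[of _ _ "Suc n - y"]) auto
    qed auto
    moreover have "avoiding (c \<sigma>)"
      unfolding c_def using avoiding_antimono[of \<sigma> "\<lambda>x. Suc n - x"] anti[OF _ _ s] s
      by (simp add: separable_perms_iff)
    moreover have "inj_on (\<lambda>x. Suc n - x) {1..n}" by (auto simp: inj_on_def)
    ultimately show ?thesis
      using s by (simp add: separable_perms_iff c_def distinct_map)
  qed
  show "bij_betw c (separable_perms n) (separable_perms n)"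
    by (rule bij_betw_byWitness[where f' = c]) (use c cc in auto)
  have d: "sum_dec (c \<sigma>) \<longleftrightarrow> skew_dec \<sigma>" "skew_dec (c \<sigma>) \<longleftrightarrow> sum_dec \<sigma>" if "\<sigma> \<in> separable_perms n" for \<sigma>
    using sum_dec_antimono[of \<sigma> "\<lambda>x. Suc n - x"] skew_dec_antimono[of \<sigma> "\<lambda>x. Suc n - x"] anti[OF _ _ that]
    by (simp_all add: c_def)
  show "bij_betw c {\<sigma> \<in> separable_perms n. \<not> skew_dec \<sigma>} (indec_perms n)"
    by (rule bij_betw_byWitness[where f' = c]) (use c cc d in \<open>auto simp: indec_perms_def\<close>)
qed

lemma occ_prod_compl:
  "\<sigma> \<in> separable_perms n \<Longrightarrow> occ_prod (neg q) (map (\<lambda>x. Suc n - x) \<sigma>) = occ_prod q \<sigma>"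
  by (rule occ_prod_antimono) (auto simp: separable_perms_iff)

lemma sep_gf_neg [simp]: "sep_gf (neg q) = sep_gf q"
proof (rule fps_ext)
  fix n
  have "(\<Sum>\<sigma>\<in>separable_perms n. occ_prod (neg q) \<sigma>) =
     (\<Sum>\<sigma>\<in>separable_perms n. occ_prod (neg q) (map (\<lambda>x. Suc n - x) \<sigma>))"
    by (rule sum.reindex_bij_betw[OF separable_perms_compl, symmetric])
  also have "\<dots> = (\<Sum>\<sigma>\<in>separable_perms n. occ_prod q \<sigma>)"
    by (rule sum.cong[OF refl occ_prod_compl])
  finally have "(\<Sum>\<sigma>\<in>separable_perms n. occ_prod (neg q) \<sigma>) = (\<Sum>\<sigma>\<in>separable_perms n. occ_prod q \<sigma>)" .
  then show "sep_gf (neg q) $ n = sep_gf q $ n"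
    by (simp only: sep_gf_def fps_nth_Abs_fps)
qed

lemma separable_perms_1: "separable_perms (Suc 0) = {[Suc 0]}"
proof (intro equalityI subsetI)
  fix s assume s: "s \<in> separable_perms (Suc 0)"
  then have "length s = Suc 0" "set s = {Suc 0}"
    using separable_perms_length[OF s] by (simp_all add: separable_perms_iff)
  then show "s \<in> {[Suc 0]}" by (cases s) auto
next
  fix s assume "s \<in> {[Suc 0]}"
  moreover have "occs [2, 4, 1, 3 :: int] [Suc 0] = {}" "occs [3, 1, 4, 2 :: int] [Suc 0] = {}"
    by (rule occs_long; simp)+
  ultimately show "s \<in> separable_perms (Suc 0)" by (simp add: separable_perms_iff avoiding_def)
qed

text \<open>From size 2 on, a separable permutation is decomposable in exactly one of the two
  senses, so the left-hand side counts it once. The permutation of size 1 is indecomposable in both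
  senses and counted twice; the surplus is \<open>fps_X\<close> if every pattern fits into a single
  entry.\<close>

lemma indec_gf_neg:
  "indec_gf q + indec_gf (neg q) = sep_gf q + (if \<forall>\<pi>\<in>set q. length \<pi> \<le> 1 then fps_X else 0)"
proof (rule fps_ext)
  fix n
  have ne: "indec_gf (neg q) $ n = (\<Sum>\<sigma> | \<sigma> \<in> separable_perms n \<and> \<not> skew_dec \<sigma>. occ_prod q \<sigma>)" if "n \<noteq> 0"
  proof -
    have "indec_gf (neg q) $ n = (\<Sum>\<sigma>\<in>indec_perms n. occ_prod (neg q) \<sigma>)"
      using that by (simp add: indec_gf_def)
    also have "\<dots> = (\<Sum>\<sigma> | \<sigma> \<in> separable_perms n \<and> \<not> skew_dec \<sigma>. occ_prod (neg q) (map (\<lambda>x. Suc n - x) \<sigma>))"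
      by (rule sum.reindex_bij_betw[OF indec_perms_compl, symmetric])
    also have "\<dots> = (\<Sum>\<sigma> | \<sigma> \<in> separable_perms n \<and> \<not> skew_dec \<sigma>. occ_prod q \<sigma>)"
      by (rule sum.cong[OF refl], rule occ_prod_compl) simp
    finally show ?thesis .
  qed
  consider "n = 0" | "n = 1" | "n \<ge> 2" by linarith
  then show "(indec_gf q + indec_gf (neg q)) $ n
      = (sep_gf q + (if \<forall>\<pi>\<in>set q. length \<pi> \<le> 1 then fps_X else 0)) $ n"
  proof cases
    case 1
    then show ?thesis by (simp add: sep_gf_def indec_gf_def)
  next
    case 2
    have nd: "\<not> sum_dec [Suc 0]" "\<not> skew_dec [Suc 0]"
      by (auto simp: sum_dec_def skew_dec_def Cons_eq_append_conv)
    have "occ_prod q [Suc 0] = (if \<forall>\<pi>\<in>set q. length \<pi> \<le> 1 then 1 else 0)"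
      by (induction q) (auto simp: occ_prod_def card_occs_singleton)
    moreover have "indec_gf q $ n = occ_prod q [Suc 0]"
    proof -
      have "indec_perms (Suc 0) = {[Suc 0]}" using nd by (auto simp: indec_perms_def separable_perms_1)
      then show ?thesis using 2 by (simp add: indec_gf_def)
    qed
    moreover have "indec_gf (neg q) $ n = occ_prod q [Suc 0]"
    proof -
      have "{\<sigma> \<in> separable_perms (Suc 0). \<not> skew_dec \<sigma>} = {[Suc 0]}"
        using nd by (auto simp: separable_perms_1)
      then show ?thesis using 2 ne by simp
    qed
    moreover have "sep_gf q $ n = occ_prod q [Suc 0]" using 2 by (simp add: sep_gf_def separable_perms_1)
    ultimately show ?thesis using 2 by auto
  next
    case 3
    let ?S = "{\<sigma> \<in> separable_perms n. \<not> skew_dec \<sigma>}"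
    have "indec_gf q $ n + indec_gf (neg q) $ n
        = (\<Sum>\<sigma>\<in>indec_perms n. occ_prod q \<sigma>) + (\<Sum>\<sigma>\<in>?S. occ_prod q \<sigma>)"
      using 3 ne by (simp add: indec_gf_def)
    also have "\<dots> = (\<Sum>\<sigma>\<in>indec_perms n \<union> ?S. occ_prod q \<sigma>)"
    proof (rule sum.union_disjoint[symmetric])
      show "indec_perms n \<inter> ?S = {}"
        using avoiding_decomposable 3 separable_perms_length
        by (auto simp: indec_perms_def separable_perms_iff)
    qed (auto simp: finite_separable_perms)
    also have "indec_perms n \<union> ?S = separable_perms n"
      using not_sum_and_skew by (auto simp: indec_perms_def)
    finally show ?thesis using 3 by (simp add: sep_gf_def)
  qed
qed

section \<open>Values at the dominant singularity\<close>

lemma occ_prod_weight_0: "weight q = 0 \<Longrightarrow> occ_prod q \<sigma> = 1"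
  by (induction q) (auto simp: weight_def occ_prod_def)

lemma sep_gf_weight_0: "weight q = 0 \<Longrightarrow> sep_gf q = sep_gf []"
proof -
  assume "weight q = 0"
  then have *: "occ_prod q = (occ_prod [] :: nat list \<Rightarrow> real)"
    by (intro ext) (simp add: occ_prod_weight_0 weight_def)
  show ?thesis unfolding sep_gf_def * ..
qed

lemma indec_gf_weight_0: "weight q = 0 \<Longrightarrow> indec_gf q = indec_gf []"
proof -
  assume "weight q = 0"
  then have *: "occ_prod q = (occ_prod [] :: nat list \<Rightarrow> real)"
    by (intro ext) (simp add: occ_prod_weight_0 weight_def)
  show ?thesis unfolding indec_gf_def * ..
qed

text \<open>The square root, with constant coefficient 1, of the discriminant of the quadratic
  equation satisfied by \<open>sep_gf []\<close>.\<close>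

definition disc_root :: "real fps" where
  "disc_root = 1 - fps_X - 2 * sep_gf []"

lemma indec_gf_Nil: "2 * indec_gf [] = sep_gf [] + fps_X"
  using indec_gf_neg[of "[]"] by (simp add: neg_def)

lemma sep_gf_Nil_decomp: "sep_gf [] = indec_gf [] + indec_gf [] * sep_gf []"
  using sep_gf_decomp[of "[]"] by simp

lemma sep_gf_Nil_quadratic: "(sep_gf [])\<^sup>2 + (fps_X - 1) * sep_gf [] + fps_X = 0"
proof -
  have "2 * sep_gf [] = 2 * indec_gf [] + 2 * indec_gf [] * sep_gf []"
    using sep_gf_Nil_decomp by (metis distrib_left mult.assoc)
  then show ?thesis unfolding indec_gf_Nil by (simp add: algebra_simps power2_eq_square)
qed

lemma disc_root_square: "disc_root\<^sup>2 = 1 - 6 * fps_X + fps_X\<^sup>2"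
proof -
  have "disc_root\<^sup>2 = (1 - fps_X)\<^sup>2 - 4 * fps_X + 4 * ((sep_gf [])\<^sup>2 + (fps_X - 1) * sep_gf [] + fps_X)"
    unfolding disc_root_def by (simp add: power2_eq_square algebra_simps)
  then show ?thesis unfolding sep_gf_Nil_quadratic by (simp add: power2_eq_square algebra_simps)
qed

text \<open>A possibly empty separable permutation is a sequence of sum-indecomposable
  components.\<close>

lemma one_plus_sep_gf_Nil: "(1 - indec_gf []) * (1 + sep_gf []) = 1"
  using sep_gf_Nil_decomp by (simp add: algebra_simps)

text \<open>Both blocks receive at least one marked entry, so these splits refer only to instances
  of strictly smaller weight.\<close>

definition proper_splits :: "int list list \<Rightarrow> (int list \<times> int list) list set" where
  "proper_splits q = {p \<in> splits q. weight (map fst p) > 0 \<and> weight (map snd p) > 0}"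

lemma finite_proper_splits [simp]: "finite (proper_splits q)"
  by (simp add: proper_splits_def)

lemma weight_splits: "p \<in> splits q \<Longrightarrow> weight (map fst p) + weight (map snd p) = weight q"
  by (induction q arbitrary: p) (force simp: splits_Cons weight_def splits1_def)+

lemma splits_trivial_left: "map (\<lambda>\<pi>. ([], \<pi>)) q \<in> splits q"
  by (induction q) (auto simp: splits_Cons splits1_def list_below_def)

lemma splits_trivial_right: "map (\<lambda>\<pi>. (\<pi>, [])) q \<in> splits q"
  by (induction q) (auto simp: splits_Cons splits1_def list_below_def)

lemma splits_weight_0_left:
  "p \<in> splits q \<Longrightarrow> weight (map fst p) = 0 \<Longrightarrow> p = map (\<lambda>\<pi>. ([], \<pi>)) q"
  by (induction q arbitrary: p) (auto simp: splits_Cons splits1_def weight_def)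

lemma splits_weight_0_right:
  "p \<in> splits q \<Longrightarrow> weight (map snd p) = 0 \<Longrightarrow> p = map (\<lambda>\<pi>. (\<pi>, [])) q"
  by (induction q arbitrary: p) (auto simp: splits_Cons splits1_def weight_def)

lemma weight_map_Nil: "weight (map (\<lambda>\<pi>. []) q) = 0"
  by (induction q) (auto simp: weight_def)

lemma sum_splits_proper:
  assumes "weight q > 0"
  shows "(\<Sum>p\<in>splits q. f p) =
    f (map (\<lambda>\<pi>. ([], \<pi>)) q) + f (map (\<lambda>\<pi>. (\<pi>, [])) q) + (\<Sum>p\<in>proper_splits q. f p)"
proof -
  let ?l = "map (\<lambda>\<pi>. ([] :: int list, \<pi>)) q" and ?r = "map (\<lambda>\<pi>. (\<pi>, [] :: int list)) q"
  have w: "weight (map fst ?l) = 0" "weight (map snd ?r) = 0"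
    "weight (map snd ?l) = weight q" "weight (map fst ?r) = weight q"
    by (simp_all add: comp_def weight_map_Nil)
  have "splits q = insert ?l (insert ?r (proper_splits q))"
    using splits_weight_0_left splits_weight_0_right splits_trivial_left splits_trivial_right
    by (auto simp: proper_splits_def)
  moreover have "?l \<noteq> ?r"
  proof
    assume "?l = ?r"
    then have "weight (map fst ?l) = weight (map fst ?r)" by (simp only:)
    then show False unfolding w using assms by simp
  qed
  moreover have "?l \<notin> proper_splits q" "?r \<notin> proper_splits q" using w by (auto simp: proper_splits_def)
  ultimately show ?thesis by (simp add: add.assoc)
qed

definition split_gf :: "int list list \<Rightarrow> real fps" where
  "split_gf q = (\<Sum>p\<in>proper_splits q. indec_gf (map fst p) * sep_gf (map snd p))"

lemma sep_gf_decomp_proper: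
  assumes "weight q > 0"
  shows "(1 - indec_gf []) * sep_gf q = (1 + sep_gf []) * indec_gf q + split_gf q"
proof -
  have "sep_gf q = indec_gf q + (indec_gf [] * sep_gf q + indec_gf q * sep_gf [] + split_gf q)"
    by (subst sep_gf_decomp, subst sum_splits_proper[OF assms])
       (simp add: split_gf_def comp_def indec_gf_weight_0 sep_gf_weight_0 weight_map_Nil)
  then show ?thesis by (simp add: algebra_simps)
qed

lemma indec_gf_eq:
  assumes "weight q > 0"
  shows "indec_gf q = (1 - indec_gf []) * ((1 - indec_gf []) * sep_gf q - split_gf q)"
proof -
  have "(1 - indec_gf []) * ((1 - indec_gf []) * sep_gf q - split_gf q)
      = ((1 - indec_gf []) * (1 + sep_gf [])) * indec_gf q"
    unfolding sep_gf_decomp_proper[OF assms] by (simp add: algebra_simps)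
  then show ?thesis by (simp add: one_plus_sep_gf_Nil)
qed

text \<open>Adding the decompositions for \<open>q\<close> and \<open>neg q\<close> eliminates the
  indecomposable series through \<open>indec_gf_neg\<close>. What remains in front of
  \<open>sep_gf q\<close> is \<open>2 - 2 * indec_gf [] - (1 + sep_gf [])\<close>, which is
  \<open>disc_root\<close>.\<close>

lemma disc_root_times_sep_gf:
  assumes "weight q > 0"
  shows "disc_root * sep_gf q =
    (if \<forall>\<pi>\<in>set q. length \<pi> \<le> 1 then fps_X * (1 + sep_gf []) else 0) + split_gf q + split_gf (neg q)"
proof -
  let ?e = "if \<forall>\<pi>\<in>set q. length \<pi> \<le> 1 then fps_X else 0 :: real fps"
  have "(1 - indec_gf []) * sep_gf q + (1 - indec_gf []) * sep_gf q
     = ((1 + sep_gf []) * indec_gf q + split_gf q) + ((1 + sep_gf []) * indec_gf (neg q) + split_gf (neg q))"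
    using sep_gf_decomp_proper[OF assms] sep_gf_decomp_proper[of "neg q"] assms
    by (intro arg_cong2[where f = "(+)"]) simp_all
  also have "\<dots> = (1 + sep_gf []) * (indec_gf q + indec_gf (neg q)) + split_gf q + split_gf (neg q)"
    by (simp add: algebra_simps)
  finally have "(1 - indec_gf []) * sep_gf q + (1 - indec_gf []) * sep_gf q
     = (1 + sep_gf []) * (indec_gf q + indec_gf (neg q)) + split_gf q + split_gf (neg q)" .
  then have "(2 - 2 * indec_gf []) * sep_gf q
     = (1 + sep_gf []) * (sep_gf q + ?e) + split_gf q + split_gf (neg q)"
    unfolding indec_gf_neg by (simp add: algebra_simps)
  then have "(2 - (sep_gf [] + fps_X)) * sep_gf q
     = (1 + sep_gf []) * (sep_gf q + ?e) + split_gf q + split_gf (neg q)"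
    unfolding indec_gf_Nil .
  then have "(1 - fps_X - 2 * sep_gf []) * sep_gf q = (1 + sep_gf []) * ?e + split_gf q + split_gf (neg q)"
    by (simp add: algebra_simps)
  then show ?thesis by (auto simp: disc_root_def mult.commute)
qed

text \<open>The smaller root of \<open>1 - 6 z + z^2\<close>, the square of
  \<open>disc_root\<close>.\<close>

definition rho :: real where "rho = 3 - 2 * sqrt 2"

lemma rho_quadratic: "rho\<^sup>2 - 6 * rho + 1 = 0"
  by (simp add: rho_def power2_eq_square algebra_simps)

text \<open>The module spanned over the polynomials by 1 and the root of the discriminant, together with
  the value at the dominant singularity, where the root vanishes.\<close>

definition quad_repr :: "real fps \<Rightarrow> real \<Rightarrow> bool" where
  "quad_repr F l \<longleftrightarrow> (\<exists>p r. F = fps_of_poly p + fps_of_poly r * disc_root \<and> poly p rho = l)"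

lemma quad_repr_poly: "quad_repr (fps_of_poly p) (poly p rho)"
  unfolding quad_repr_def by (rule exI[of _ p], rule exI[of _ 0]) simp

lemma quad_repr_const: "quad_repr (fps_const c) c"
  using quad_repr_poly[of "[:c:]"] by (simp add: fps_of_poly_const)

lemma quad_repr_numeral: "quad_repr 0 0" "quad_repr 1 1"
  using quad_repr_const[of 0] quad_repr_const[of 1] by simp_all

lemma quad_repr_X: "quad_repr fps_X rho"
  using quad_repr_poly[of "[:0, 1:]"] by (simp add: fps_of_poly_fps_X)

lemma quad_repr_disc_root: "quad_repr disc_root 0"
  unfolding quad_repr_def by (rule exI[of _ 0], rule exI[of _ 1]) simp

lemma quad_repr_add:
  assumes "quad_repr F a" "quad_repr G b"
  shows "quad_repr (F + G) (a + b)"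
proof -
  obtain p r p' r' where "F = fps_of_poly p + fps_of_poly r * disc_root" "poly p rho = a"
    "G = fps_of_poly p' + fps_of_poly r' * disc_root" "poly p' rho = b"
    using assms by (auto simp: quad_repr_def)
  then show ?thesis unfolding quad_repr_def
    by (intro exI[of _ "p + p'"] exI[of _ "r + r'"]) (simp add: fps_of_poly_add algebra_simps)
qed

text \<open>The product of the two root parts is a polynomial multiple of
  \<open>disc_root^2 = 1 - 6 z + z^2\<close>, which vanishes at \<open>rho\<close>; hence the values
  multiply.\<close>

lemma quad_repr_mult:
  assumes "quad_repr F a" "quad_repr G b"
  shows "quad_repr (F * G) (a * b)"
proof -
  obtain p r p' r' where *: "F = fps_of_poly p + fps_of_poly r * disc_root" "poly p rho = a"
    "G = fps_of_poly p' + fps_of_poly r' * disc_root" "poly p' rho = b"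
    using assms by (auto simp: quad_repr_def)
  have d: "fps_of_poly [:1, -6, 1:] = disc_root\<^sup>2"
    unfolding disc_root_square
    by (simp add: fps_of_poly_pCons numeral_fps_const power2_eq_square algebra_simps flip: fps_const_neg)
  have "F * G = fps_of_poly (p * p' + r * r' * [:1, -6, 1:]) + fps_of_poly (p * r' + r * p') * disc_root"
    unfolding * fps_of_poly_add fps_of_poly_mult d by (simp add: algebra_simps power2_eq_square)
  moreover have "poly (p * p' + r * r' * [:1, -6, 1:]) rho = a * b"
  proof -
    have "poly [:1, -6, 1:] rho = 0" using rho_quadratic by (simp add: algebra_simps power2_eq_square)
    then show ?thesis by (simp only: poly_add poly_mult *(2) *(4))
  qed
  ultimately show ?thesis unfolding quad_repr_def by blast
qed

lemma quad_repr_diff: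
  assumes "quad_repr F a" "quad_repr G b"
  shows "quad_repr (F - G) (a - b)"
  using quad_repr_add[OF assms(1) quad_repr_mult[OF quad_repr_const[of "-1"] assms(2)]]
  by (simp flip: fps_const_neg)

lemma quad_repr_sum:
  assumes "\<And>x. x \<in> A \<Longrightarrow> quad_repr (F x) (a x)"
  shows "quad_repr (\<Sum>x\<in>A. F x) (\<Sum>x\<in>A. a x)"
  using assms by (induction A rule: infinite_finite_induct) (auto intro: quad_repr_add simp: quad_repr_numeral)

lemma quad_repr_power_disc_root: "n > 0 \<Longrightarrow> quad_repr (disc_root ^ n) 0"
proof (induction n)
  case (Suc n)
  then show ?case
    using quad_repr_mult[OF quad_repr_disc_root, of "disc_root ^ n"] quad_repr_disc_root
    by (cases "n = 0") auto
qed simp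

lemma half_fps: "2 * F = G \<Longrightarrow> F = fps_const (1 / 2) * (G :: real fps)"
  by (auto simp: numeral_fps_const mult.assoc[symmetric])

lemma quad_repr_sep_gf_Nil: "quad_repr (sep_gf []) ((1 - rho) / 2)"
proof -
  have "sep_gf [] = fps_const (1 / 2) * (1 - fps_X - disc_root)"
    by (rule half_fps) (simp add: disc_root_def)
  then show ?thesis
    using quad_repr_mult[OF quad_repr_const[of "1 / 2"]
        quad_repr_diff[OF quad_repr_diff[OF quad_repr_numeral(2) quad_repr_X] quad_repr_disc_root]]
    by simp
qed

lemma quad_repr_indec_gf_Nil: "quad_repr (1 - indec_gf []) ((3 - rho) / 4)"
proof -
  have "indec_gf [] = fps_const (1 / 2) * (sep_gf [] + fps_X)"
    by (rule half_fps) (rule indec_gf_Nil)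
  then show ?thesis
    using quad_repr_diff[OF quad_repr_numeral(2)
        quad_repr_mult[OF quad_repr_const[of "1 / 2"] quad_repr_add[OF quad_repr_sep_gf_Nil quad_repr_X]]]
    by (simp add: field_simps)
qed

text \<open>Here \<open>(3 - rho) / 4\<close> is \<open>1 / sqrt 2\<close>. The resulting
  \<open>1 / 2\<close> is why sum-indecomposable permutations carry half of every leading
  term.\<close>

lemma quad_repr_indec_gf_Nil_square: "quad_repr ((1 - indec_gf []) * (1 - indec_gf [])) (1 / 2)"
proof -
  have "(3 - rho) / 4 * ((3 - rho) / 4) = 1 / 2"
    by (simp add: rho_def)
  then show ?thesis using quad_repr_mult[OF quad_repr_indec_gf_Nil quad_repr_indec_gf_Nil] by simp
qed

text \<open>The value at \<open>rho\<close> of \<open>fps_X * (1 + sep_gf [])\<close>, the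
  contribution of a single marked entry.\<close>

definition kappa :: real where "kappa = rho * (3 - rho) / 2"

text \<open>Division by 2 accounts for the indecomposable factor of each split, whose constant is
  half of \<open>lead\<close>. At weight 0 the value is a convention, replaced by 0 in
  \<open>lead0\<close>.\<close>

function lead :: "int list list \<Rightarrow> real" where
  "lead q = (if weight q \<le> 1 then kappa else
     ((\<Sum>p\<in>proper_splits q. lead (map fst p) * lead (map snd p)) +
      (\<Sum>p\<in>proper_splits (neg q). lead (map fst p) * lead (map snd p))) / 2)"
  by auto
termination
proof (relation "Wellfounded.measure weight", goal_cases)
  case 1 then show ?case by simp
next
  case (2 q p)
  then show ?case using weight_splits[of p q] by (auto simp: proper_splits_def)
next
  case (3 q p)
  then show ?case using weight_splits[of p q] by (auto simp: proper_splits_def)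
next
  case (4 q p)
  then show ?case using weight_splits[of p "neg q"] by (auto simp: proper_splits_def)
next
  case (5 q p)
  then show ?case using weight_splits[of p "neg q"] by (auto simp: proper_splits_def)
qed

declare lead.simps [simp del]

text \<open>Induction on the weight, for both series at once because each split pairs an
  indecomposable block with an arbitrary one. The powers of \<open>disc_root\<close> consumed by the
  two blocks add up to \<open>2 * k - 2\<close>, leaving one for the linear equation.\<close>

lemma quad_repr_gf:
  assumes "weight q > 0"
  shows "quad_repr (sep_gf q * disc_root ^ (2 * weight q - 1)) (lead q) \<and>
         quad_repr (indec_gf q * disc_root ^ (2 * weight q - 1)) (lead q / 2)"
  using assms
proof (induction "weight q" arbitrary: q rule: less_induct)
  case less
  define T where "T = indec_gf []"
  define k where "k = weight q"
  have k: "k > 0" using less.prems by (simp add: k_def)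
  define sl where "sl q' = (\<Sum>p\<in>proper_splits q'. lead (map fst p) / 2 * lead (map snd p))" for q'
  have R: "quad_repr (split_gf q' * disc_root ^ (2 * k - 2)) (sl q')" if q': "weight q' = k" for q'
  proof -
    have "quad_repr (indec_gf (map fst p) * sep_gf (map snd p) * disc_root ^ (2 * k - 2))
        (lead (map fst p) / 2 * lead (map snd p))" if p: "p \<in> proper_splits q'" for p
    proof -
      define i j where "i = weight (map fst p)" and "j = weight (map snd p)"
      have w: "i + j = k" "i > 0" "j > 0"
        using p q' weight_splits[of p q'] by (auto simp: proper_splits_def i_def j_def)
      have "quad_repr (indec_gf (map fst p) * disc_root ^ (2 * i - 1)) (lead (map fst p) / 2)"
        using less.hyps[of "map fst p"] w by (auto simp: i_def j_def k_def)
      moreover have "quad_repr (sep_gf (map snd p) * disc_root ^ (2 * j - 1)) (lead (map snd p))"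
        using less.hyps[of "map snd p"] w by (auto simp: i_def j_def k_def)
      moreover have "2 * k - 2 = (2 * i - 1) + (2 * j - 1)" using w by linarith
      ultimately show ?thesis
        using quad_repr_mult by (fastforce simp: power_add mult_ac)
    qed
    then show ?thesis unfolding split_gf_def sl_def sum_distrib_right by (rule quad_repr_sum)
  qed
  define e where "e = (if \<forall>\<pi>\<in>set q. length \<pi> \<le> 1 then fps_X * (1 + sep_gf []) else 0 :: real fps)"
  have k': "2 * k - 1 = Suc (2 * k - 2)" using k by simp
  have eq: "sep_gf q * disc_root ^ (2 * k - 1) = e * disc_root ^ (2 * k - 2) +
     (split_gf q * disc_root ^ (2 * k - 2) + split_gf (neg q) * disc_root ^ (2 * k - 2))"
  proof -
    have "sep_gf q * disc_root ^ (2 * k - 1) = (disc_root * sep_gf q) * disc_root ^ (2 * k - 2)"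
      unfolding k' power_Suc by (simp add: mult_ac)
    also have "disc_root * sep_gf q = e + split_gf q + split_gf (neg q)"
      unfolding e_def by (rule disc_root_times_sep_gf[OF less.prems])
    finally show ?thesis by (simp add: algebra_simps)
  qed
  have kap: "quad_repr (fps_X * (1 + sep_gf [])) kappa"
    using quad_repr_mult[OF quad_repr_X quad_repr_add[OF quad_repr_numeral(2) quad_repr_sep_gf_Nil]]
    by (simp add: kappa_def field_simps)
  have A: "quad_repr (sep_gf q * disc_root ^ (2 * k - 1)) (lead q)"
  proof (cases "k = 1")
    case True
    have "proper_splits q' = {}" if "weight q' = 1" for q'
      using weight_splits[of _ q'] that by (fastforce simp: proper_splits_def)
    then have "split_gf q = 0" "split_gf (neg q) = 0" using True by (simp_all add: split_gf_def k_def)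
    moreover have "length \<pi> \<le> 1" if "\<pi> \<in> set q" for \<pi>
      using member_le_sum_list[of "length \<pi>" "map length q"] that True by (auto simp: k_def weight_def)
    ultimately have "sep_gf q * disc_root ^ (2 * k - 1) = fps_X * (1 + sep_gf [])"
      unfolding eq using True by (auto simp: e_def)
    then show ?thesis using kap True by (simp add: lead.simps[of q] k_def)
  next
    case False
    \<comment> \<open>For \<open>k > 1\<close> the marking term is multiplied by a positive power of
      \<open>disc_root\<close>, so its value \<open>l\<close> does not reach the leading
      constant.\<close>
    have "\<exists>l. quad_repr e l" using kap quad_repr_numeral by (auto simp: e_def)
    then obtain l where "quad_repr e l" ..
    then have "quad_repr (e * disc_root ^ (2 * k - 2)) (l * 0)"
      using False k by (intro quad_repr_mult quad_repr_power_disc_root) auto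
    then have "quad_repr (sep_gf q * disc_root ^ (2 * k - 1)) (l * 0 + (sl q + sl (neg q)))"
      unfolding eq using R[of q] R[of "neg q"] by (intro quad_repr_add) (simp_all add: k_def)
    moreover have "lead q = sl q + sl (neg q)"
      using False k by (subst lead.simps) (simp add: k_def sl_def sum_divide_distrib add_divide_distrib)
    ultimately show ?thesis by simp
  qed
  have "indec_gf q * disc_root ^ (2 * k - 1) = (1 - T) * (1 - T) * (sep_gf q * disc_root ^ (2 * k - 1))
      - ((1 - T) * disc_root) * (split_gf q * disc_root ^ (2 * k - 2))"
    unfolding k' power_Suc indec_gf_eq[OF less.prems] T_def by (simp add: algebra_simps)
  moreover have "quad_repr ((1 - T) * (1 - T) * (sep_gf q * disc_root ^ (2 * k - 1))
      - ((1 - T) * disc_root) * (split_gf q * disc_root ^ (2 * k - 2)))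
      (1 / 2 * lead q - ((3 - rho) / 4 * 0) * sl q)"
    unfolding T_def
    by (intro quad_repr_diff quad_repr_mult[OF _ A] quad_repr_mult[OF _ R] quad_repr_indec_gf_Nil_square
        quad_repr_mult[OF quad_repr_indec_gf_Nil quad_repr_disc_root]) (simp add: k_def)
  ultimately show ?case using A by (simp add: k_def)
qed

section \<open>Coefficient asymptotics\<close>

text \<open>Intended for the error of quotients of consecutive coefficients; the factor
  \<open>1 / 5\<close> comes from \<open>alpha_ge\<close>.\<close>

lemma contraction_tendsto_0:
  fixes e d :: "nat \<Rightarrow> real"
  assumes step: "\<And>n. n \<ge> N \<Longrightarrow> e (Suc n) \<le> e n / 5 + d n" and nonneg: "\<And>n. e n \<ge> 0"
    and d: "d \<longlonglongrightarrow> 0"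
  shows "e \<longlonglongrightarrow> 0"
proof (rule LIMSEQ_I)
  fix r :: real assume r: "r > 0"
  obtain N1 where N1: "\<And>n. n \<ge> N1 \<Longrightarrow> norm (d n - 0) < r / 4"
    using LIMSEQ_D[OF d, of "r / 4"] r by auto
  define K where "K = max N N1"
  have b: "e (K + k) \<le> e K * (1 / 5) ^ k + r / 2" for k
  proof (induction k)
    case (Suc k)
    have "e (K + Suc k) \<le> e (K + k) / 5 + d (K + k)" using step[of "K + k"] by (simp add: K_def)
    also have "d (K + k) \<le> r / 4"
    proof -
      have "norm (d (K + k) - 0) < r / 4" by (rule N1) (simp add: K_def)
      then show ?thesis by simp
    qed
    finally have "e (K + Suc k) \<le> e (K + k) / 5 + r / 4" by simp
    moreover have "e K * (1 / 5) ^ Suc k = e K * (1 / 5) ^ k / 5" by simp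
    ultimately show ?case using Suc.IH r by linarith
  qed (use r in simp)
  have "(\<lambda>k. e K * (1 / 5) ^ k) \<longlonglongrightarrow> e K * 0" by (intro tendsto_mult tendsto_const LIMSEQ_power_zero) simp
  then obtain M where M: "\<And>k. k \<ge> M \<Longrightarrow> norm (e K * (1 / 5) ^ k - 0) < r / 2"
    using LIMSEQ_D[of "\<lambda>k. e K * (1 / 5) ^ k" 0 "r / 2"] r by auto
  show "\<exists>no. \<forall>n\<ge>no. norm (e n - 0) < r"
  proof (intro exI allI impI)
    fix n assume n: "K + M \<le> n"
    then have "e n \<le> e K * (1 / 5) ^ (n - K) + r / 2" using b[of "n - K"] by simp
    moreover have "e K * (1 / 5) ^ (n - K) < r / 2"
    proof -
      have "norm (e K * (1 / 5) ^ (n - K) - 0) < r / 2" by (rule M) (use n in simp)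
      then show ?thesis by simp
    qed
    ultimately show "norm (e n - 0) < r" using nonneg[of n] by simp
  qed
qed

definition alpha :: real where "alpha = 3 + 2 * sqrt 2"

lemma alpha_rho: "alpha * rho = 1"
  by (simp add: alpha_def rho_def algebra_simps)

lemma alpha_ge: "alpha \<ge> 5"
  by (simp add: alpha_def)

lemma rho_bounds: "0 < rho" "rho < 1"
proof -
  have "alpha * rho > 0" using alpha_rho by simp
  then show "0 < rho" using alpha_ge by (simp add: zero_less_mult_iff)
  have "5 * rho \<le> alpha * rho" using alpha_ge \<open>0 < rho\<close> by (intro mult_right_mono) auto
  then show "rho < 1" using alpha_rho by simp
qed

lemma alpha_eq: "alpha = 6 - rho"
  by (simp add: alpha_def rho_def)

text \<open>From index \<open>N\<close> on the coefficient of \<open>c (n - 1)\<close> has the right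
  sign to propagate monotonicity, so the quotients \<open>x n\<close> are at least 1. They satisfy
  \<open>x (n + 1) = u - v / x n\<close> with \<open>u\<close> tending to 6 and \<open>v\<close> to
  1. The limit \<open>alpha\<close> is the fixed point of \<open>x = 6 - 1 / x\<close>, near which
  this map contracts.\<close>

lemma recurrence_ratio:
  fixes c :: "nat \<Rightarrow> real" and m :: real
  assumes rec: "\<And>n. n \<ge> N \<Longrightarrow> (real n + 1) * c (Suc n) = (6 * real n + 3 * m) * c n - (real n - 1 + m) * c (n - 1)"
    and init: "c (N - 1) > 0" "c N \<ge> c (N - 1)" and m: "m \<ge> -1" and N: "N \<ge> 1" "real N - 1 + m \<ge> 0"
  shows "\<And>n. n \<ge> N - 1 \<Longrightarrow> c n > 0" and "(\<lambda>n. c (Suc n) / c n) \<longlonglongrightarrow> alpha"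
proof -
  have *: "c (N - 1 + k) > 0 \<and> c (Suc (N - 1 + k)) \<ge> c (N - 1 + k)" for k
  proof (induction k)
    case 0
    then show ?case using init N by simp
  next
    case (Suc k)
    define n where "n = N + k"
    have n: "n \<ge> N" "N - 1 + k = n - 1" "Suc (n - 1) = n" using N by (auto simp: n_def)
    have IH: "c (n - 1) > 0" "c n \<ge> c (n - 1)" using Suc.IH n by auto
    have nm: "real n - 1 + m \<ge> 0" using N n(1) by linarith
    have "(real n + 1) * c (Suc n) = (6 * real n + 3 * m) * c n - (real n - 1 + m) * c (n - 1)"
      using rec n by simp
    also have "\<dots> \<ge> (6 * real n + 3 * m) * c n - (real n - 1 + m) * c n"
      using IH nm by (intro diff_left_mono mult_left_mono) auto
    also have "(6 * real n + 3 * m) * c n - (real n - 1 + m) * c n = (5 * real n + 2 * m + 1) * c n"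
      by (simp add: algebra_simps)
    finally have "(5 * real n + 2 * m + 1) * c n \<le> (real n + 1) * c (Suc n)" .
    moreover have "(real n + 1) * c n \<le> (5 * real n + 2 * m + 1) * c n"
      using IH m n(1) N by (intro mult_right_mono) auto
    ultimately have "(real n + 1) * c n \<le> (real n + 1) * c (Suc n)" by linarith
    then have "c n \<le> c (Suc n)" by (simp add: mult_le_cancel_left)
    moreover have "N - 1 + Suc k = n" using N by (simp add: n_def)
    ultimately show ?case using IH by simp
  qed
  have pos: "c n > 0" and mono: "c (Suc n) \<ge> c n" if "n \<ge> N - 1" for n
    using *[of "n - (N - 1)"] that by auto
  show "\<And>n. n \<ge> N - 1 \<Longrightarrow> c n > 0" by (rule pos)
  define x where "x n = c (Suc n) / c n" for n
  define u where "u n = (6 * real n + 3 * m) / (n + 1)" for n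
  define v where "v n = (real n - 1 + m) / (n + 1)" for n
  have "(\<lambda>n. \<bar>x n - alpha\<bar>) \<longlonglongrightarrow> 0"
  proof (rule contraction_tendsto_0)
    show "\<bar>x (Suc n) - alpha\<bar> \<le> \<bar>x n - alpha\<bar> / 5 + (\<bar>u (Suc n) - 6\<bar> + \<bar>v (Suc n) - 1\<bar>)"
      if n: "n \<ge> N" for n
    proof -
      have cp: "c n > 0" "c (Suc n) > 0" using pos[of n] pos[of "Suc n"] n by auto
      have x1: "x n \<ge> 1" using mono[of n] cp n by (simp add: x_def)
      have "(real (Suc n) + 1) * c (Suc (Suc n)) =
          (6 * real (Suc n) + 3 * m) * c (Suc n) - (real (Suc n) - 1 + m) * c n"
        using rec[of "Suc n"] n by simp
      then have "c (Suc (Suc n)) = ((6 * real (Suc n) + 3 * m) * c (Suc n) - (real (Suc n) - 1 + m) * c n) / (real (Suc n) + 1)"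
        by (simp add: field_simps)
      then have "x (Suc n) = u (Suc n) - v (Suc n) / x n"
        unfolding x_def u_def v_def using cp by (simp add: divide_simps)
      moreover have "1 / alpha = rho" using alpha_rho alpha_ge by (simp add: field_simps)
      then have "alpha = 6 - 1 / alpha" using alpha_eq by simp
      ultimately have "x (Suc n) - alpha = (u (Suc n) - 6) - ((v (Suc n) - 1) / x n + (1 / x n - 1 / alpha))"
        by (simp add: diff_divide_distrib)
      then have "\<bar>x (Suc n) - alpha\<bar> \<le> \<bar>u (Suc n) - 6\<bar> + \<bar>(v (Suc n) - 1) / x n\<bar> + \<bar>1 / x n - 1 / alpha\<bar>"
        by linarith
      also have "\<bar>(v (Suc n) - 1) / x n\<bar> \<le> \<bar>v (Suc n) - 1\<bar>"
      proof -
        have "\<bar>v (Suc n) - 1\<bar> * 1 \<le> \<bar>v (Suc n) - 1\<bar> * x n" using x1 by (intro mult_left_mono) auto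
        then show ?thesis using x1 by (simp add: abs_divide divide_le_eq)
      qed
      also have "\<bar>1 / x n - 1 / alpha\<bar> \<le> \<bar>x n - alpha\<bar> / 5"
      proof -
        have "1 / x n - 1 / alpha = (alpha - x n) / (x n * alpha)"
          using x1 alpha_ge by (simp add: field_simps)
        then have "\<bar>1 / x n - 1 / alpha\<bar> = \<bar>x n - alpha\<bar> / (x n * alpha)"
          using x1 alpha_ge by (simp add: abs_divide abs_mult abs_minus_commute)
        also have "\<dots> \<le> \<bar>x n - alpha\<bar> / (1 * 5)"
          using x1 alpha_ge by (intro divide_left_mono mult_mono) auto
        finally show ?thesis by simp
      qed
      finally show ?thesis by simp
    qed
    have "(\<lambda>n. \<bar>u n - 6\<bar> + \<bar>v n - 1\<bar>) \<longlonglongrightarrow> \<bar>6 - 6\<bar> + \<bar>1 - 1\<bar>"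
    proof (intro tendsto_add tendsto_rabs tendsto_diff tendsto_const)
      show "u \<longlonglongrightarrow> 6" unfolding u_def by real_asymp
      show "v \<longlonglongrightarrow> 1" unfolding v_def by real_asymp
    qed
    then show "(\<lambda>n. \<bar>u (Suc n) - 6\<bar> + \<bar>v (Suc n) - 1\<bar>) \<longlonglongrightarrow> 0"
      by (subst filterlim_sequentially_Suc) simp
  qed simp
  then have "(\<lambda>n. x n - alpha) \<longlonglongrightarrow> 0" by (rule tendsto_rabs_zero_cancel)
  then have "x \<longlonglongrightarrow> alpha" by (simp only: LIM_zero_iff)
  then show "(\<lambda>n. c (Suc n) / c n) \<longlonglongrightarrow> alpha" unfolding x_def .
qed

section \<open>Coefficients of the powers of the inverse root\<close>

definition inv_root :: "real fps" where "inv_root = inverse disc_root"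

lemma disc_root_nth_0: "disc_root $ 0 = 1"
  by (simp add: disc_root_def sep_gf_def)

lemma inv_root_mult: "disc_root * inv_root = 1"
  unfolding inv_root_def using inverse_mult_eq_1[of disc_root] by (simp add: disc_root_nth_0 mult.commute)

lemma disc_root_deriv: "disc_root * fps_deriv disc_root = fps_X - 3"
proof -
  have "fps_deriv (disc_root\<^sup>2) = 2 * (disc_root * fps_deriv disc_root)"
    by (simp add: power2_eq_square)
  moreover have "fps_deriv (disc_root\<^sup>2) = 2 * (fps_X - 3)"
    unfolding disc_root_square by (simp add: power2_eq_square algebra_simps)
  ultimately have "2 * (disc_root * fps_deriv disc_root) = 2 * (fps_X - 3)" by (simp only:)
  then show ?thesis by (subst (asm) mult_cancel_left) simp
qed

lemma disc_root_deriv': "fps_deriv disc_root = (fps_X - 3) * inv_root"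
proof -
  have "fps_deriv disc_root = (disc_root * inv_root) * fps_deriv disc_root" by (simp add: inv_root_mult)
  also have "\<dots> = (disc_root * fps_deriv disc_root) * inv_root" by (simp add: mult_ac)
  finally show ?thesis unfolding disc_root_deriv .
qed

lemma inv_root_deriv: "fps_deriv inv_root = (3 - fps_X) * inv_root ^ 3"
proof -
  have "fps_deriv (disc_root * inv_root) = 0" by (simp add: inv_root_mult)
  then have "disc_root * fps_deriv inv_root = (3 - fps_X) * inv_root\<^sup>2"
    by (simp add: disc_root_deriv' algebra_simps power2_eq_square eq_neg_iff_add_eq_0)
  then have "(disc_root * inv_root) * fps_deriv inv_root = (3 - fps_X) * inv_root ^ 3"
    by (simp add: mult_ac power2_eq_square power3_eq_cube)
  then show ?thesis by (simp add: inv_root_mult)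
qed

lemma inv_root_power_deriv:
  "fps_deriv (inv_root ^ m) = of_nat m * (3 - fps_X) * inv_root ^ (m + 2)"
proof (cases m)
  case (Suc k)
  have "fps_deriv (inv_root ^ m) = of_nat m * fps_deriv inv_root * inv_root ^ k"
    by (subst fps_deriv_power') (simp add: Suc)
  then show ?thesis unfolding inv_root_deriv by (simp add: Suc mult_ac power_add power3_eq_cube)
qed simp

text \<open>The differential equation of the power \<open>-m\<close> of \<open>disc_root\<close>:
  positive \<open>m\<close> gives the powers of \<open>inv_root\<close>, and \<open>m = -1\<close>
  gives \<open>disc_root\<close> itself.\<close>

lemma ode_recurrence:
  fixes F :: "real fps"
  assumes "(1 - 6 * fps_X + fps_X\<^sup>2) * fps_deriv F = fps_const m * (3 - fps_X) * F"
  shows "F $ 1 = 3 * m * F $ 0"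
    and "n \<ge> 1 \<Longrightarrow> (real n + 1) * F $ Suc n = (6 * real n + 3 * m) * F $ n - (real n - 1 + m) * F $ (n - 1)"
proof -
  have l: "((1 - 6 * fps_X + fps_X\<^sup>2) * fps_deriv F) $ n = fps_deriv F $ n
      - 6 * (if n = 0 then 0 else fps_deriv F $ (n - 1)) + (if n < 2 then 0 else fps_deriv F $ (n - 2))" for n
  proof -
    have "(1 - 6 * fps_X + fps_X\<^sup>2) * fps_deriv F
        = fps_deriv F - fps_const 6 * (fps_X * fps_deriv F) + fps_X ^ 2 * fps_deriv F"
      by (simp add: numeral_fps_const algebra_simps)
    then show ?thesis by (simp add: fps_X_power_mult_nth)
  qed
  have r: "(fps_const m * (3 - fps_X) * F) $ n = 3 * m * F $ n - m * (if n = 0 then 0 else F $ (n - 1))" for n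
  proof -
    have "fps_const m * (3 - fps_X) * F = fps_const (3 * m) * F - fps_const m * (fps_X * F)"
      by (simp add: numeral_fps_const algebra_simps flip: fps_const_mult)
    then show ?thesis by simp
  qed
  note e = arg_cong[where f = "\<lambda>G. G $ n" for n, OF assms, unfolded l r]
  show "F $ 1 = 3 * m * F $ 0" using e[of 0] by simp
  show "(real n + 1) * F $ Suc n = (6 * real n + 3 * m) * F $ n - (real n - 1 + m) * F $ (n - 1)" if "n \<ge> 1"
  proof (cases "n = 1")
    case True
    then show ?thesis using e[of 1] by (simp add: algebra_simps)
  next
    case False
    define k where "k = n - 2"
    have "n = Suc (Suc k)" using False that by (simp add: k_def)
    then show ?thesis using e[of n] by (simp add: algebra_simps)
  qed
qed

lemma inv_root_power_ode:
  "(1 - 6 * fps_X + fps_X\<^sup>2) * fps_deriv (inv_root ^ m) = fps_const (real m) * (3 - fps_X) * inv_root ^ m"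
proof -
  have "disc_root\<^sup>2 * (inv_root ^ (m + 2)) = (disc_root * inv_root) * (disc_root * inv_root) * inv_root ^ m"
    by (simp add: power2_eq_square mult_ac)
  then have "disc_root\<^sup>2 * (inv_root ^ (m + 2)) = inv_root ^ m" by (simp add: inv_root_mult)
  moreover have "of_nat m = fps_const (real m)" by (simp add: fps_of_nat)
  ultimately show ?thesis
    unfolding disc_root_square[symmetric] inv_root_power_deriv by (simp add: mult_ac)
qed

lemma disc_root_ode:
  "(1 - 6 * fps_X + fps_X\<^sup>2) * fps_deriv disc_root = fps_const (-1) * (3 - fps_X) * disc_root"
proof -
  have "disc_root\<^sup>2 * fps_deriv disc_root = disc_root * (disc_root * fps_deriv disc_root)"
    by (simp add: power2_eq_square mult.assoc)
  also have "\<dots> = disc_root * (fps_X - 3)" unfolding disc_root_deriv ..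
  also have "\<dots> = fps_const (-1) * (3 - fps_X) * disc_root" by (simp add: algebra_simps flip: fps_const_neg)
  finally show ?thesis unfolding disc_root_square .
qed

lemma inv_root_power_nth_0: "inv_root ^ m $ 0 = 1"
  by (simp add: inv_root_def disc_root_nth_0 fps_power_zeroth)

lemma inv_root_power:
  assumes "m \<ge> 1"
  shows inv_root_power_pos: "inv_root ^ m $ n > 0"
    and inv_root_power_ratio: "(\<lambda>n. inv_root ^ m $ Suc n / inv_root ^ m $ n) \<longlonglongrightarrow> alpha"
proof -
  note r = ode_recurrence[OF inv_root_power_ode[of m]]
  have i: "inv_root ^ m $ (1 - 1) > 0" "inv_root ^ m $ 1 \<ge> inv_root ^ m $ (1 - 1)"
    using r(1) assms by (simp_all add: inv_root_power_nth_0)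
  note * = recurrence_ratio[where c = "\<lambda>n. inv_root ^ m $ n" and N = 1 and m = "real m", OF r(2) i]
  show "inv_root ^ m $ n > 0" by (rule *(1)) (use assms in auto)
  show "(\<lambda>n. inv_root ^ m $ Suc n / inv_root ^ m $ n) \<longlonglongrightarrow> alpha" by (rule *(2)) (use assms in auto)
qed

lemma disc_root_nth_neg: "n \<ge> 2 \<Longrightarrow> disc_root $ n < 0"
  and disc_root_ratio: "(\<lambda>n. disc_root $ Suc n / disc_root $ n) \<longlonglongrightarrow> alpha"
proof -
  note r = ode_recurrence[OF disc_root_ode]
  have 1: "disc_root $ 1 = -3" using r(1) by (simp add: disc_root_nth_0)
  have 2: "disc_root $ 2 = -4" using r(2)[of 1] 1 disc_root_nth_0 by (simp add: numeral_2_eq_2)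
  have 3: "disc_root $ 3 = -12" using r(2)[of 2] 1 2 by (simp add: numeral_3_eq_3 numeral_2_eq_2)
  have rec: "(real n + 1) * - disc_root $ Suc n
      = (6 * real n + 3 * -1) * - disc_root $ n - (real n - 1 + -1) * - disc_root $ (n - 1)" if "n \<ge> 3" for n
    using r(2)[of n] that by (simp add: algebra_simps)
  have i: "- disc_root $ (3 - 1) > 0" "- disc_root $ 3 \<ge> - disc_root $ (3 - 1)" using 2 3 by simp_all
  note * = recurrence_ratio[where c = "\<lambda>n. - disc_root $ n" and N = 3 and m = "-1", OF rec i]
  show "disc_root $ n < 0" if "n \<ge> 2" using *(1)[of n] that by simp
  show "(\<lambda>n. disc_root $ Suc n / disc_root $ n) \<longlonglongrightarrow> alpha" using *(2) by simp
qed

lemma ratio_pred: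
  fixes g :: "nat \<Rightarrow> real"
  assumes "(\<lambda>n. g (Suc n) / g n) \<longlonglongrightarrow> alpha"
  shows "(\<lambda>n. g (n - 1) / g n) \<longlonglongrightarrow> rho"
proof -
  have "(\<lambda>n. inverse (g (Suc n) / g n)) \<longlonglongrightarrow> inverse alpha"
    using assms alpha_ge by (intro tendsto_inverse) auto
  moreover have "inverse alpha = rho" using alpha_rho alpha_ge by (simp add: field_simps)
  ultimately have "(\<lambda>n. g n / g (Suc n)) \<longlonglongrightarrow> rho" by simp
  then show ?thesis by (subst filterlim_sequentially_Suc[symmetric]) simp
qed

text \<open>The hypothesis \<open>rel\<close> compares coefficients in
  \<open>c' = \<mu> (3 - X) g\<close>. Divided by \<open>g n\<close>, its left-hand side tends to
  \<open>3 - rho\<close>, while \<open>c (n + 1) / c n\<close> tends to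
  \<open>alpha\<close>.\<close>

lemma deriv_ratio:
  fixes c g :: "nat \<Rightarrow> real"
  assumes rel: "\<And>n. n \<ge> 2 \<Longrightarrow> 3 * g n - g (n - 1) = (real n + 1) * c (Suc n) / \<mu>"
    and g: "(\<lambda>n. g (Suc n) / g n) \<longlonglongrightarrow> alpha" and c: "(\<lambda>n. c (Suc n) / c n) \<longlonglongrightarrow> alpha"
    and nz: "\<And>n. n \<ge> 2 \<Longrightarrow> g n \<noteq> 0" "\<And>n. n \<ge> 2 \<Longrightarrow> c n \<noteq> 0" and mu: "\<mu> \<noteq> 0"
  shows "(\<lambda>n. g n / (real n * c n)) \<longlonglongrightarrow> alpha / (\<mu> * (3 - rho))"
proof -
  have "(\<lambda>n. (real n + 1) / real n) \<longlonglongrightarrow> 1" by real_asymp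
  then have "(\<lambda>n. (real n + 1) / real n * (c (Suc n) / c n) / (\<mu> * (3 - g (n - 1) / g n)))
      \<longlonglongrightarrow> 1 * alpha / (\<mu> * (3 - rho))"
    using mu rho_bounds by (intro tendsto_intros c ratio_pred[OF g]) auto
  moreover have "\<forall>\<^sub>F n in sequentially.
      (real n + 1) / real n * (c (Suc n) / c n) / (\<mu> * (3 - g (n - 1) / g n)) = g n / (real n * c n)"
    using eventually_ge_at_top[of 3]
  proof eventually_elim
    case (elim n)
    have nz': "g n \<noteq> 0" "c n \<noteq> 0" "c (Suc n) \<noteq> 0" using nz elim by auto
    have r: "3 * g n - g (n - 1) = (real n + 1) * c (Suc n) / \<mu>" using rel elim by simp
    have "3 - g (n - 1) / g n = (3 * g n - g (n - 1)) / g n" using nz' by (simp add: field_simps)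
    also have "\<dots> = (real n + 1) * c (Suc n) / \<mu> / g n" unfolding r ..
    finally have e: "3 - g (n - 1) / g n = (real n + 1) * c (Suc n) / \<mu> / g n" .
    have "real n + 1 \<noteq> 0" by linarith
    then show ?case unfolding e using nz' mu elim by simp
  qed
  ultimately show ?thesis using Lim_transform_eventually by fastforce
qed

lemma three_minus_X_nth: "n \<ge> 1 \<Longrightarrow> ((3 - fps_X) * F :: real fps) $ n = 3 * F $ n - F $ (n - 1)"
proof -
  assume "n \<ge> 1"
  have "(3 - fps_X) * F = fps_const 3 * F - fps_X * F" by (simp add: numeral_fps_const algebra_simps)
  then show ?thesis using \<open>n \<ge> 1\<close> by simp
qed

text \<open>Passing from the power \<open>m\<close> of \<open>inv_root\<close> to
  \<open>m + 2\<close> multiplies the coefficients asymptotically by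
  \<open>growth * n / m\<close>.\<close>

definition growth :: real where "growth = alpha / (3 - rho)"

lemma growth_pos: "growth > 0"
  unfolding growth_def using alpha_ge rho_bounds by (intro divide_pos_pos) auto

lemma inv_root_power_step:
  assumes "m \<ge> 1"
  shows "(\<lambda>n. inv_root ^ (m + 2) $ n / (real n * inv_root ^ m $ n)) \<longlonglongrightarrow> growth / m"
proof -
  have "(\<lambda>n. inv_root ^ (m + 2) $ n / (real n * inv_root ^ m $ n)) \<longlonglongrightarrow> alpha / (real m * (3 - rho))"
  proof (rule deriv_ratio)
    fix n :: nat assume n: "n \<ge> 2"
    have eq: "3 * y - z = x / real m" if "x = real m * (3 * y - z)" for x y z :: real
      using that assms by (simp add: field_simps)
    have "(real n + 1) * inv_root ^ m $ Suc n = fps_deriv (inv_root ^ m) $ n" by simp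
    also have "\<dots> = (fps_const (real m) * ((3 - fps_X) * inv_root ^ (m + 2))) $ n"
      unfolding inv_root_power_deriv by (simp only: fps_of_nat mult.assoc)
    also have "\<dots> = real m * (3 * inv_root ^ (m + 2) $ n - inv_root ^ (m + 2) $ (n - 1))"
      using n by (simp only: fps_mult_left_const_nth three_minus_X_nth)
    finally show "3 * inv_root ^ (m + 2) $ n - inv_root ^ (m + 2) $ (n - 1) = (real n + 1) * inv_root ^ m $ Suc n / real m"
      by (rule eq)
    show "inv_root ^ (m + 2) $ n \<noteq> 0" "inv_root ^ m $ n \<noteq> 0"
      using inv_root_power_pos[of "m + 2" n] inv_root_power_pos[of m n] assms by auto
  qed (use assms inv_root_power_ratio[of m] inv_root_power_ratio[of "m + 2"] in auto)
  then show ?thesis by (simp add: growth_def field_simps)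
qed

lemma inv_root_step:
  "(\<lambda>n. inv_root $ n / (real n * disc_root $ n)) \<longlonglongrightarrow> - growth"
proof -
  have "(\<lambda>n. inv_root $ n / (real n * disc_root $ n)) \<longlonglongrightarrow> alpha / (-1 * (3 - rho))"
  proof (rule deriv_ratio)
    fix n :: nat assume n: "n \<ge> 2"
    have "fps_deriv disc_root = - ((3 - fps_X) * inv_root)" by (simp add: disc_root_deriv' algebra_simps)
    then have "fps_deriv disc_root $ n = - (((3 - fps_X) * inv_root) $ n)" by (simp only: fps_neg_nth)
    also have "((3 - fps_X) * inv_root) $ n = 3 * inv_root $ n - inv_root $ (n - 1)"
      using n by (intro three_minus_X_nth) simp
    finally show "3 * inv_root $ n - inv_root $ (n - 1) = (real n + 1) * disc_root $ Suc n / -1"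
      by (simp add: algebra_simps)
    show "inv_root $ n \<noteq> 0" "disc_root $ n \<noteq> 0"
      using inv_root_power_pos[of 1 n] disc_root_nth_neg[OF n] by auto
  qed (use inv_root_power_ratio[of 1] disc_root_ratio in auto)
  moreover have "alpha / (-1 * (3 - rho)) = - growth"
    unfolding growth_def using minus_divide_right[of alpha "3 - rho"] by simp
  ultimately show ?thesis by simp
qed

text \<open>The coefficients of \<open>1 / (1 - 6 z + z^2)\<close> obey
  \<open>u (n + 2) = 6 * u (n + 1) - u n\<close>. The bound \<open>u (n + 1) >= alpha * u n\<close>
  is inherited because \<open>alpha = 6 - rho\<close> and \<open>alpha * rho = 1\<close>.\<close>

lemma inv_root_square_lower: "inv_root\<^sup>2 $ n * rho ^ n \<ge> 1"
proof -
  have "disc_root\<^sup>2 * inv_root\<^sup>2 = 1" by (metis inv_root_mult power_mult_distrib power_one)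
  then have e: "(1 - 6 * fps_X + fps_X\<^sup>2) * inv_root\<^sup>2 = 1" unfolding disc_root_square .
  have l: "((1 - 6 * fps_X + fps_X\<^sup>2) * F) $ Suc (Suc n) = F $ Suc (Suc n) - 6 * F $ Suc n + F $ n"
    "((1 - 6 * fps_X + fps_X\<^sup>2) * F) $ 1 = F $ 1 - 6 * F $ 0" for F :: "real fps" and n
  proof -
    have "(1 - 6 * fps_X + fps_X\<^sup>2) * F = F - fps_const 6 * (fps_X * F) + fps_X ^ 2 * F"
      by (simp add: numeral_fps_const algebra_simps)
    then show "((1 - 6 * fps_X + fps_X\<^sup>2) * F) $ Suc (Suc n) = F $ Suc (Suc n) - 6 * F $ Suc n + F $ n"
      "((1 - 6 * fps_X + fps_X\<^sup>2) * F) $ 1 = F $ 1 - 6 * F $ 0"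
      by (simp_all add: fps_X_power_mult_nth)
  qed
  define u where "u n = inv_root\<^sup>2 $ n" for n
  have u0: "u 0 = 1" unfolding u_def by (rule inv_root_power_nth_0)
  have u1: "u 1 = 6" using l(2)[of "inv_root\<^sup>2"] u0 unfolding e by (simp add: u_def)
  have u2: "u (Suc (Suc n)) = 6 * u (Suc n) - u n" for n
    using l(1)[of "inv_root\<^sup>2" n] unfolding e by (simp add: u_def)
  have up: "u n > 0" for n unfolding u_def by (rule inv_root_power_pos) simp
  have st: "u (Suc n) \<ge> alpha * u n" for n
  proof (induction n)
    case 0
    then show ?case using u0 u1 alpha_eq rho_bounds by simp
  next
    case (Suc n)
    have "rho * (alpha * u n) \<le> rho * u (Suc n)" using Suc.IH rho_bounds by (intro mult_left_mono) auto
    moreover have "rho * (alpha * u n) = (alpha * rho) * u n" by simp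
    ultimately have "u n \<le> rho * u (Suc n)" unfolding alpha_rho by simp
    then show ?case unfolding u2 alpha_eq by (simp add: algebra_simps)
  qed
  show ?thesis
  proof (induction n)
    case 0
    then show ?case using u0 by (simp add: u_def)
  next
    case (Suc n)
    have "u n * rho ^ n = (alpha * rho) * (u n * rho ^ n)" unfolding alpha_rho by simp
    also have "\<dots> = (alpha * u n) * rho ^ Suc n" by simp
    also have "\<dots> \<le> u (Suc n) * rho ^ Suc n" using st[of n] rho_bounds by (intro mult_right_mono) auto
    finally show ?case using Suc.IH by (simp add: u_def)
  qed
qed

text \<open>If the nonnegative series converged, so would its Cauchy square, whose terms are all at
  least 1.\<close>

lemma inv_root_not_summable: "\<not> summable (\<lambda>n. inv_root $ n * rho ^ n)"
proof
  assume s: "summable (\<lambda>n. inv_root $ n * rho ^ n)"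
  have "inv_root $ n > 0" for n using inv_root_power_pos[of 1 n] by simp
  then have "summable (\<lambda>n. norm (inv_root $ n * rho ^ n))"
    using s rho_bounds by (simp add: abs_mult less_imp_le abs_of_pos)
  then have "summable (\<lambda>n. \<Sum>i\<le>n. (inv_root $ i * rho ^ i) * (inv_root $ (n - i) * rho ^ (n - i)))"
    by (intro summable_Cauchy_product)
  moreover have "(\<Sum>i\<le>n. (inv_root $ i * rho ^ i) * (inv_root $ (n - i) * rho ^ (n - i))) = inv_root\<^sup>2 $ n * rho ^ n" for n
  proof -
    have "(\<Sum>i\<le>n. (inv_root $ i * rho ^ i) * (inv_root $ (n - i) * rho ^ (n - i)))
        = (\<Sum>i\<le>n. inv_root $ i * inv_root $ (n - i) * rho ^ n)"
      by (rule sum.cong) (auto simp: mult_ac simp flip: power_add)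
    also have "\<dots> = inv_root\<^sup>2 $ n * rho ^ n"
      by (simp add: power2_eq_square fps_mult_nth sum_distrib_right atLeast0AtMost)
    finally show ?thesis .
  qed
  ultimately have "summable (\<lambda>n. inv_root\<^sup>2 $ n * rho ^ n)" by simp
  then have "(\<lambda>n. inv_root\<^sup>2 $ n * rho ^ n) \<longlonglongrightarrow> 0" by (rule summable_LIMSEQ_zero)
  then have "1 \<le> (0::real)" by (rule LIMSEQ_le_const) (use inv_root_square_lower in auto)
  then show False by simp
qed

lemma ratio_shift:
  fixes g :: "nat \<Rightarrow> real"
  assumes "(\<lambda>n. g (Suc n) / g n) \<longlonglongrightarrow> alpha" and nz: "\<And>n. g n \<noteq> 0"
  shows "(\<lambda>n. g (n - j) / g n) \<longlonglongrightarrow> rho ^ j"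
proof (induction j)
  case 0
  then show ?case using nz by simp
next
  case (Suc j)
  have "(\<lambda>n. g (n - 1) / g n) \<longlonglongrightarrow> rho" by (rule ratio_pred[OF assms(1)])
  then have "(\<lambda>n. g (n - j - 1) / g (n - j)) \<longlonglongrightarrow> rho"
    by (rule filterlim_compose) (rule filterlim_minus_const_nat_at_top)
  from tendsto_mult[OF this Suc.IH] show ?case using nz by (simp add: field_simps)
qed

text \<open>The coefficients of the power \<open>m + 1\<close> are convolutions of those of the
  power \<open>m\<close> with those of \<open>inv_root\<close>. Relative to the power
  \<open>m\<close>, the first \<open>J\<close> terms tend to a partial sum of the divergent series
  of \<open>inv_root\<close> at \<open>rho\<close>. For \<open>m = 0\<close> the numerators vanish
  from index 1 on.\<close>

lemma inv_root_power_little_o: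
  "(\<lambda>n. inv_root ^ m $ n / inv_root ^ Suc m $ n) \<longlonglongrightarrow> 0"
proof (cases "m = 0")
  case True
  have "\<forall>\<^sub>F n in sequentially. 0 = inv_root ^ m $ n / inv_root ^ Suc m $ n"
    using eventually_gt_at_top[of 0] by eventually_elim (simp add: True)
  then show ?thesis by (rule Lim_transform_eventually[rotated]) simp
next
  case False
  define c where "c = (\<lambda>n. inv_root ^ m $ n)"
  define d where "d = (\<lambda>n. inv_root ^ Suc m $ n)"
  define h where "h = (\<lambda>n. inv_root $ n)"
  have cp: "c n > 0" and dp: "d n > 0" and hp: "h n > 0" for n
    using inv_root_power_pos[of m n] inv_root_power_pos[of "Suc m" n] inv_root_power_pos[of 1 n] False
    by (auto simp: c_def d_def h_def)
  have "filterlim (\<lambda>n. d n / c n) at_top sequentially"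
    unfolding filterlim_at_top
  proof
    fix B :: real
    have "\<exists>J. (\<Sum>j<J. h j * rho ^ j) > B + 1"
    proof (rule ccontr)
      assume "\<not> (\<exists>J. (\<Sum>j<J. h j * rho ^ j) > B + 1)"
      then have "(\<Sum>j<J. h j * rho ^ j) \<le> B + 1" for J by (auto simp: not_less)
      then have "summable (\<lambda>j. h j * rho ^ j)"
        using hp rho_bounds by (intro summableI_nonneg_bounded[where x = "B + 1"]) (auto simp: less_imp_le)
      then show False using inv_root_not_summable by (simp add: h_def)
    qed
    then obtain J where J: "(\<Sum>j<J. h j * rho ^ j) > B + 1" ..
    have "(\<lambda>n. \<Sum>j<J. h j * (c (n - j) / c n)) \<longlonglongrightarrow> (\<Sum>j<J. h j * rho ^ j)"
      using cp inv_root_power_ratio[of m] False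
      by (intro tendsto_sum tendsto_mult tendsto_const ratio_shift) (auto simp: c_def less_imp_neq[THEN not_sym])
    then have "\<forall>\<^sub>F n in sequentially. (\<Sum>j<J. h j * (c (n - j) / c n)) > B"
      using J by (intro order_tendstoD(1)) auto
    then show "\<forall>\<^sub>F n in sequentially. B \<le> d n / c n"
      using eventually_ge_at_top[of J]
    proof eventually_elim
      case (elim n)
      have "(\<Sum>j<J. h j * c (n - j)) \<le> (\<Sum>j=0..n. h j * c (n - j))"
        using elim(2) hp cp by (intro sum_mono2) (auto intro: mult_nonneg_nonneg less_imp_le)
      also have "\<dots> = d n" by (simp add: d_def h_def c_def fps_mult_nth)
      finally have "(\<Sum>j<J. h j * c (n - j)) / c n \<le> d n / c n" using cp[of n] by (intro divide_right_mono) auto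
      then show ?case using elim(1) by (simp add: sum_divide_distrib)
    qed
  qed
  then have "(\<lambda>n. inverse (d n / c n)) \<longlonglongrightarrow> 0"
    by (rule tendsto_inverse_0_at_top)
  then show ?thesis by (simp add: c_def d_def)
qed

text \<open>Induction on the polynomial: multiplication by \<open>fps_X\<close> shifts the index by
  one, which costs a factor \<open>rho\<close> relative to \<open>g\<close>.\<close>

lemma poly_mult_tendsto:
  fixes G :: "real fps" and g :: "nat \<Rightarrow> real"
  assumes G: "(\<lambda>n. G $ n / g n) \<longlonglongrightarrow> L"
    and g: "(\<lambda>n. g (Suc n) / g n) \<longlonglongrightarrow> alpha" and nz: "\<And>n. g n \<noteq> 0"
  shows "(\<lambda>n. (fps_of_poly p * G) $ n / g n) \<longlonglongrightarrow> poly p rho * L"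
proof (induction p)
  case 0
  then show ?case by simp
next
  case (pCons a p)
  have "(\<lambda>n. (fps_of_poly p * G) $ (n - 1) / g (n - 1)) \<longlonglongrightarrow> poly p rho * L"
    using pCons.IH by (rule filterlim_compose) (rule filterlim_minus_const_nat_at_top)
  from tendsto_add[OF tendsto_mult[OF tendsto_const[of a] G] tendsto_mult[OF this ratio_pred[OF g]]]
  have "(\<lambda>n. a * (G $ n / g n) + (fps_of_poly p * G) $ (n - 1) / g (n - 1) * (g (n - 1) / g n))
      \<longlonglongrightarrow> a * L + poly p rho * L * rho" .
  moreover have "\<forall>\<^sub>F n in sequentially. a * (G $ n / g n) + (fps_of_poly p * G) $ (n - 1) / g (n - 1) * (g (n - 1) / g n)
      = (fps_of_poly (pCons a p) * G) $ n / g n"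
    using eventually_gt_at_top[of 0]
  proof eventually_elim
    case (elim n)
    have "fps_of_poly (pCons a p) * G = fps_const a * G + fps_X * (fps_of_poly p * G)"
      by (simp add: fps_of_poly_pCons algebra_simps)
    then have "(fps_of_poly (pCons a p) * G) $ n = a * G $ n + (fps_of_poly p * G) $ (n - 1)"
      using elim by simp
    then show ?case using nz by (simp add: add_divide_distrib)
  qed
  ultimately have "(\<lambda>n. (fps_of_poly (pCons a p) * G) $ n / g n) \<longlonglongrightarrow> a * L + poly p rho * L * rho"
    by (rule Lim_transform_eventually)
  then show ?case by (simp add: algebra_simps)
qed

text \<open>Multiplying back by \<open>inv_root ^ m\<close> cancels one factor in the root part, so
  that part is a polynomial times a lower power and negligible.\<close>

lemma quad_repr_tendsto:
  assumes "quad_repr (F * disc_root ^ m) l" and m: "m \<ge> 1"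
  shows "(\<lambda>n. F $ n / inv_root ^ m $ n) \<longlonglongrightarrow> l"
proof -
  obtain p r where pr: "F * disc_root ^ m = fps_of_poly p + fps_of_poly r * disc_root" "poly p rho = l"
    using assms by (auto simp: quad_repr_def)
  obtain k where k: "m = Suc k" using m by (cases m) auto
  have "F = (F * disc_root ^ m) * inv_root ^ m"
  proof -
    have "(F * disc_root ^ m) * inv_root ^ m = F * (disc_root * inv_root) ^ m"
      by (simp add: power_mult_distrib mult.assoc)
    then show ?thesis by (simp add: inv_root_mult)
  qed
  also have "\<dots> = (fps_of_poly p + fps_of_poly r * disc_root) * inv_root ^ m" by (simp only: pr(1))
  also have "\<dots> = fps_of_poly p * inv_root ^ m + fps_of_poly r * ((disc_root * inv_root) * inv_root ^ k)"
    by (simp add: k algebra_simps)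
  finally have F: "F = fps_of_poly p * inv_root ^ m + fps_of_poly r * inv_root ^ k"
    by (simp add: inv_root_mult)
  have nz: "inv_root ^ m $ n \<noteq> 0" for n using inv_root_power_pos[OF m, of n] by simp
  have 1: "(\<lambda>n. (fps_of_poly p * inv_root ^ m) $ n / inv_root ^ m $ n) \<longlonglongrightarrow> poly p rho * 1"
    by (rule poly_mult_tendsto[OF _ inv_root_power_ratio[OF m] nz]) (simp add: nz)
  have 2: "(\<lambda>n. (fps_of_poly r * inv_root ^ k) $ n / inv_root ^ m $ n) \<longlonglongrightarrow> poly r rho * 0"
    by (rule poly_mult_tendsto[OF _ inv_root_power_ratio[OF m] nz]) (unfold k, rule inv_root_power_little_o)
  show ?thesis using tendsto_add[OF 1 2] pr(2) F by (simp add: add_divide_distrib)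
qed

section \<open>Convergence of the joint moments\<close>

lemma sep_gf_Nil_nth: "n \<ge> 1 \<Longrightarrow> sep_gf [] $ n = real (card (separable_perms n))"
  by (simp add: sep_gf_def occ_prod_def)

lemma sep_gf_Nil_pos: "n \<ge> 1 \<Longrightarrow> sep_gf [] $ n > 0"
  by (simp add: sep_gf_Nil_nth card_gt_0_iff finite_separable_perms separable_perms_nonempty)

lemma sep_gf_Nil_disc_root: "n \<ge> 2 \<Longrightarrow> sep_gf [] $ n = - disc_root $ n / 2"
  unfolding disc_root_def by (simp add: numeral_fps_const)

text \<open>The factor \<open>2 * growth\<close> compares \<open>inv_root\<close> with
  \<open>sep_gf []\<close>, whose coefficients are minus half those of \<open>disc_root\<close> from
  index 2 on. Each further mark gives \<open>growth / m\<close> with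
  \<open>m = 1, 3, 5, ...\<close>, whence the product of odd numbers.\<close>

definition growth_scale :: "nat \<Rightarrow> real" where
  "growth_scale k = 2 * growth ^ k / (\<Prod>i<k - 1. 2 * real i + 1)"

lemma growth_scale_pos: "growth_scale k > 0"
  unfolding growth_scale_def using growth_pos by (intro divide_pos_pos prod_pos) auto

lemma growth_scale_Suc: "k \<ge> 1 \<Longrightarrow> growth_scale (Suc k) = growth_scale k * (growth / (2 * real k - 1))"
proof -
  assume "k \<ge> 1"
  then obtain j where "k = Suc j" by (cases k) auto
  then show ?thesis by (simp add: growth_scale_def mult_ac add.commute)
qed

lemma growth_scale_tendsto:
  assumes "k \<ge> 1"
  shows "(\<lambda>n. inv_root ^ (2 * k - 1) $ n / (real n ^ k * sep_gf [] $ n)) \<longlonglongrightarrow> growth_scale k"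
  using assms
proof (induction k rule: nat_induct_at_least)
  case base
  have "(\<lambda>n. (-2) * (inv_root $ n / (real n * disc_root $ n))) \<longlonglongrightarrow> (-2) * (- growth)"
    by (intro tendsto_mult tendsto_const inv_root_step)
  moreover have "\<forall>\<^sub>F n in sequentially. (-2) * (inv_root $ n / (real n * disc_root $ n))
      = inv_root ^ (2 * 1 - 1) $ n / (real n ^ 1 * sep_gf [] $ n)"
    using eventually_ge_at_top[of 2] by eventually_elim (simp add: sep_gf_Nil_disc_root)
  ultimately have "(\<lambda>n. inv_root ^ (2 * 1 - 1) $ n / (real n ^ 1 * sep_gf [] $ n)) \<longlonglongrightarrow> (-2) * (- growth)"
    by (rule Lim_transform_eventually)
  then show ?case by (simp add: growth_scale_def)
next
  case (Suc k)
  define m where "m = 2 * k - 1"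
  have m: "m \<ge> 1" "2 * Suc k - 1 = m + 2" "real m = 2 * real k - 1" using Suc.hyps by (auto simp: m_def)
  have "(\<lambda>n. (inv_root ^ m $ n / (real n ^ k * sep_gf [] $ n)) * (inv_root ^ (m + 2) $ n / (real n * inv_root ^ m $ n)))
     \<longlonglongrightarrow> growth_scale k * (growth / m)"
    using Suc.IH inv_root_power_step[OF m(1)] by (intro tendsto_mult) (simp_all add: m_def)
  moreover have "\<forall>\<^sub>F n in sequentially.
     (inv_root ^ m $ n / (real n ^ k * sep_gf [] $ n)) * (inv_root ^ (m + 2) $ n / (real n * inv_root ^ m $ n))
     = inv_root ^ (m + 2) $ n / (real n ^ Suc k * sep_gf [] $ n)"
    using eventually_ge_at_top[of 2]
  proof eventually_elim
    case (elim n)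
    have "inv_root ^ m $ n \<noteq> 0" using inv_root_power_pos[OF m(1), of n] by simp
    then show ?case by (simp del: power_add add: power_Suc mult.commute mult.left_commute)
  qed
  ultimately have "(\<lambda>n. inv_root ^ (m + 2) $ n / (real n ^ Suc k * sep_gf [] $ n)) \<longlonglongrightarrow> growth_scale k * (growth / m)"
    by (rule Lim_transform_eventually)
  then show ?case unfolding m(2) growth_scale_Suc[OF Suc.hyps] m(3) .
qed

lemma sep_gf_tendsto:
  assumes "weight q > 0"
  shows "(\<lambda>n. sep_gf q $ n / (real n ^ weight q * sep_gf [] $ n)) \<longlonglongrightarrow> lead q * growth_scale (weight q)"
proof -
  define k where "k = weight q"
  have k: "k \<ge> 1" "2 * k - 1 \<ge> 1" using assms by (auto simp: k_def)
  have "(\<lambda>n. (sep_gf q $ n / inv_root ^ (2 * k - 1) $ n) * (inv_root ^ (2 * k - 1) $ n / (real n ^ k * sep_gf [] $ n)))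
     \<longlonglongrightarrow> lead q * growth_scale k"
    using quad_repr_gf[OF assms] k
    by (intro tendsto_mult growth_scale_tendsto quad_repr_tendsto) (auto simp: k_def)
  moreover have "inv_root ^ (2 * k - 1) $ n \<noteq> 0" for n using inv_root_power_pos[OF k(2), of n] by simp
  ultimately show ?thesis by (simp add: k_def)
qed

lemma binomial_ratio_tendsto: "(\<lambda>n. real n ^ k / real (n choose k)) \<longlonglongrightarrow> fact k"
proof (induction k)
  case 0
  then show ?case by simp
next
  case (Suc k)
  have "(\<lambda>n. real n / (real n - real k)) \<longlonglongrightarrow> 1" by real_asymp
  then have "(\<lambda>n. real n ^ k / real (n choose k) * (real (Suc k) * (real n / (real n - real k))))
      \<longlonglongrightarrow> fact k * (real (Suc k) * 1)"
    using Suc.IH by (intro tendsto_mult tendsto_const)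
  moreover have "\<forall>\<^sub>F n in sequentially. real n ^ k / real (n choose k) * (real (Suc k) * (real n / (real n - real k)))
      = real n ^ Suc k / real (n choose Suc k)"
    using eventually_gt_at_top[of k]
  proof eventually_elim
    case (elim n)
    have "real (Suc k) * real (n choose Suc k) = (real n - real k) * real (n choose k)"
    proof -
      have "Suc k * (n choose Suc k) = (n - k) * (n choose k)"
        by (simp only: binomial_absorb_comp binomial_absorption)
      from arg_cong[where f = real, OF this] show ?thesis
        using elim by (simp only: of_nat_mult) (simp add: of_nat_diff)
    qed
    then have "real (n choose Suc k) = (real n - real k) * real (n choose k) / real (Suc k)"
      by (simp add: field_simps)
    then show ?case by (simp del: of_nat_Suc add: mult_ac)
  qed
  ultimately have "(\<lambda>n. real n ^ Suc k / real (n choose Suc k)) \<longlonglongrightarrow> fact k * (real (Suc k) * 1)"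
    by (rule Lim_transform_eventually)
  then show ?case by (simp add: mult.commute)
qed

definition is_perm :: "nat list \<Rightarrow> bool" where
  "is_perm \<pi> \<longleftrightarrow> \<pi> \<in> permutations_of_set {1..length \<pi>}"

definition occ_moment :: "nat list list \<Rightarrow> nat \<Rightarrow> real" where
  "occ_moment q n = (\<integral>\<sigma>. (\<Prod>\<pi>\<leftarrow>q. occ \<pi> \<sigma>) \<partial>uniform_separable n)"

text \<open>The factorials convert the normalization by powers of \<open>n\<close> into the one by
  binomial coefficients.\<close>

definition limit_moment :: "nat list list \<Rightarrow> real" where
  "limit_moment q = (if weight (map (map int) q) = 0 then 1
     else lead (map (map int) q) * growth_scale (weight (map (map int) q)) * (\<Prod>\<pi>\<leftarrow>q. fact (length \<pi>)))"

lemma integral_uniform_separable: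
  fixes f :: "nat list \<Rightarrow> real"
  shows "(\<integral>\<sigma>. f \<sigma> \<partial>uniform_separable n) = (\<Sum>\<sigma>\<in>separable_perms n. f \<sigma>) / card (separable_perms n)"
  unfolding uniform_separable_def
  by (rule integral_pmf_of_set) (simp_all add: finite_separable_perms separable_perms_nonempty)

lemma occ_moment_eq:
  assumes q: "\<And>\<pi>. \<pi> \<in> set q \<Longrightarrow> is_perm \<pi>" and n: "n \<ge> 1"
  shows "occ_moment q n = sep_gf (map (map int) q) $ n / sep_gf [] $ n / (\<Prod>\<pi>\<leftarrow>q. real (n choose length \<pi>))"
proof -
  have "(\<Prod>\<pi>\<leftarrow>q. occ \<pi> \<sigma>) = occ_prod (map (map int) q) \<sigma> / (\<Prod>\<pi>\<leftarrow>q. real (n choose length \<pi>))"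
    if "\<sigma> \<in> separable_perms n" for \<sigma>
    using q
  proof (induction q)
    case (Cons \<pi> q)
    have "occ \<pi> \<sigma> = real (card (occs (map int \<pi>) \<sigma>)) / real (n choose length \<pi>)"
      using occ_eq_card_occs[of \<pi> "length \<pi>" \<sigma>] Cons.prems separable_perms_length[OF that]
      by (simp add: is_perm_def)
    then show ?case using Cons by (simp add: occ_prod_def)
  qed (simp add: occ_prod_def)
  then have "(\<Sum>\<sigma>\<in>separable_perms n. \<Prod>\<pi>\<leftarrow>q. occ \<pi> \<sigma>)
      = (\<Sum>\<sigma>\<in>separable_perms n. occ_prod (map (map int) q) \<sigma> / (\<Prod>\<pi>\<leftarrow>q. real (n choose length \<pi>)))"
    by (rule sum.cong[OF refl])
  also have "\<dots> = (\<Sum>\<sigma>\<in>separable_perms n. occ_prod (map (map int) q) \<sigma>) / (\<Prod>\<pi>\<leftarrow>q. real (n choose length \<pi>))"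
    by (rule sum_divide_distrib[symmetric])
  also have "(\<Sum>\<sigma>\<in>separable_perms n. occ_prod (map (map int) q) \<sigma>) = sep_gf (map (map int) q) $ n"
    using n by (simp add: sep_gf_def)
  finally show ?thesis
    using n by (simp add: occ_moment_def integral_uniform_separable sep_gf_Nil_nth mult.commute)
qed

lemma occ_moment_tendsto:
  assumes q: "\<And>\<pi>. \<pi> \<in> set q \<Longrightarrow> is_perm \<pi>"
  shows "occ_moment q \<longlonglongrightarrow> limit_moment q"
proof (cases "weight (map (map int) q) = 0")
  case True
  have "\<forall>\<pi>\<in>set q. \<pi> = []" using True by (simp add: weight_def)
  then have p1: "(\<Prod>\<pi>\<leftarrow>q. real (n choose length \<pi>)) = 1" for n by (induction q) auto
  have "\<forall>\<^sub>F n in sequentially. 1 = occ_moment q n"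
    using eventually_ge_at_top[of 1]
  proof eventually_elim
    case (elim n)
    then show ?case using sep_gf_Nil_pos[of n] sep_gf_weight_0[OF True] p1 by (simp add: occ_moment_eq[OF q])
  qed
  then have "occ_moment q \<longlonglongrightarrow> 1" by (rule Lim_transform_eventually[rotated]) simp
  then show ?thesis using True by (simp add: limit_moment_def)
next
  case False
  define k where "k = weight (map (map int) q)"
  have kq: "k = (\<Sum>\<pi>\<leftarrow>q. length \<pi>)" by (simp add: k_def weight_def comp_def)
  have "(\<lambda>n. \<Prod>\<pi>\<leftarrow>q. real n ^ length \<pi> / real (n choose length \<pi>)) \<longlonglongrightarrow> (\<Prod>\<pi>\<leftarrow>q. fact (length \<pi>))"
  proof (induction q)
    case (Cons a q)
    then show ?case using tendsto_mult[OF binomial_ratio_tendsto[of "length a"] Cons.IH] by simp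
  qed simp
  moreover have "(\<Prod>\<pi>\<leftarrow>q. real n ^ length \<pi> / real (n choose length \<pi>))
     = real n ^ k / (\<Prod>\<pi>\<leftarrow>q. real (n choose length \<pi>))" for n
    unfolding kq by (induction q) (auto simp: power_add)
  ultimately have lim: "(\<lambda>n. real n ^ k / (\<Prod>\<pi>\<leftarrow>q. real (n choose length \<pi>))) \<longlonglongrightarrow> (\<Prod>\<pi>\<leftarrow>q. fact (length \<pi>))"
    by simp
  have w: "weight (map (map int) q) > 0" using False by simp
  have "(\<lambda>n. sep_gf (map (map int) q) $ n / (real n ^ k * sep_gf [] $ n) * (real n ^ k / (\<Prod>\<pi>\<leftarrow>q. real (n choose length \<pi>))))
     \<longlonglongrightarrow> lead (map (map int) q) * growth_scale k * (\<Prod>\<pi>\<leftarrow>q. fact (length \<pi>))"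
    using tendsto_mult[OF sep_gf_tendsto[OF w] lim] unfolding k_def .
  moreover have "\<forall>\<^sub>F n in sequentially.
     sep_gf (map (map int) q) $ n / (real n ^ k * sep_gf [] $ n) * (real n ^ k / (\<Prod>\<pi>\<leftarrow>q. real (n choose length \<pi>)))
     = occ_moment q n"
    using eventually_ge_at_top[of 1] by eventually_elim (simp add: occ_moment_eq[OF q])
  ultimately have "occ_moment q \<longlonglongrightarrow> lead (map (map int) q) * growth_scale k * (\<Prod>\<pi>\<leftarrow>q. fact (length \<pi>))"
    by (rule Lim_transform_eventually)
  then show ?thesis using False by (simp add: limit_moment_def k_def)
qed

lemma occ_not_perm:
  assumes "\<not> is_perm \<pi>" "\<sigma> \<in> separable_perms n"
  shows "occ \<pi> \<sigma> = 0"
proof -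
  have "pat I \<sigma> \<noteq> \<pi>" for I
  proof
    assume "pat I \<sigma> = \<pi>"
    moreover have "distinct (nths \<sigma> I)" using assms(2) by (simp add: separable_perms_iff)
    ultimately have "\<pi> \<in> permutations_of_set {1..length \<pi>}"
      using standardize_perm[of "nths \<sigma> I"] by (auto simp: pat_def)
    then show False using assms(1) by (simp add: is_perm_def)
  qed
  then show ?thesis by (simp add: occ_def)
qed

lemma occ_moment_convergent: "convergent (occ_moment q)"
proof (cases "\<forall>\<pi>\<in>set q. is_perm \<pi>")
  case True
  then show ?thesis using occ_moment_tendsto convergentI by blast
next
  case False
  then obtain \<pi> where \<pi>: "\<pi> \<in> set q" "\<not> is_perm \<pi>" by blast
  have "(\<Prod>\<pi>\<leftarrow>q. occ \<pi> \<sigma>) = 0" if "\<sigma> \<in> separable_perms n" for \<sigma> n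
  proof -
    have "0 \<in> set (map (\<lambda>\<pi>. occ \<pi> \<sigma>) q)" using \<pi> occ_not_perm[OF \<pi>(2) that] by force
    then show ?thesis by (simp only: prod_list_zero_iff)
  qed
  then have "occ_moment q = (\<lambda>n. 0)"
    by (intro ext) (simp add: occ_moment_def integral_uniform_separable)
  then show ?thesis by (simp add: convergent_const)
qed

section \<open>A space-filling curve\<close>

text \<open>A clipped cosine of period 2: since \<open>cos (pi / 3) = 1 / 2\<close> and
  \<open>cos (2 * pi / 3) = - 1 / 2\<close>, it is 0 on \<open>[0, 1/3]\<close> and 1 on
  \<open>[2/3, 1]\<close>.\<close>

definition bump :: "real \<Rightarrow> real" where
  "bump t = max 0 (min 1 (1 / 2 - cos (pi * t)))"

lemma bump_bounds: "0 \<le> bump t" "bump t \<le> 1"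
  by (auto simp: bump_def)

text \<open>The shape of a ternary number with digits 0 and 2 after multiplication by a power of 3:
  an even integer part, the current digit \<open>2 * b\<close>, and a remainder.\<close>

lemma bump_eq:
  assumes "t = 2 * of_int k + 2 * b / 3 + r" "0 \<le> r" "r \<le> 1 / 3" "b = 0 \<or> b = 1"
  shows "bump t = b"
proof -
  define s where "s = 2 * b / 3 + r"
  have "pi * t = pi * s + (2 * pi) * of_int k" using assms(1) by (simp add: s_def algebra_simps)
  then have c: "cos (pi * t) = cos (pi * s)"
    by (simp only: cos_add cos_int_2pin sin_int_2pin)
  show ?thesis
  proof (cases "b = 0")
    case True
    then have s: "0 \<le> s" "s \<le> 1 / 3" using assms by (auto simp: s_def)
    have "cos (pi / 3) \<le> cos (pi * s)"
      by (rule cos_monotone_0_pi_le) (use s in \<open>auto simp: field_simps\<close>)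
    then show ?thesis using True by (simp add: bump_def c cos_60)
  next
    case False
    then have b: "b = 1" using assms by auto
    then have s: "2 / 3 \<le> s" "s \<le> 1" using assms by (auto simp: s_def)
    have "cos (pi * s) \<le> cos (2 * pi / 3)"
      by (rule cos_monotone_0_pi_le) (use s in \<open>auto simp: field_simps\<close>)
    also have "cos (2 * pi / 3) = - (1 / 2)" by (simp add: cos_120)
    finally show ?thesis using b by (simp add: bump_def c)
  qed
qed

lemma binary_expansion:
  fixes x :: real
  assumes "0 \<le> x" "x \<le> 1"
  obtains b :: "nat \<Rightarrow> real" where "\<And>i. b i = 0 \<or> b i = 1" "(\<lambda>i. b i / 2 ^ Suc i) sums x"
proof (cases "x = 1")
  \<comment> \<open>The floors below would give only digits 0 for \<open>x = 1\<close>; the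
    expansion with all digits 1 is used instead.\<close>
  case True
  have "(\<lambda>i. (1::real) / 2 ^ Suc i) sums 1" using power_half_series by (simp add: power_divide)
  then show ?thesis using that[of "\<lambda>_. 1"] True by simp
next
  case False
  define f where "f i = real_of_int \<lfloor>2 ^ i * x\<rfloor> / 2 ^ i" for i :: nat
  define b :: "nat \<Rightarrow> real" where "b i = of_int (\<lfloor>2 ^ Suc i * x\<rfloor> - 2 * \<lfloor>2 ^ i * x\<rfloor>)" for i :: nat
  have "b i = (0::real) \<or> b i = 1" for i
  proof -
    define y where "y = 2 ^ i * x"
    have "\<lfloor>2 * y\<rfloor> = 2 * \<lfloor>y\<rfloor> \<or> \<lfloor>2 * y\<rfloor> = 2 * \<lfloor>y\<rfloor> + 1" by linarith
    then show ?thesis by (auto simp: b_def y_def mult.assoc)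
  qed
  moreover have "(\<lambda>i. b i / 2 ^ Suc i) sums x"
  proof -
    have "b i / 2 ^ Suc i = f (Suc i) - f i" for i
      by (simp add: b_def f_def field_simps)
    moreover have "(\<lambda>i. f (Suc i) - f i) sums (x - f 0)"
    proof (rule telescope_sums)
      show "f \<longlonglongrightarrow> x"
      proof (rule tendsto_sandwich[of "\<lambda>i. x - (1 / 2) ^ i" f sequentially "\<lambda>i. x"])
        show "\<forall>\<^sub>F i in sequentially. x - (1 / 2) ^ i \<le> f i"
        proof (intro always_eventually allI)
          fix i
          have "2 ^ i * x - 1 \<le> of_int \<lfloor>2 ^ i * x\<rfloor>" by linarith
          then have "(2 ^ i * x - 1) / 2 ^ i \<le> f i" unfolding f_def by (intro divide_right_mono) auto
          then show "x - (1 / 2) ^ i \<le> f i" by (simp add: diff_divide_distrib power_one_over)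
        qed
        show "\<forall>\<^sub>F i in sequentially. f i \<le> x"
        proof (intro always_eventually allI)
          fix i
          have "of_int \<lfloor>2 ^ i * x\<rfloor> \<le> 2 ^ i * x" by linarith
          then show "f i \<le> x" by (simp add: f_def field_simps)
        qed
        have "(\<lambda>i. x - (1 / 2) ^ i) \<longlonglongrightarrow> x - 0" by (intro tendsto_diff tendsto_const LIMSEQ_power_zero) simp
        then show "(\<lambda>i. x - (1 / 2) ^ i) \<longlonglongrightarrow> x" by simp
      qed simp
    qed
    moreover have "f 0 = 0" using assms False by (simp add: f_def floor_eq_iff)
    ultimately show ?thesis by simp
  qed
  ultimately show ?thesis by (rule that)
qed

text \<open>The point of the Cantor set with ternary digits \<open>2 * b m\<close>. After
  multiplication by \<open>3 ^ j\<close> the digits before \<open>j\<close> form an even integer and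
  those after \<open>j\<close> sum to at most \<open>1 / 3\<close>.\<close>

lemma ternary_point:
  fixes b :: "nat \<Rightarrow> real"
  assumes b: "\<And>i. b i = 0 \<or> b i = 1"
  obtains c where "c \<in> {0..1}" "\<And>j. bump (3 ^ j * c) = b j"
proof -
  define t where "t m = 2 * b m / 3 ^ Suc m" for m
  have geo: "(\<lambda>m. 2 / (3::real) ^ Suc (m + j)) sums (1 / 3 ^ j)" for j
  proof -
    have "(\<lambda>m. (2 / 3 ^ Suc j) * (1 / 3 :: real) ^ m) sums ((2 / 3 ^ Suc j) * (1 / (1 - 1 / 3)))"
      by (intro sums_mult geometric_sums) simp
    then show ?thesis by (simp add: power_add power_divide field_simps)
  qed
  have tb: "0 \<le> t m" "t m \<le> 2 / 3 ^ Suc m" for m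
    using b[of m] by (auto simp: t_def)
  have st: "summable t"
    by (rule summable_comparison_test'[of "\<lambda>m. 2 / 3 ^ Suc m" 0]) (use geo[of 0] tb sums_summable in auto)
  define c where "c = suminf t"
  have tail: "0 \<le> (\<Sum>m. t (m + j))" "(\<Sum>m. t (m + j)) \<le> 1 / 3 ^ j" for j
  proof -
    have s: "summable (\<lambda>m. t (m + j))" using st by (rule summable_ignore_initial_segment)
    show "0 \<le> (\<Sum>m. t (m + j))" using s tb by (intro suminf_nonneg) auto
    have "(\<Sum>m. t (m + j)) \<le> (\<Sum>m. 2 / 3 ^ Suc (m + j))"
      using s tb geo[of j] by (intro suminf_le) (auto intro: sums_summable)
    then show "(\<Sum>m. t (m + j)) \<le> 1 / 3 ^ j" using geo[of j] by (simp add: sums_iff)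
  qed
  have "c \<in> {0..1}" using tail[of 0] by (simp add: c_def)
  moreover have "bump (3 ^ j * c) = b j" for j
  proof (rule bump_eq)
    define k where "k = (\<Sum>m<j. (if b m = 1 then 3 ^ (j - Suc m) else 0) :: int)"
    define r where "r = 3 ^ j * (\<Sum>m. t (m + Suc j))"
    have "c = (\<Sum>m. t (m + Suc j)) + (\<Sum>m<Suc j. t m)"
      unfolding c_def by (rule suminf_split_initial_segment[OF st])
    then have "3 ^ j * c = r + (\<Sum>m<j. 3 ^ j * t m) + 3 ^ j * t j"
      by (simp add: r_def algebra_simps sum_distrib_right)
    also have "3 ^ j * t j = 2 * b j / 3" by (simp add: t_def)
    also have "(\<Sum>m<j. 3 ^ j * t m) = 2 * of_int k"
    proof -
      have "3 ^ j * t m = 2 * of_int (if b m = 1 then 3 ^ (j - Suc m) else 0)" if "m < j" for m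
      proof -
        have "(3::real) ^ j = 3 ^ ((j - Suc m) + Suc m)" using that by simp
        then have "(3::real) ^ j = 3 ^ (j - Suc m) * 3 ^ Suc m" by (simp only: power_add)
        then show ?thesis using b[of m] by (auto simp: t_def)
      qed
      then show ?thesis by (simp add: k_def sum_distrib_left)
    qed
    finally show "3 ^ j * c = 2 * of_int k + 2 * b j / 3 + r" by simp
    show "0 \<le> r" "r \<le> 1 / 3" using tail[of "Suc j"] by (auto simp: r_def field_simps)
    show "b j = 0 \<or> b j = 1" by (rule b)
  qed
  ultimately show ?thesis by (rule that)
qed

text \<open>Schoenberg's space-filling curve, with all coordinates of the Hilbert cube.\<close>

definition curve :: "nat \<Rightarrow> real \<Rightarrow> real" where
  "curve k c = (\<Sum>i. bump (3 ^ prod_encode (k, i) * c) / 2 ^ Suc i)"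

lemma half_sums: "(\<lambda>i. 1 / (2::real) ^ Suc i) sums 1"
  using power_half_series by (simp add: power_divide)

lemma curve_summable: "summable (\<lambda>i. bump (3 ^ prod_encode (k, i) * c) / 2 ^ Suc i)"
  by (rule summable_comparison_test'[of "\<lambda>i. 1 / 2 ^ Suc i" 0])
     (use half_sums sums_summable bump_bounds in \<open>auto simp: divide_right_mono\<close>)

lemma curve_bounds: "0 \<le> curve k c" "curve k c \<le> 1"
proof -
  show "0 \<le> curve k c" unfolding curve_def
    by (rule suminf_nonneg[OF curve_summable]) (simp add: bump_bounds)
  have "curve k c \<le> (\<Sum>i. 1 / 2 ^ Suc i)" unfolding curve_def
    by (rule suminf_le[OF _ curve_summable]) (use half_sums sums_summable bump_bounds in \<open>auto simp: divide_right_mono\<close>)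
  then show "curve k c \<le> 1" using half_sums by (simp add: sums_iff)
qed

lemma curve_continuous: "continuous_on UNIV (curve k)"
proof -
  have u: "uniform_limit UNIV (\<lambda>n x. \<Sum>i<n. bump (3 ^ prod_encode (k, i) * x) / 2 ^ Suc i)
      (\<lambda>x. \<Sum>i. bump (3 ^ prod_encode (k, i) * x) / 2 ^ Suc i) sequentially"
    by (rule Weierstrass_m_test[where M = "\<lambda>i. 1 / 2 ^ Suc i"])
       (use half_sums sums_summable bump_bounds in \<open>auto simp: divide_right_mono\<close>)
  have "continuous_on UNIV (\<lambda>x. \<Sum>i<n. bump (3 ^ prod_encode (k, i) * x) / 2 ^ Suc i)" for n
    unfolding bump_def by (intro continuous_intros) auto
  then show ?thesis
    using uniform_limit_theorem[OF always_eventually u] by (simp add: curve_def[abs_def])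
qed

text \<open>\<open>prod_encode\<close> interleaves the binary digits of all coordinates into one
  sequence, which becomes the ternary digits of a single number.\<close>

lemma curve_surj:
  assumes "\<And>k. 0 \<le> x k" "\<And>k. x k \<le> 1"
  obtains c where "c \<in> {0..1}" "\<And>k. curve k c = x k"
proof -
  have "\<exists>b :: nat \<Rightarrow> real. (\<forall>i. b i = 0 \<or> b i = 1) \<and> (\<lambda>i. b i / 2 ^ Suc i) sums x k" for k
    using binary_expansion[OF assms, of k] by metis
  then obtain b :: "nat \<Rightarrow> nat \<Rightarrow> real" where b: "\<And>k i. b k i = 0 \<or> b k i = 1" "\<And>k. (\<lambda>i. b k i / 2 ^ Suc i) sums x k"
    by metis
  obtain c where c: "c \<in> {0..1}" "\<And>j. bump (3 ^ j * c) = case_prod b (prod_decode j)"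
    by (rule ternary_point[of "\<lambda>j. case_prod b (prod_decode j)"]) (use b in \<open>auto split: prod.split\<close>)
  have "curve k c = x k" for k
    using b(2)[of k] by (simp add: curve_def c(2) sums_iff)
  then show ?thesis using c(1) that by blast
qed

section \<open>The method of moments\<close>

definition cube :: "(nat \<Rightarrow> real) set" where
  "cube = {x. \<forall>k. 0 \<le> x k \<and> x k \<le> 1}"

lemma compact_cube: "compact cube"
proof -
  have "cube = PiE UNIV (\<lambda>_. {0..1})" by (auto simp: cube_def PiE_def Pi_def)
  moreover have "compactin (product_topology (\<lambda>_. euclidean :: real topology) UNIV) (PiE UNIV (\<lambda>_ :: nat. {0..1}))"
    unfolding compactin_PiE by simp
  ultimately show ?thesis by (simp add: euclidean_product_topology)
qed

definition monomial :: "nat list \<Rightarrow> (nat \<Rightarrow> real) \<Rightarrow> real" where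
  "monomial ks x = (\<Prod>k\<leftarrow>ks. x k)"

text \<open>Monomials are lists of coordinates with repetition, so the expectation of such a
  function is a linear combination of mixed moments.\<close>

definition cube_poly :: "((nat \<Rightarrow> real) \<Rightarrow> real) \<Rightarrow> bool" where
  "cube_poly f \<longleftrightarrow> (\<exists>ps. f = (\<lambda>x. \<Sum>(a, ks)\<leftarrow>ps. a * monomial ks x))"

lemma cube_poly_const: "cube_poly (\<lambda>x. c)"
  unfolding cube_poly_def by (rule exI[of _ "[(c, [])]"]) (simp add: monomial_def)

lemma cube_poly_coordinate: "cube_poly (\<lambda>x. x k)"
  unfolding cube_poly_def by (rule exI[of _ "[(1, [k])]"]) (simp add: monomial_def)

lemma cube_poly_add: "cube_poly f \<Longrightarrow> cube_poly g \<Longrightarrow> cube_poly (\<lambda>x. f x + g x)"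
proof -
  assume "cube_poly f" "cube_poly g"
  then obtain ps qs where "f = (\<lambda>x. \<Sum>(a, ks)\<leftarrow>ps. a * monomial ks x)"
    "g = (\<lambda>x. \<Sum>(a, ks)\<leftarrow>qs. a * monomial ks x)" by (auto simp: cube_poly_def)
  then show ?thesis unfolding cube_poly_def by (intro exI[of _ "ps @ qs"]) simp
qed

lemma cube_poly_mult: "cube_poly f \<Longrightarrow> cube_poly g \<Longrightarrow> cube_poly (\<lambda>x. f x * g x)"
proof -
  assume "cube_poly f" "cube_poly g"
  then obtain ps qs where fg: "f = (\<lambda>x. \<Sum>(a, ks)\<leftarrow>ps. a * monomial ks x)"
    "g = (\<lambda>x. \<Sum>(a, ks)\<leftarrow>qs. a * monomial ks x)" by (auto simp: cube_poly_def)
  have single: "(\<Sum>(b, ls)\<leftarrow>map (\<lambda>(b, ls). (a * b, ks @ ls)) qs. b * monomial ls x)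
      = a * monomial ks x * g x" for a ks x
    unfolding fg(2) by (induction qs) (auto simp: monomial_def algebra_simps)
  have "(\<Sum>(a, ks)\<leftarrow>concat (map (\<lambda>(a, ks). map (\<lambda>(b, ls). (a * b, ks @ ls)) qs) ps). a * monomial ks x)
      = (\<Sum>(a, ks)\<leftarrow>ps. a * monomial ks x) * g x" for x
    by (induction ps) (auto simp: single algebra_simps simp del: map_map)
  note mult = this
  show ?thesis unfolding cube_poly_def fg(1) by (rule exI, rule ext, rule mult[symmetric])
qed

lemma monomial_continuous: "continuous_on A (monomial ks)"
proof (induction ks)
  case (Cons k ks)
  have "continuous_on A (\<lambda>x :: nat \<Rightarrow> real. x k)"
    by (rule continuous_on_subset[OF continuous_on_product_coordinates]) simp
  then have "continuous_on A (\<lambda>x. x k * monomial ks x)" using Cons.IH by (rule continuous_on_mult)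
  then show ?case by (simp add: monomial_def)
qed (simp add: monomial_def)

lemma cube_poly_continuous: "cube_poly f \<Longrightarrow> continuous_on A f"
proof -
  assume "cube_poly f"
  then obtain ps where f: "f = (\<lambda>x. \<Sum>(a, ks)\<leftarrow>ps. a * monomial ks x)" by (auto simp: cube_poly_def)
  show ?thesis unfolding f
  proof (induction ps)
    case (Cons p ps)
    then show ?case by (cases p) (auto intro!: continuous_intros monomial_continuous)
  qed simp
qed

lemma cube_poly_dense:
  assumes "continuous_on cube f" "e > 0"
  obtains g where "cube_poly g" "\<And>x. x \<in> cube \<Longrightarrow> \<bar>f x - g x\<bar> < e"
proof -
  have "\<exists>g. cube_poly g \<and> (\<forall>x\<in>cube. \<bar>f x - g x\<bar> < e)"
  proof (rule Stone_Weierstrass_HOL[OF compact_cube])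
    show "\<exists>f. cube_poly f \<and> f x \<noteq> f y" if "x \<in> cube \<and> y \<in> cube \<and> x \<noteq> y" for x y
      using that cube_poly_coordinate by (metis ext)
  qed (use assms cube_poly_const cube_poly_continuous cube_poly_add cube_poly_mult in auto)
  then show ?thesis using that by blast
qed

lemma integral_diff_le:
  fixes u v :: "'a \<Rightarrow> real"
  assumes "prob_space Q" "integrable Q u" "integrable Q v" "\<And>y. \<bar>u y - v y\<bar> < e"
  shows "\<bar>(\<integral>y. u y \<partial>Q) - (\<integral>y. v y \<partial>Q)\<bar> \<le> e"
proof -
  interpret Q: prob_space Q by fact
  have "\<bar>(\<integral>y. u y \<partial>Q) - (\<integral>y. v y \<partial>Q)\<bar> = \<bar>\<integral>y. u y - v y \<partial>Q\<bar>"
    using assms by simp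
  also have "\<dots> \<le> (\<integral>y. \<bar>u y - v y\<bar> \<partial>Q)" by (rule integral_abs_bound)
  also have "\<dots> \<le> (\<integral>y. e \<partial>Q)"
    using assms by (intro integral_mono) (auto intro: less_imp_le)
  finally show ?thesis by (simp add: Q.prob_space)
qed

text \<open>Method of moments on the Hilbert cube: a sequence of laws is transported to the line along a
  preimage under the space-filling curve, where Helly's theorem provides a limit point.\<close>

lemma moments_imp_joint_limit:
  fixes p :: "nat \<Rightarrow> 'a pmf" and X :: "nat \<Rightarrow> 'a \<Rightarrow> real"
  assumes bounds: "\<And>k a. 0 \<le> X k a" "\<And>k a. X k a \<le> 1"
    and moments: "\<And>ks. convergent (\<lambda>n. \<integral>a. (\<Prod>k\<leftarrow>ks. X k a) \<partial>p n)"
  obtains N where "real_distribution N"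
    "\<And>f :: (nat \<Rightarrow> real) \<Rightarrow> real. continuous_on cube f \<Longrightarrow>
       (\<lambda>n. \<integral>a. f (\<lambda>k. X k a) \<partial>p n) \<longlonglongrightarrow> (\<integral>c. f (\<lambda>k. curve k c) \<partial>N)"
proof -
  have "\<exists>c\<in>{0..1}. \<forall>k. curve k c = X k a" for a
    using curve_surj[of "\<lambda>k. X k a"] bounds by metis
  then obtain pt where pt: "\<And>a. pt a \<in> {0..1}" "\<And>a k. curve k (pt a) = X k a" by metis
  \<comment> \<open>Every map is measurable on a pmf, so even an arbitrary choice \<open>pt\<close>
    of preimages is a random variable.\<close>
  define \<mu> where "\<mu> n = distr (measure_pmf (p n)) borel pt" for n
  have rd: "real_distribution (\<mu> n)" for n
    unfolding \<mu>_def by (rule prob_space.real_distribution_distr) (auto intro: measure_pmf.prob_space_axioms)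
  have "tight \<mu>"
    unfolding tight_def
  proof (intro conjI allI impI)
    show "real_distribution (\<mu> n)" for n by (rule rd)
    fix e :: real assume e: "e > 0"
    \<comment> \<open>All mass lies in \<open>{0..1}\<close>; the open left end \<open>-1\<close>
      keeps the point 0 inside.\<close>
    have "measure (\<mu> n) {-1<..1} = 1" for n
    proof -
      have "pt -` {-1<..1} = UNIV" using pt(1) by (force simp: greaterThanAtMost_iff)
      then show ?thesis unfolding \<mu>_def by (subst measure_distr) auto
    qed
    then show "\<exists>a b. a < b \<and> (\<forall>n. measure (\<mu> n) {a<..b} > 1 - e)"
      using e by (intro exI[of _ "-1"] exI[of _ 1]) auto
  qed
  then obtain r N where r: "strict_mono r" "real_distribution N" "weak_conv_m (\<mu> \<circ> id \<circ> r) N"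
    using tight_imp_convergent_subsubsequence[of \<mu> id] by (auto simp: strict_mono_id)
  interpret N: real_distribution N by fact
  define \<xi> where "\<xi> c = (\<lambda>k. curve k c)" for c
  have \<xi>_cube: "\<xi> c \<in> cube" for c using curve_bounds by (simp add: cube_def \<xi>_def)
  have X_cube: "(\<lambda>k. X k a) \<in> cube" for a using bounds by (simp add: cube_def)
  have \<xi>_cont: "continuous_on UNIV \<xi>"
    unfolding \<xi>_def by (intro continuous_on_coordinatewise_then_product curve_continuous)
  have f\<xi>_cont: "continuous_on UNIV (\<lambda>c. f (\<xi> c))" if "continuous_on cube f" for f :: "_ \<Rightarrow> real"
    by (rule continuous_on_compose2[OF that \<xi>_cont]) (use \<xi>_cube in auto)
  have bdd: "\<exists>B. \<forall>x\<in>cube. norm (f x) \<le> B" if "continuous_on cube f" for f :: "_ \<Rightarrow> real"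
    using compact_imp_bounded[OF compact_continuous_image[OF that compact_cube]]
    by (auto simp: bounded_iff)
  have intN: "integrable N (\<lambda>c. f (\<xi> c))" if f: "continuous_on cube f" for f :: "_ \<Rightarrow> real"
  proof -
    obtain B where "\<forall>x\<in>cube. norm (f x) \<le> B" using bdd[OF f] ..
    then show ?thesis
      by (intro N.integrable_const_bound[where B = B] AE_I2)
         (use \<xi>_cube borel_measurable_continuous_onI[OF f\<xi>_cont[OF f]] in auto)
  qed
  have intp: "integrable (p n) (\<lambda>a. f (\<lambda>k. X k a))" if f: "continuous_on cube f" for f :: "_ \<Rightarrow> real" and n
  proof -
    obtain B where "\<forall>x\<in>cube. norm (f x) \<le> B" using bdd[OF f] ..
    then show ?thesis
      by (intro measure_pmf.integrable_const_bound[where B = B] AE_I2) (use X_cube in auto)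
  qed
  have sub: "(\<lambda>n. \<integral>a. f (\<lambda>k. X k a) \<partial>p (r n)) \<longlonglongrightarrow> (\<integral>c. f (\<xi> c) \<partial>N)"
    if f: "continuous_on cube f" for f :: "_ \<Rightarrow> real"
  proof -
    obtain B where B: "\<forall>x\<in>cube. norm (f x) \<le> B" using bdd[OF f] ..
    have c: "continuous_on UNIV (\<lambda>c. f (\<xi> c))" by (rule f\<xi>_cont[OF f])
    have "weak_conv_m (\<lambda>n. \<mu> (r n)) N" using r(3) by (simp add: comp_def)
    then have "(\<lambda>n. integral\<^sup>L (\<mu> (r n)) (\<lambda>c. f (\<xi> c))) \<longlonglongrightarrow> integral\<^sup>L N (\<lambda>c. f (\<xi> c))"
      using r(2) rd c B \<xi>_cube
      by (intro weak_conv_imp_integral_bdd_continuous_conv[where B = B])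
         (auto simp: continuous_on_eq_continuous_at)
    moreover have "integral\<^sup>L (\<mu> (r n)) (\<lambda>c. f (\<xi> c)) = (\<integral>a. f (\<lambda>k. X k a) \<partial>p (r n))" for n
      using borel_measurable_continuous_onI[OF c]
      by (simp add: \<mu>_def integral_distr) (simp add: \<xi>_def pt(2))
    ultimately show ?thesis by simp
  qed
  \<comment> \<open>For polynomials, \<open>moments\<close> makes the full sequence converge, and
    the limit is then identified along the subsequence \<open>r\<close>.\<close>
  have conv: "(\<lambda>n. \<integral>a. f (\<lambda>k. X k a) \<partial>p n) \<longlonglongrightarrow> (\<integral>c. f (\<xi> c) \<partial>N)"
    if f: "cube_poly f" for f
  proof -
    obtain ps where ps: "f = (\<lambda>x. \<Sum>(a, ks)\<leftarrow>ps. a * monomial ks x)" using f by (auto simp: cube_poly_def)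
    have int: "integrable (p n) (\<lambda>a. \<Sum>(b, ks)\<leftarrow>ps. b * monomial ks (\<lambda>k. X k a))" for ps n
      by (rule intp[of "\<lambda>x. \<Sum>(b, ks)\<leftarrow>ps. b * monomial ks x"], rule cube_poly_continuous)
         (auto simp: cube_poly_def)
    have "convergent (\<lambda>n. \<integral>a. (\<Sum>(b, ks)\<leftarrow>ps. b * monomial ks (\<lambda>k. X k a)) \<partial>p n)"
    proof (induction ps)
      case Nil
      then show ?case by (simp add: convergent_const)
    next
      case (Cons bk ps)
      obtain b ks where bk: "bk = (b, ks)" by (cases bk)
      have i: "integrable (p n) (\<lambda>a. b * monomial ks (\<lambda>k. X k a))" for n
        using int[of n "[(b, ks)]"] by simp
      have "convergent (\<lambda>n. b * (\<integral>a. monomial ks (\<lambda>k. X k a) \<partial>p n))"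
        using moments[of ks] convergent_mult[OF convergent_const] by (simp add: monomial_def)
      then have "convergent (\<lambda>n. b * (\<integral>a. monomial ks (\<lambda>k. X k a) \<partial>p n)
          + (\<integral>a. (\<Sum>(b, ks)\<leftarrow>ps. b * monomial ks (\<lambda>k. X k a)) \<partial>p n))"
        using Cons.IH by (rule convergent_add)
      then show ?case using i int by (simp add: bk)
    qed
    then obtain L where L: "(\<lambda>n. \<integral>a. f (\<lambda>k. X k a) \<partial>p n) \<longlonglongrightarrow> L"
      by (auto simp: convergent_def ps)
    have "(\<lambda>n. \<integral>a. f (\<lambda>k. X k a) \<partial>p (r n)) \<longlonglongrightarrow> L"
      using LIMSEQ_subseq_LIMSEQ[OF L r(1)] by (simp add: comp_def)
    then have "L = (\<integral>c. f (\<xi> c) \<partial>N)" using sub[OF cube_poly_continuous[OF f]] LIMSEQ_unique by blast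
    then show ?thesis using L by simp
  qed
  \<comment> \<open>Uniform approximation by polynomials on the cube transfers the convergence of
    the full sequence to every continuous \<open>f\<close>.\<close>
  have "(\<lambda>n. \<integral>a. f (\<lambda>k. X k a) \<partial>p n) \<longlonglongrightarrow> (\<integral>c. f (\<xi> c) \<partial>N)"
    if f: "continuous_on cube f" for f :: "_ \<Rightarrow> real"
  proof (rule LIMSEQ_I)
    fix e :: real assume e: "e > 0"
    obtain g where g: "cube_poly g" "\<And>x. x \<in> cube \<Longrightarrow> \<bar>f x - g x\<bar> < e / 3"
      using cube_poly_dense[OF f, of "e / 3"] e by auto
    have gc: "continuous_on cube g" by (rule cube_poly_continuous[OF g(1)])
    obtain n0 where n0: "\<And>n. n \<ge> n0 \<Longrightarrow>
        norm ((\<integral>a. g (\<lambda>k. X k a) \<partial>p n) - (\<integral>c. g (\<xi> c) \<partial>N)) < e / 3"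
      using LIMSEQ_D[OF conv[OF g(1)], of "e / 3"] e by auto
    show "\<exists>n0. \<forall>n\<ge>n0. norm ((\<integral>a. f (\<lambda>k. X k a) \<partial>p n) - (\<integral>c. f (\<xi> c) \<partial>N)) < e"
    proof (intro exI allI impI)
      fix n assume n: "n \<ge> n0"
      have "\<bar>(\<integral>a. f (\<lambda>k. X k a) \<partial>p n) - (\<integral>a. g (\<lambda>k. X k a) \<partial>p n)\<bar> \<le> e / 3"
        by (rule integral_diff_le) (use intp f gc g(2) X_cube measure_pmf.prob_space_axioms in auto)
      moreover have "\<bar>(\<integral>c. f (\<xi> c) \<partial>N) - (\<integral>c. g (\<xi> c) \<partial>N)\<bar> \<le> e / 3"
        by (rule integral_diff_le) (use intN f gc g(2) \<xi>_cube N.prob_space_axioms in auto)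
      ultimately show "norm ((\<integral>a. f (\<lambda>k. X k a) \<partial>p n) - (\<integral>c. f (\<xi> c) \<partial>N)) < e"
        using n0[OF n] by (simp add: abs_if split: if_splits)
    qed
  qed
  note main = this[unfolded \<xi>_def]
  show ?thesis by (rule that[OF r(2)]) (rule main)
qed

section \<open>Non-determinism: decreasing patterns\<close>

lemma kappa_pos: "kappa > 0"
  unfolding kappa_def using rho_bounds by simp

lemma lead_nonneg: "lead q \<ge> 0"
proof (induction q rule: lead.induct)
  case (1 q)
  show ?case
  proof (cases "weight q \<le> 1")
    case True
    then show ?thesis using kappa_pos by (simp add: lead.simps[of q])
  next
    case False
    then show ?thesis using 1
      by (subst lead.simps) (auto intro!: divide_nonneg_nonneg add_nonneg_nonneg sum_nonneg mult_nonneg_nonneg)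
  qed
qed

lemma lead_neg: "lead (neg q) = lead q"
  by (subst (1 2) lead.simps) (simp add: add.commute)

lemma lead_ge_split:
  assumes "p \<in> proper_splits q"
  shows "lead q \<ge> lead (map fst p) * lead (map snd p) / 2"
proof -
  have w: "weight q > 1" using weight_splits[of p q] assms by (auto simp: proper_splits_def)
  have "lead (map fst p) * lead (map snd p) \<le> (\<Sum>p\<in>proper_splits q. lead (map fst p) * lead (map snd p))"
    using assms by (intro member_le_sum) (auto intro: mult_nonneg_nonneg lead_nonneg)
  moreover have "0 \<le> (\<Sum>p\<in>proper_splits (neg q). lead (map fst p) * lead (map snd p))"
    by (intro sum_nonneg mult_nonneg_nonneg lead_nonneg)
  moreover have "lead q = ((\<Sum>p\<in>proper_splits q. lead (map fst p) * lead (map snd p)) +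
      (\<Sum>p\<in>proper_splits (neg q). lead (map fst p) * lead (map snd p))) / 2"
    using w by (subst lead.simps) simp
  ultimately show ?thesis by simp
qed

lemma lead_pos_of_sum_dec:
  assumes dec: "sum_dec \<pi>" and av: "avoiding \<pi>" "distinct \<pi>"
    and IH: "\<And>\<rho> :: int list. length \<rho> < length \<pi> \<Longrightarrow> distinct \<rho> \<Longrightarrow> avoiding \<rho> \<Longrightarrow> \<rho> \<noteq> [] \<Longrightarrow> lead [\<rho>] > 0"
  shows "lead [\<pi> :: int list] > 0"
proof -
  obtain us vs where uv: "us \<noteq> []" "vs \<noteq> []" "\<pi> = us @ vs" "us \<lless> vs" using dec by (auto simp: sum_dec_def)
  have "[(us, vs)] \<in> proper_splits [\<pi>]"
    using uv by (auto simp: proper_splits_def splits_Cons splits1_def weight_def)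
  then have "lead [us] * lead [vs] / 2 \<le> lead [\<pi>]" using lead_ge_split by fastforce
  moreover have "avoiding us" "avoiding vs" using av uv avoiding_append by auto
  then have "lead [us] > 0" "lead [vs] > 0" using IH[of us] IH[of vs] uv av by auto
  ultimately show ?thesis using mult_pos_pos[of "lead [us]" "lead [vs]"] by linarith
qed

text \<open>All terms of the recursion are nonnegative, so one positive term suffices. A pattern of
  size at least 2 that avoids 2413 and 3142, or else its negation, is sum-decomposable and supplies
  a proper split.\<close>

lemma lead_pos:
  fixes \<pi> :: "int list"
  shows "distinct \<pi> \<Longrightarrow> avoiding \<pi> \<Longrightarrow> \<pi> \<noteq> [] \<Longrightarrow> lead [\<pi>] > 0"
proof (induction "length \<pi>" arbitrary: \<pi> rule: less_induct)
  case less
  show ?case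
  proof (cases "length \<pi> \<le> 1")
    case True
    then show ?thesis using kappa_pos by (simp add: lead.simps[of "[\<pi>]"] weight_def)
  next
    case False
    then consider "sum_dec \<pi>" | "skew_dec \<pi>" using avoiding_decomposable_int[of \<pi>] less.prems by fastforce
    then show ?thesis
    proof cases
      case 1
      then show ?thesis using lead_pos_of_sum_dec[of \<pi>] less by blast
    next
      case 2
      have "sum_dec (map uminus \<pi>)" using 2 sum_dec_antimono[of \<pi> uminus] by simp
      moreover have "avoiding (map uminus \<pi>)" using less.prems avoiding_antimono[of \<pi> uminus] by simp
      moreover have "distinct (map uminus \<pi>)" using less.prems by (simp add: distinct_map)
      ultimately have "lead [map uminus \<pi>] > 0"
        using lead_pos_of_sum_dec[of "map uminus \<pi>"] less.hyps by simp
      then show ?thesis using lead_neg[of "[\<pi>]"] by (simp add: neg_def)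
    qed
  qed
qed

text \<open>Instead of matching the splits of both sides, \<open>lead\<close> is recovered as a
  limit of coefficient quotients of \<open>sep_gf\<close>, and that series sees patterns only up to
  order isomorphism.\<close>

lemma lead_cong:
  assumes "list_all2 order_iso q q'"
  shows "lead q = lead q'"
proof -
  have w: "weight q = weight q'" unfolding weight_def
    using assms by (induction rule: list_all2_induct) (auto simp: order_iso_length)
  show ?thesis
  proof (cases "weight q = 0")
    case True
    then show ?thesis using w by (simp add: lead.simps[of q] lead.simps[of q'])
  next
    case False
    have "occ_prod q = (occ_prod q' :: nat list \<Rightarrow> real)"
    proof
      fix \<sigma> :: "nat list"
      show "occ_prod q \<sigma> = occ_prod q' \<sigma>"
        using assms
      proof (induction rule: list_all2_induct)
        case (Cons x xs y ys)
        have "occs x \<sigma> = occs y \<sigma>" by (rule occs_cong_left[OF Cons.hyps(1)])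
        then show ?case using Cons.IH by (simp add: occ_prod_def)
      qed simp
    qed
    then have "sep_gf q = sep_gf q'" unfolding sep_gf_def by (simp only:)
    moreover have "(\<lambda>n. sep_gf q'' $ n / inv_root ^ (2 * weight q'' - 1) $ n) \<longlonglongrightarrow> lead q''"
      if "weight q'' > 0" for q''
      using quad_repr_gf[OF that] that by (intro quad_repr_tendsto) auto
    ultimately show ?thesis using False w by (metis LIMSEQ_unique neq0_conv)
  qed
qed

text \<open>The value 0 at weight 0 makes one-sided splits vanish, so the recursion may run over all
  splits and becomes a convolution.\<close>

definition lead0 :: "int list list \<Rightarrow> real" where
  "lead0 q = (if weight q = 0 then 0 else lead q)"

lemma lead0_rec:
  assumes "weight q \<ge> 2"
  shows "2 * lead0 q = (\<Sum>p\<in>splits q. lead0 (map fst p) * lead0 (map snd p)) +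
      (\<Sum>p\<in>splits (neg q). lead0 (map fst p) * lead0 (map snd p))"
proof -
  have "(\<Sum>p\<in>splits q'. lead0 (map fst p) * lead0 (map snd p))
      = (\<Sum>p\<in>proper_splits q'. lead (map fst p) * lead (map snd p))" for q'
    by (rule sum.mono_neutral_cong_right) (auto simp: proper_splits_def lead0_def)
  then show ?thesis using assms by (simp add: lead0_def lead.simps[of q])
qed

section \<open>Leading constants of pairs of monotone patterns\<close>

definition inc_list :: "nat \<Rightarrow> int list" where "inc_list n = map int [0..<n]"
definition dec_list :: "nat \<Rightarrow> int list" where "dec_list n = map (\<lambda>i. - int i) [0..<n]"

definition lead_dec_inc :: "nat \<Rightarrow> nat \<Rightarrow> real" where
  "lead_dec_inc i j = lead0 [dec_list i, inc_list j]"

lemma order_iso_sorted: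
  fixes x y :: "int list"
  assumes "length x = length y" "sorted_wrt (<) x" "sorted_wrt (<) y"
  shows "order_iso x y"
proof -
  have "z ! i < z ! j \<longleftrightarrow> i < j" if "sorted_wrt (<) z" "i < length z" "j < length z" for z :: "int list" and i j
    using that sorted_wrt_nth_less[OF that(1), of i j] sorted_wrt_nth_less[OF that(1), of j i]
    by (metis linorder_neqE_nat order.asym order.irrefl)
  then show ?thesis using assms by (auto simp: order_iso_def)
qed

lemma order_iso_sorted_dec:
  fixes x y :: "int list"
  assumes "length x = length y" "sorted_wrt (>) x" "sorted_wrt (>) y"
  shows "order_iso x y"
proof -
  have "z ! i < z ! j \<longleftrightarrow> j < i" if "sorted_wrt (>) z" "i < length z" "j < length z" for z :: "int list" and i j
    using that sorted_wrt_nth_less[OF that(1), of i j] sorted_wrt_nth_less[OF that(1), of j i]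
    by (metis linorder_neqE_nat order.asym order.irrefl)
  then show ?thesis using assms by (auto simp: order_iso_def)
qed

lemma sorted_inc: "sorted_wrt (<) (inc_list n)" and sorted_dec: "sorted_wrt (>) (dec_list n)"
  by (simp_all add: inc_list_def dec_list_def sorted_wrt_map sorted_wrt_iff_nth_less)

lemma length_inc [simp]: "length (inc_list n) = n" and length_dec [simp]: "length (dec_list n) = n"
  by (simp_all add: inc_list_def dec_list_def)

lemma lead0_eq:
  assumes "sorted_wrt (>) x" "sorted_wrt (<) y"
  shows "lead0 [x, y] = lead_dec_inc (length x) (length y)"
proof -
  have "list_all2 order_iso [x, y] [dec_list (length x), inc_list (length y)]"
    using assms order_iso_sorted[OF _ assms(2) sorted_inc] order_iso_sorted_dec[OF _ assms(1) sorted_dec] by simp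
  then show ?thesis using lead_cong by (simp add: lead_dec_inc_def lead0_def weight_def)
qed

lemma lead0_neg: "lead0 (neg q) = lead0 q"
  by (simp add: lead0_def lead_neg)

lemma lead0_eq':
  assumes "sorted_wrt (<) x" "sorted_wrt (>) y"
  shows "lead0 [x, y] = lead_dec_inc (length x) (length y)"
  using lead0_eq[of "map uminus x" "map uminus y"] lead0_neg[of "[x, y]"] assms
  by (simp add: neg_def sorted_wrt_map)

lemma splits1_sorted:
  assumes "sorted_wrt (<) y"
  shows "splits1 y = (\<lambda>i. (take i y, drop i y)) ` {..length y}"
proof (intro equalityI splits1_subset subsetI)
  fix p assume "p \<in> (\<lambda>i. (take i y, drop i y)) ` {..length y}"
  then obtain i where "p = (take i y, drop i y)" by blast
  moreover have "sorted_wrt (<) (take i y @ drop i y)" using assms by simp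
  then have "take i y \<lless> drop i y" unfolding sorted_wrt_append by (auto simp: list_below_def)
  ultimately show "p \<in> splits1 y" by (simp add: splits1_def)
qed

lemma splits1_sorted_dec:
  assumes "sorted_wrt (>) x"
  shows "splits1 x = {([], x), (x, [])}"
proof (rule splits1_trivial)
  fix i assume i: "0 < i" "i < length x"
  have "x ! i < x ! 0" using sorted_wrt_nth_less[OF assms, of 0 i] i by simp
  moreover have "x ! 0 \<in> set (take i x)" using i by (auto simp: in_set_conv_nth intro!: exI[of _ 0])
  moreover have "x ! i \<in> set (drop i x)" using i by (auto simp: in_set_conv_nth intro!: exI[of _ 0])
  ultimately show "\<not> take i x \<lless> drop i x" by (meson list_below_def order.asym)
qed

lemma sum_splits1_sorted:
  assumes "sorted_wrt (<) y"
  shows "(\<Sum>v\<in>splits1 y. f v) = (\<Sum>i\<le>length y. f (take i y, drop i y))"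
proof -
  have "inj_on (\<lambda>i. (take i y, drop i y)) {..length y}"
    by (rule inj_onI) (metis Pair_inject atMost_iff length_take min.absorb2)
  then show ?thesis by (simp add: splits1_sorted[OF assms] sum.reindex)
qed

lemma sum_splits1_sorted_dec:
  assumes "sorted_wrt (>) x"
  shows "(\<Sum>u\<in>splits1 x. f u) = f ([], x) + (if x = [] then 0 else f (x, []))"
  by (simp add: splits1_sorted_dec[OF assms])

lemma sorted_take_drop:
  assumes "sorted_wrt R x"
  shows "sorted_wrt R (take i x)" "sorted_wrt R (drop i x)"
  using assms sorted_wrt_append[of R "take i x" "drop i x"] by simp_all

text \<open>An increasing list can be cut anywhere, a decreasing one only trivially, and negation
  exchanges the roles. The case distinctions reflect that the two trivial splits of an empty list
  coincide.\<close>

lemma lead_dec_inc_rec: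
  assumes "i + j \<ge> 2"
  shows "2 * lead_dec_inc i j =
    (\<Sum>b\<le>j. lead_dec_inc 0 b * lead_dec_inc i (j - b)) +
    (if i = 0 then 0 else \<Sum>b\<le>j. lead_dec_inc i b * lead_dec_inc 0 (j - b)) +
    (\<Sum>a\<le>i. lead_dec_inc a 0 * lead_dec_inc (i - a) j) +
    (if j = 0 then 0 else \<Sum>a\<le>i. lead_dec_inc a j * lead_dec_inc (i - a) 0)"
proof -
  define x where "x = dec_list i"
  define y where "y = inc_list j"
  define x' where "x' = map uminus x"
  define y' where "y' = map uminus y"
  note F = lead_dec_inc_def
  have s: "sorted_wrt (>) x" "sorted_wrt (<) y" "sorted_wrt (<) x'" "sorted_wrt (>) y'"
    and l: "length x = i" "length y = j" "length x' = i" "length y' = j"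
    using sorted_inc sorted_dec by (simp_all add: x_def y_def x'_def y'_def sorted_wrt_map)
  have e: "x = [] \<longleftrightarrow> i = 0" "y' = [] \<longleftrightarrow> j = 0" using l by auto
  have n: "neg [x, y] = [x', y']" by (simp add: neg_def x'_def y'_def)
  have "2 * lead_dec_inc i j = 2 * lead0 [x, y]" by (simp add: F x_def y_def)
  also have "\<dots> = (\<Sum>p\<in>splits [x, y]. lead0 (map fst p) * lead0 (map snd p)) +
      (\<Sum>p\<in>splits [x', y']. lead0 (map fst p) * lead0 (map snd p))"
    unfolding n[symmetric] by (rule lead0_rec) (use assms l in \<open>simp add: weight_def\<close>)
  also have "(\<Sum>p\<in>splits [x, y]. lead0 (map fst p) * lead0 (map snd p)) =
      (\<Sum>b\<le>j. lead0 [[], take b y] * lead0 [x, drop b y]) +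
      (if i = 0 then 0 else \<Sum>b\<le>j. lead0 [x, take b y] * lead0 [[], drop b y])"
    by (simp add: sum_splits_Cons sum_splits1_sorted_dec s sum_splits1_sorted l e)
  also have "(\<Sum>b\<le>j. lead0 [[], take b y] * lead0 [x, drop b y])
      = (\<Sum>b\<le>j. lead_dec_inc 0 b * lead_dec_inc i (j - b))"
    using s l by (intro sum.cong refl) (simp add: lead0_eq sorted_take_drop)
  also have "(\<Sum>b\<le>j. lead0 [x, take b y] * lead0 [[], drop b y])
      = (\<Sum>b\<le>j. lead_dec_inc i b * lead_dec_inc 0 (j - b))"
    using s l by (intro sum.cong refl) (simp add: lead0_eq sorted_take_drop)
  also have "(\<Sum>p\<in>splits [x', y']. lead0 (map fst p) * lead0 (map snd p)) =
      (\<Sum>a\<le>i. lead0 [take a x', []] * lead0 [drop a x', y'] +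
        (if j = 0 then 0 else lead0 [take a x', y'] * lead0 [drop a x', []]))"
    by (cases "j = 0") (simp_all add: sum_splits_Cons sum_splits1_sorted_dec s sum_splits1_sorted l e)
  also have "\<dots> = (\<Sum>a\<le>i. lead_dec_inc a 0 * lead_dec_inc (i - a) j +
        (if j = 0 then 0 else lead_dec_inc a j * lead_dec_inc (i - a) 0))"
    using s l by (intro sum.cong refl) (simp add: lead0_eq' sorted_take_drop)
  finally show ?thesis by (simp add: sum.distrib)
qed

lemma lead_dec_inc_small:
  "lead_dec_inc 0 0 = 0" "lead_dec_inc (Suc 0) 0 = kappa" "lead_dec_inc 0 (Suc 0) = kappa"
  "lead_dec_inc 0 2 = kappa\<^sup>2 / 2"
proof -
  show 1: "lead_dec_inc 0 0 = 0" "lead_dec_inc (Suc 0) 0 = kappa" "lead_dec_inc 0 (Suc 0) = kappa"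
    by (simp_all add: lead_dec_inc_def lead0_def weight_def lead.simps)
  show "lead_dec_inc 0 2 = kappa\<^sup>2 / 2"
    using lead_dec_inc_rec[of 0 2] 1 by (simp add: numeral_2_eq_2 power2_eq_square)
qed

lemma lead_dec_inc_nonneg: "lead_dec_inc i j \<ge> 0"
  by (simp add: lead_dec_inc_def lead0_def lead_nonneg)

definition dec_gf :: "nat \<Rightarrow> real fps" where
  "dec_gf j = Abs_fps (\<lambda>i. lead_dec_inc i j)"

lemma dec_gf_nth [simp]: "dec_gf j $ i = lead_dec_inc i j"
  by (simp add: dec_gf_def)

lemma dec_gf_mult_nth: "(dec_gf j * dec_gf k) $ i = (\<Sum>a\<le>i. lead_dec_inc a j * lead_dec_inc (i - a) k)"
  by (simp add: fps_mult_nth atLeast0AtMost)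

text \<open>A Catalan-type equation: \<open>1 - dec_gf 0\<close> is a square root of
  \<open>1 - 2 \<kappa> X\<close>.\<close>

lemma dec_gf_0: "2 * dec_gf 0 = dec_gf 0 * dec_gf 0 + fps_const (2 * kappa) * fps_X"
proof (rule fps_ext)
  fix i
  consider "i = 0" | "i = Suc 0" | "i \<ge> 2" by linarith
  then show "(2 * dec_gf 0) $ i = (dec_gf 0 * dec_gf 0 + fps_const (2 * kappa) * fps_X) $ i"
  proof cases
    case 3
    then show ?thesis using lead_dec_inc_rec[of i 0] lead_dec_inc_small
      by (simp add: numeral_fps_const dec_gf_mult_nth)
  qed (simp_all add: numeral_fps_const dec_gf_mult_nth lead_dec_inc_small)
qed

lemma sum_atMost_flip: "(\<Sum>a\<le>i. f a * g (i - a)) = (\<Sum>a\<le>i. g a * f (i - a))" for f g :: "nat \<Rightarrow> real"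
  by (rule sum.reindex_bij_witness[of _ "\<lambda>a. i - a" "\<lambda>a. i - a"]) (auto simp: mult.commute)

lemma dec_gf_1: "dec_gf 1 = fps_const kappa * (1 + dec_gf 0) + dec_gf 0 * dec_gf 1"
proof (rule fps_ext)
  fix i
  show "dec_gf 1 $ i = (fps_const kappa * (1 + dec_gf 0) + dec_gf 0 * dec_gf 1) $ i"
  proof (cases "i = 0")
    case True
    then show ?thesis by (simp add: dec_gf_mult_nth[where j = 0] lead_dec_inc_small)
  next
    case False
    then have "2 * lead_dec_inc i 1 = 2 * (kappa * lead_dec_inc i 0) +
       2 * (\<Sum>a\<le>i. lead_dec_inc a 0 * lead_dec_inc (i - a) 1)"
      using lead_dec_inc_rec[of i 1] lead_dec_inc_small
        sum_atMost_flip[of "\<lambda>a. lead_dec_inc a 1" "\<lambda>a. lead_dec_inc a 0" i] by (simp add: mult.commute)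
    then show ?thesis using False by (simp add: dec_gf_mult_nth)
  qed
qed

text \<open>The two sums pairing the unknown with \<open>lead_dec_inc a 0\<close> are equal, which
  leaves a linear equation. The subtracted constant affects only index 0, where the empty decreasing
  list has one trivial split instead of two.\<close>

lemma dec_gf_2:
  "dec_gf 2 = fps_const kappa * dec_gf 1 + fps_const (kappa\<^sup>2 / 2) * dec_gf 0 - fps_const (kappa\<^sup>2 / 2)
    + dec_gf 0 * dec_gf 2"
proof (rule fps_ext)
  fix i
  show "dec_gf 2 $ i = (fps_const kappa * dec_gf 1 + fps_const (kappa\<^sup>2 / 2) * dec_gf 0 - fps_const (kappa\<^sup>2 / 2)
    + dec_gf 0 * dec_gf 2) $ i"
  proof (cases "i = 0")
    case True
    then show ?thesis by (simp add: dec_gf_mult_nth[where j = 0] lead_dec_inc_small power2_eq_square)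
  next
    case False
    have sum3: "(\<Sum>b\<le>2. f b) = f 0 + f 1 + f 2" for f :: "nat \<Rightarrow> real" by (simp add: numeral_2_eq_2)
    have "2 * lead_dec_inc i 2 = 2 * (kappa * lead_dec_inc i 1) + 2 * (kappa\<^sup>2 / 2 * lead_dec_inc i 0) +
       2 * (\<Sum>a\<le>i. lead_dec_inc a 0 * lead_dec_inc (i - a) 2)"
      using lead_dec_inc_rec[of i 2] lead_dec_inc_small False
        sum_atMost_flip[of "\<lambda>a. lead_dec_inc a 2" "\<lambda>a. lead_dec_inc a 0" i] by (simp add: sum3 mult.commute)
    then show ?thesis using False by (simp add: dec_gf_mult_nth)
  qed
qed

lemma one_minus_dec_gf_square: "(1 - dec_gf 0)\<^sup>2 = 1 - fps_const (2 * kappa) * fps_X"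
  using dec_gf_0 by (simp add: power2_eq_square algebra_simps)

text \<open>Differentiating the equation for \<open>E = 1 - dec_gf 0\<close> gives a first-order
  linear differential equation, hence a two-term recurrence. Index 0 is exceptional because of the
  constant coefficient of \<open>E\<close>.\<close>

lemma dec_gf_0_rec: "(real i + 1) * lead_dec_inc (Suc i) 0 = kappa * (2 * real i - 1) * lead_dec_inc i 0 \<or> i = 0"
proof -
  define E where "E = 1 - dec_gf 0"
  have "fps_deriv (E\<^sup>2) = - fps_const (2 * kappa)"
    unfolding E_def one_minus_dec_gf_square by simp
  then have "E * fps_deriv E + E * fps_deriv E = - fps_const (2 * kappa)" by (simp add: power2_eq_square)
  then have "2 * (E * fps_deriv E) = 2 * (- fps_const kappa)"
    by (simp add: numeral_fps_const flip: fps_const_neg)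
  then have "E * fps_deriv E = - fps_const kappa" by (subst (asm) mult_cancel_left) simp
  then have "E\<^sup>2 * fps_deriv E = - fps_const kappa * E" by (simp add: power2_eq_square mult.assoc mult.commute)
  then have "fps_deriv E - fps_const (2 * kappa) * (fps_X * fps_deriv E) = - (fps_const kappa * E)"
    unfolding E_def one_minus_dec_gf_square by (simp add: algebra_simps flip: fps_const_neg)
  from arg_cong[where f = "\<lambda>G. G $ i", OF this]
  show ?thesis by (cases i) (simp_all add: E_def algebra_simps)
qed

text \<open>The rescaled coefficients \<open>p n\<close> change by the factor
  \<open>(2n - 1) / (2n)\<close>. As \<open>(2n - 1)^2 * n >= 4 * n^2 * (n - 1)\<close>, the
  quantity \<open>p n^2 * (n - 1)\<close> never decreases, and at \<open>n = 2\<close> it equals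
  \<open>1 / 16\<close>.\<close>

lemma dec_gf_0_lower:
  assumes "n \<ge> 2"
  shows "lead_dec_inc n 0 > 0" and "(real n * (lead_dec_inc n 0 / (2 * kappa) ^ n))\<^sup>2 * (real n - 1) \<ge> 1 / 16"
proof -
  define p where "p n = real n * (lead_dec_inc n 0 / (2 * kappa) ^ n)" for n
  have rec: "p (Suc n) = p n * (2 * real n - 1) / (2 * real n)" if "n \<ge> 1" for n
  proof -
    have "(real n + 1) * lead_dec_inc (Suc n) 0 = kappa * (2 * real n - 1) * lead_dec_inc n 0"
      using dec_gf_0_rec[of n] that by auto
    then have "p (Suc n) = kappa * (2 * real n - 1) * lead_dec_inc n 0 / (2 * kappa) ^ Suc n"
      by (simp add: p_def add.commute)
    also have "\<dots> = p n * (2 * real n - 1) / (2 * real n)"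
      using kappa_pos that by (simp add: p_def field_simps)
    finally show ?thesis .
  qed
  have p1: "p 1 = 1 / 2" using kappa_pos by (simp add: p_def lead_dec_inc_small)
  have *: "p n > 0 \<and> (p n)\<^sup>2 * (real n - 1) \<ge> 1 / 16"
    using assms
  proof (induction n rule: nat_induct_at_least)
    case base
    have "p 2 = 1 / 4" using rec[of 1] p1 by (simp add: numeral_2_eq_2)
    show ?case unfolding \<open>p 2 = 1 / 4\<close> by (simp add: power2_eq_square)
  next
    case (Suc n)
    have "(p n)\<^sup>2 * (real n - 1) \<le> (p n)\<^sup>2 * (((2 * real n - 1) / (2 * real n))\<^sup>2 * real n)"
    proof (rule mult_left_mono)
      have "4 * (real n)\<^sup>2 * (real n - 1) \<le> (2 * real n - 1)\<^sup>2 * real n"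
        by (simp add: power2_eq_square algebra_simps)
      then show "real n - 1 \<le> ((2 * real n - 1) / (2 * real n))\<^sup>2 * real n"
        using Suc.hyps by (simp add: power_divide power_mult_distrib pos_le_divide_eq mult.commute)
    qed simp
    also have "\<dots> = (p (Suc n))\<^sup>2 * (real (Suc n) - 1)"
      using rec[of n] Suc.hyps by (simp add: power_divide power_mult_distrib)
    finally show ?case using Suc rec[of n] by simp
  qed
  then show "(real n * (lead_dec_inc n 0 / (2 * kappa) ^ n))\<^sup>2 * (real n - 1) \<ge> 1 / 16"
    by (simp add: p_def)
  have "real n * (lead_dec_inc n 0 / (2 * kappa) ^ n) > 0" using * by (simp only: p_def)
  then have "lead_dec_inc n 0 / (2 * kappa) ^ n > 0" by (rule zero_less_mult_pos) (use assms in simp)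
  then show "lead_dec_inc n 0 > 0" using kappa_pos zero_less_power[of "2 * kappa" n]
    by (metis zero_less_divide_iff order.asym zero_less_mult_iff zero_less_numeral)
qed

text \<open>With \<open>E = 1 - dec_gf 0\<close> one has \<open>E\<^sup>2 = 1 - 2 \<kappa> X\<close> and \<open>dec_gf 2 = \<kappa>\<^sup>2 (2 / E\<^sup>2 - 1 / E - 1 / 2)\<close>, where
  \<open>1 / E\<close> has nonnegative coefficients.\<close>

lemma dec_gf_2_upper: "lead_dec_inc n 2 \<le> 2 * kappa\<^sup>2 * (2 * kappa) ^ n"
proof -
  define E where "E = 1 - dec_gf 0"
  define V where "V = inverse E"
  define G where "G = Abs_fps (\<lambda>n. (2 * kappa) ^ n)"
  define k where "k = fps_const kappa"
  have E0: "E $ 0 = 1" by (simp add: E_def lead_dec_inc_small)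
  have VE: "V * E = 1" unfolding V_def by (rule inverse_mult_eq_1) (simp add: E0)
  have G: "G * E\<^sup>2 = 1"
  proof -
    have "G * (1 - fps_const (2 * kappa) * fps_X) = 1"
    proof (rule fps_ext)
      fix n
      have "G * (1 - fps_const (2 * kappa) * fps_X) = G - fps_const (2 * kappa) * (fps_X * G)"
        by (simp add: algebra_simps)
      then show "(G * (1 - fps_const (2 * kappa) * fps_X)) $ n = 1 $ n"
        by (cases n) (simp_all add: G_def)
    qed
    then show ?thesis unfolding E_def one_minus_dec_gf_square .
  qed
  have c2: "fps_const (kappa\<^sup>2 / 2) = fps_const (1 / 2) * (k * k)"
    by (simp add: k_def power2_eq_square)
  have half: "fps_const (1 / 2) + fps_const (1 / 2) = (1 :: real fps)" by simp
  have 1: "dec_gf 1 * E = k * (2 - E)"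
    using dec_gf_1 by (simp add: E_def k_def algebra_simps)
  have 2: "dec_gf 2 * E = k * dec_gf 1 - fps_const (1 / 2) * (k * k) * E"
    using dec_gf_2 unfolding c2 by (simp add: E_def k_def algebra_simps)
  have "dec_gf 2 * E\<^sup>2 = (dec_gf 2 * E) * E" by (simp add: power2_eq_square mult.assoc)
  also have "\<dots> = k * (dec_gf 1 * E) - fps_const (1 / 2) * (k * k) * E\<^sup>2"
    unfolding 2 by (simp add: algebra_simps power2_eq_square)
  also have "\<dots> = k * k * (2 - E - fps_const (1 / 2) * E\<^sup>2)"
    unfolding 1 by (simp add: algebra_simps)
  finally have D: "dec_gf 2 * E\<^sup>2 = k * k * (2 - E - fps_const (1 / 2) * E\<^sup>2)" .
  have "dec_gf 2 = (dec_gf 2 * E\<^sup>2) * (V * V)"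
  proof -
    have "(dec_gf 2 * E\<^sup>2) * (V * V) = dec_gf 2 * ((V * E) * (V * E))"
      by (simp add: power2_eq_square mult_ac)
    then show ?thesis by (simp add: VE)
  qed
  also have "\<dots> = k * k * (2 * (V * V) - V * (V * E) - fps_const (1 / 2) * ((V * E) * (V * E)))"
    unfolding D by (simp add: algebra_simps power2_eq_square)
  also have "V * V = G"
  proof -
    have "V * V = (V * V) * (G * E\<^sup>2)" by (simp add: G)
    also have "\<dots> = G * ((V * E) * (V * E))" by (simp add: power2_eq_square mult_ac)
    finally show ?thesis by (simp add: VE)
  qed
  finally have eq: "dec_gf 2 = k * k * (2 * G - V - fps_const (1 / 2))" by (simp add: VE)
  \<comment> \<open>The geometric series of \<open>dec_gf 0\<close>, written as a fixed-point
    equation. As \<open>dec_gf 0\<close> has no constant coefficient and the others are nonnegative,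
    the nonnegativity of \<open>V\<close> follows by induction.\<close>
  have V: "V = 1 + dec_gf 0 * V" using VE by (simp add: E_def algebra_simps)
  have Vn: "V $ n \<ge> 0" for n
  proof (induction n rule: less_induct)
    case (less n)
    have "(dec_gf 0 * V) $ n \<ge> 0"
      unfolding fps_mult_nth
    proof (rule sum_nonneg)
      fix i assume "i \<in> {0..n}"
      then show "dec_gf 0 $ i * V $ (n - i) \<ge> 0"
        using less[of "n - i"] lead_dec_inc_small lead_dec_inc_nonneg
        by (cases "i = 0") (auto intro!: mult_nonneg_nonneg)
    qed
    then have "(1 + dec_gf 0 * V) $ n \<ge> 0" by simp
    then show ?case using V by metis
  qed
  have "lead_dec_inc n 2 = kappa * kappa * (2 * (2 * kappa) ^ n - V $ n - (if n = 0 then 1 / 2 else 0))"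
  proof -
    have "lead_dec_inc n 2 = dec_gf 2 $ n" by simp
    also have "\<dots> = (fps_const (kappa * kappa) * (fps_const 2 * G - V - fps_const (1 / 2))) $ n"
      unfolding eq k_def by (simp add: numeral_fps_const)
    finally show ?thesis by (simp add: G_def)
  qed
  also have "\<dots> \<le> kappa * kappa * (2 * (2 * kappa) ^ n)"
    using Vn[of n] kappa_pos by (intro mult_left_mono) auto
  finally show ?thesis by (simp add: power2_eq_square)
qed

section \<open>The limiting random variables\<close>

lemma occs_compose:
  assumes "I \<in> occs \<pi> \<sigma>" "B \<in> occs \<rho> \<pi>"
  shows "\<exists>J\<subseteq>I. J \<in> occs \<rho> \<sigma>"
proof -
  \<comment> \<open>The elements of \<open>I\<close> whose rank within \<open>I\<close> belongs to
    \<open>B\<close>, in the form produced by \<open>nths_nths\<close>.\<close>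
  define J where "J = {i \<in> I. \<exists>j\<in>B. card {i' \<in> I. i' < i} = j}"
  have "order_iso (nths \<pi> B) (nths (nths \<sigma> I) B)"
    using assms by (intro order_iso_nths) (simp add: occs_def)
  then have "order_iso \<rho> (nths \<sigma> J)"
    using assms order_iso_trans[of \<rho> "nths \<pi> B"] unfolding nths_nths J_def occs_def by blast
  moreover have "J \<subseteq> I" by (auto simp: J_def)
  ultimately show ?thesis using assms by (auto simp: occs_def)
qed

text \<open>Choosing inside each occurrence \<open>I\<close> of \<pi> an occurrence
  \<open>J I\<close> of \<rho> makes \<open>I \<mapsto> (J I, I - J I)\<close> injective.\<close>

lemma card_occs_le:
  assumes "occs \<rho> \<pi> \<noteq> {}"
  shows "card (occs \<pi> \<sigma>) \<le> card (occs \<rho> \<sigma>) * (length \<sigma> choose (length \<pi> - length \<rho>))"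
proof -
  obtain B where B: "B \<in> occs \<rho> \<pi>" using assms by blast
  have "\<forall>I\<in>occs \<pi> \<sigma>. \<exists>J. J \<subseteq> I \<and> J \<in> occs \<rho> \<sigma>" using occs_compose[OF _ B] by blast
  from bchoice[OF this] obtain J where J: "\<And>I. I \<in> occs \<pi> \<sigma> \<Longrightarrow> J I \<subseteq> I \<and> J I \<in> occs \<rho> \<sigma>"
    by blast
  define K where "K = {K. K \<subseteq> {..<length \<sigma>} \<and> card K = length \<pi> - length \<rho>}"
  have "card (occs \<pi> \<sigma>) \<le> card (occs \<rho> \<sigma> \<times> K)"
  proof (rule card_inj_on_le[where f = "\<lambda>I. (J I, I - J I)"])
    show "inj_on (\<lambda>I. (J I, I - J I)) (occs \<pi> \<sigma>)"
    proof (rule inj_onI)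
      fix I I' assume "I \<in> occs \<pi> \<sigma>" "I' \<in> occs \<pi> \<sigma>" "(J I, I - J I) = (J I', I' - J I')"
      then show "I = I'" using J[of I] J[of I'] by blast
    qed
    show "(\<lambda>I. (J I, I - J I)) ` occs \<pi> \<sigma> \<subseteq> occs \<rho> \<sigma> \<times> K"
    proof
      fix z assume "z \<in> (\<lambda>I. (J I, I - J I)) ` occs \<pi> \<sigma>"
      then obtain I where I: "I \<in> occs \<pi> \<sigma>" "z = (J I, I - J I)" by blast
      have "I \<subseteq> {..<length \<sigma>}" using I by (simp add: occs_def)
      moreover have "card (I - J I) = length \<pi> - length \<rho>"
        using J[OF I(1)] occs_card[OF I(1)] occs_card[of "J I" \<rho> \<sigma>]
          finite_subset[OF \<open>I \<subseteq> {..<length \<sigma>}\<close>] finite_subset[of "J I" I]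
        by (simp add: card_Diff_subset)
      ultimately show "z \<in> occs \<rho> \<sigma> \<times> K" using I J[OF I(1)] by (auto simp: K_def)
    qed
    show "finite (occs \<rho> \<sigma> \<times> K)"
      unfolding K_def by (intro finite_cartesian_product finite_occs) (auto intro: finite_subset[of _ "Pow {..<length \<sigma>}"])
  qed
  also have "\<dots> = card (occs \<rho> \<sigma>) * (length \<sigma> choose (length \<pi> - length \<rho>))"
    unfolding K_def by (simp add: card_cartesian_product n_subsets)
  finally show ?thesis .
qed

lemma occs_map_int: "occs (map int \<pi>) \<sigma> = occs \<pi> \<sigma>"
  by (rule occs_cong_left) (auto simp: order_iso_def)

lemma occ_nonneg: "occ \<pi> \<sigma> \<ge> 0"
  by (simp add: occ_def)

lemma occ_le_1: "occ \<pi> \<sigma> \<le> 1"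
proof (cases "length \<pi> \<le> length \<sigma>")
  case True
  have "card {I. I \<subseteq> {..<length \<sigma>} \<and> card I = length \<pi> \<and> pat I \<sigma> = \<pi>}
      \<le> card {I. I \<subseteq> {..<length \<sigma>} \<and> card I = length \<pi>}"
    by (rule card_mono) (auto intro: finite_subset[of _ "Pow {..<length \<sigma>}"])
  then have "card {I. I \<subseteq> {..<length \<sigma>} \<and> card I = length \<pi> \<and> pat I \<sigma> = \<pi>} \<le> length \<sigma> choose length \<pi>"
    by (simp add: n_subsets)
  then show ?thesis using True by (simp add: occ_def)
qed (simp add: occ_def)

lemma is_perm_all_perms: "\<pi> \<in> all_perms \<Longrightarrow> is_perm \<pi>"
  by (auto simp: all_perms_def is_perm_def length_finite_permutations_of_set)

lemma occ_not_separable: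
  assumes "is_perm \<pi>" "\<not> separable \<pi>" "\<sigma> \<in> separable_perms n"
  shows "occ \<pi> \<sigma> = 0"
proof -
  have "occs \<pi> \<sigma> = {}"
  proof (rule ccontr)
    assume "occs \<pi> \<sigma> \<noteq> {}"
    then obtain I where I: "I \<in> occs \<pi> \<sigma>" by blast
    have "avoiding \<pi>"
      unfolding avoiding_def
    proof (intro conjI; rule ccontr)
      assume "occs [2, 4, 1, 3 :: int] \<pi> \<noteq> {}"
      then show False using occs_compose[OF I] assms(3) by (fastforce simp: separable_perms_iff avoiding_def)
    next
      assume "occs [3, 1, 4, 2 :: int] \<pi> \<noteq> {}"
      then show False using occs_compose[OF I] assms(3) by (fastforce simp: separable_perms_iff avoiding_def)
    qed
    then show False using assms(2) by (simp add: separable_iff_avoiding)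
  qed
  then show ?thesis
    using occ_eq_card_occs[of \<pi> "length \<pi>" \<sigma>] assms(1) by (simp add: is_perm_def occs_map_int)
qed

lemma occ_singleton:
  assumes "is_perm \<pi>" "length \<pi> = 1" "\<sigma> \<in> separable_perms n" "n \<ge> 1"
  shows "occ \<pi> \<sigma> = 1"
proof -
  have l: "length \<sigma> = n" by (rule separable_perms_length[OF assms(3)])
  have "occs \<pi> \<sigma> = {I. I \<subseteq> {..<length \<sigma>} \<and> card I = 1}"
  proof (intro equalityI subsetI)
    fix I assume "I \<in> occs \<pi> \<sigma>"
    then show "I \<in> {I. I \<subseteq> {..<length \<sigma>} \<and> card I = 1}"
      using occs_card[of I \<pi> \<sigma>] assms(2) by (simp add: occs_def)
  next
    fix I assume I: "I \<in> {I. I \<subseteq> {..<length \<sigma>} \<and> card I = 1}"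
    then have "{i. i < length \<sigma> \<and> i \<in> I} = I" by auto
    then have "length (nths \<sigma> I) = 1" using I by (simp add: length_nths)
    then show "I \<in> occs \<pi> \<sigma>" using I assms(2) by (auto simp: occs_def order_iso_def)
  qed
  then have c: "card (occs \<pi> \<sigma>) = n" by (simp only: n_subsets[OF finite_lessThan] card_lessThan l) simp
  have "occ \<pi> \<sigma> = real (card (occs \<pi> \<sigma>)) / real (n choose 1)"
    using occ_eq_card_occs[of \<pi> "length \<pi>" \<sigma>] assms(1) by (simp only: is_perm_def occs_map_int assms(2) l)
  then show ?thesis unfolding c using assms(4) by simp
qed

lemma occ_moment_mono:
  assumes "\<And>\<sigma>. \<sigma> \<in> separable_perms n \<Longrightarrow> occ \<pi> \<sigma> \<le> C * occ \<beta> \<sigma>"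
  shows "occ_moment [\<rho>, \<pi>] n \<le> C * occ_moment [\<rho>, \<beta>] n"
proof -
  have "(\<Sum>\<sigma>\<in>separable_perms n. occ \<rho> \<sigma> * occ \<pi> \<sigma>) \<le> (\<Sum>\<sigma>\<in>separable_perms n. C * (occ \<rho> \<sigma> * occ \<beta> \<sigma>))"
  proof (rule sum_mono)
    fix \<sigma> assume "\<sigma> \<in> separable_perms n"
    then have "occ \<rho> \<sigma> * occ \<pi> \<sigma> \<le> occ \<rho> \<sigma> * (C * occ \<beta> \<sigma>)"
      by (intro mult_left_mono assms occ_nonneg)
    then show "occ \<rho> \<sigma> * occ \<pi> \<sigma> \<le> C * (occ \<rho> \<sigma> * occ \<beta> \<sigma>)" by (simp add: mult_ac)
  qed
  then show ?thesis
    unfolding occ_moment_def integral_uniform_separable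
    by (simp add: sum_distrib_left[symmetric] divide_right_mono)
qed

text \<open>The constant is the limit of \<open>C n\<close>, which arises when the two counts in
  \<open>card_occs_le\<close> are normalized by their binomial coefficients.\<close>

lemma limit_moment_le:
  assumes perm: "is_perm \<rho>" "is_perm \<pi>" "is_perm \<beta>" and occ: "occs \<beta> \<pi> \<noteq> {}"
  defines "k \<equiv> length \<pi>" and "l \<equiv> length \<beta>"
  shows "limit_moment [\<rho>, \<pi>] \<le> fact k / (fact l * fact (k - l)) * limit_moment [\<rho>, \<beta>]"
proof -
  have lk: "l \<le> k" using occ occs_long[of \<pi> \<beta>] by (fastforce simp: k_def l_def)
  define C where "C n = real (n choose l) * real (n choose (k - l)) / real (n choose k)" for n
  have "(\<lambda>n. (real n ^ k / real (n choose k)) / ((real n ^ l / real (n choose l)) * (real n ^ (k - l) / real (n choose (k - l)))))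
      \<longlonglongrightarrow> fact k / (fact l * fact (k - l))"
    by (intro tendsto_divide tendsto_mult binomial_ratio_tendsto) simp
  moreover have "\<forall>\<^sub>F n in sequentially. (real n ^ k / real (n choose k)) /
      ((real n ^ l / real (n choose l)) * (real n ^ (k - l) / real (n choose (k - l)))) = C n"
    using eventually_gt_at_top[of 0]
  proof eventually_elim
    case (elim n)
    have "real n ^ k = real n ^ l * real n ^ (k - l)" using lk by (simp flip: power_add)
    then show ?case using elim by (simp add: C_def)
  qed
  ultimately have C: "C \<longlonglongrightarrow> fact k / (fact l * fact (k - l))" by (rule Lim_transform_eventually)
  have "\<forall>\<^sub>F n in sequentially. occ_moment [\<rho>, \<pi>] n \<le> C n * occ_moment [\<rho>, \<beta>] n"
    using eventually_ge_at_top[of k]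
  proof eventually_elim
    case (elim n)
    show ?case
    proof (rule occ_moment_mono)
      fix \<sigma> assume "\<sigma> \<in> separable_perms n"
      then have ls: "length \<sigma> = n" by (rule separable_perms_length)
      have "real (card (occs \<pi> \<sigma>)) \<le> real (card (occs \<beta> \<sigma>)) * real (n choose (k - l))"
        using card_occs_le[OF occ, of \<sigma>] ls unfolding k_def l_def by (metis of_nat_le_iff of_nat_mult)
      then have "real (card (occs \<pi> \<sigma>)) / real (n choose k)
          \<le> real (card (occs \<beta> \<sigma>)) * real (n choose (k - l)) / real (n choose k)"
        by (rule divide_right_mono) simp
      moreover have "real (n choose l) > 0" using lk elim by simp
      ultimately show "occ \<pi> \<sigma> \<le> C n * occ \<beta> \<sigma>"
        using occ_eq_card_occs[of \<pi> k \<sigma>] occ_eq_card_occs[of \<beta> l \<sigma>] perm ls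
        by (simp add: is_perm_def occs_map_int k_def l_def C_def mult.commute)
    qed
  qed
  moreover have "occ_moment [\<rho>, \<pi>] \<longlonglongrightarrow> limit_moment [\<rho>, \<pi>]"
    using perm by (auto intro!: occ_moment_tendsto)
  moreover have "(\<lambda>n. C n * occ_moment [\<rho>, \<beta>] n) \<longlonglongrightarrow> fact k / (fact l * fact (k - l)) * limit_moment [\<rho>, \<beta>]"
    by (rule tendsto_mult[OF C], rule occ_moment_tendsto) (use perm in auto)
  ultimately show ?thesis by (intro tendsto_le[OF sequentially_bot]) auto
qed

text \<open>Lets a single moment be read as a pair, so that \<open>limit_moment_pair\<close>
  evaluates it by \<open>lead_dec_inc\<close> with second index 0.\<close>

lemma limit_moment_Nil:
  assumes "is_perm \<rho>"
  shows "limit_moment [\<rho>, []] = limit_moment [\<rho>]"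
proof -
  have e: "is_perm []" by (simp add: is_perm_def)
  have "occ [] \<sigma> = 1" for \<sigma>
    using occ_eq_card_occs[of "[]" 0 \<sigma>] by simp
  then have "occ_moment [\<rho>, []] = occ_moment [\<rho>]" by (intro ext) (simp add: occ_moment_def)
  moreover have "occ_moment [\<rho>, []] \<longlonglongrightarrow> limit_moment [\<rho>, []]" "occ_moment [\<rho>] \<longlonglongrightarrow> limit_moment [\<rho>]"
    using assms e by (auto intro: occ_moment_tendsto)
  ultimately show ?thesis using LIMSEQ_unique by metis
qed

text \<open>Both constants grow like \<open>(2 * kappa) ^ N\<close>: the upper one has no further
  factor, the lower one loses at most order \<open>N^(3/2)\<close>. The scales contribute
  \<open>growth^2 / ((2N - 1) * (2N + 1))\<close>, so the quotient is
  \<open>O(N^(-1/2))\<close>.\<close>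

lemma lead_dec_inc_ratio:
  assumes e: "e > 0"
  obtains N where "N \<ge> 2"
    "2 * (lead_dec_inc N 2 * growth_scale (N + 2)) < e * (lead_dec_inc N 0 * growth_scale N)"
proof -
  define C where "C = 4 * kappa\<^sup>2 * growth\<^sup>2"
  have C: "C > 0" using kappa_pos growth_pos by (simp add: C_def)
  \<comment> \<open>Ensures \<open>N / 16 > C^2 / e^2\<close>. Since \<open>dec_gf_0_lower\<close>
    yields \<open>(N * N * w)^2 >= N / 16\<close>, this gives \<open>C < e * (N * N * w)\<close>
    after comparing squares.\<close>
  obtain N :: nat where N: "real N > 16 * C\<^sup>2 / e\<^sup>2 + 2" using reals_Archimedean2 by blast
  have "16 * C\<^sup>2 / e\<^sup>2 > 0" using C e by simp
  then have N2: "N \<ge> 2" using N by linarith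
  define w where "w = lead_dec_inc N 0 / (2 * kappa) ^ N"
  have w: "w > 0" "(real N * w)\<^sup>2 * (real N - 1) \<ge> 1 / 16" "lead_dec_inc N 0 = w * (2 * kappa) ^ N"
    using dec_gf_0_lower[OF N2] kappa_pos by (auto simp: w_def)
  define s where "s = (2 * real N - 1) * (2 * real N + 1)"
  have s: "s \<ge> (real N)\<^sup>2" "s > 0"
  proof -
    have "real N * real N \<ge> 1 * 1" using N2 by (intro mult_mono) auto
    then show "s \<ge> (real N)\<^sup>2" by (simp add: s_def power2_eq_square algebra_simps)
    then show "s > 0" using N2 by (smt (verit) zero_less_power2 of_nat_0_less_iff pos2 order_less_le_trans)
  qed
  have sc: "growth_scale (N + 2) = growth_scale N * growth\<^sup>2 / s"
    using N2 by (simp add: growth_scale_Suc s_def power2_eq_square algebra_simps)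
  have "C < e * (real N * (real N * w))"
  proof (rule power_less_imp_less_base)
    have "(real N)\<^sup>2 / 16 \<le> (real N)\<^sup>2 * ((real N * w)\<^sup>2 * (real N - 1))"
      using mult_left_mono[OF w(2), of "(real N)\<^sup>2"] by simp
    also have "\<dots> \<le> (real N)\<^sup>2 * ((real N * w)\<^sup>2 * real N)" by (intro mult_left_mono) auto
    also have "\<dots> = real N * (real N * (real N * w))\<^sup>2" by (simp add: power2_eq_square mult_ac)
    finally have "real N * (real N / 16) \<le> real N * (real N * (real N * w))\<^sup>2" by (simp add: power2_eq_square)
    then have "real N / 16 \<le> (real N * (real N * w))\<^sup>2" using N2 by (simp add: mult_le_cancel_left)
    moreover have "C\<^sup>2 / e\<^sup>2 < real N / 16"
    proof -
      have "16 * C\<^sup>2 / e\<^sup>2 = 16 * (C\<^sup>2 / e\<^sup>2)" by simp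
      then show ?thesis using N by linarith
    qed
    ultimately have "C\<^sup>2 / e\<^sup>2 < (real N * (real N * w))\<^sup>2" by linarith
    then show "C\<^sup>2 < (e * (real N * (real N * w)))\<^sup>2"
      using e by (simp add: power_mult_distrib pos_divide_less_eq mult.commute)
    show "0 \<le> e * (real N * (real N * w))" using e w by simp
  qed
  also have "\<dots> \<le> e * (s * w)"
    using e w s by (simp add: power2_eq_square mult.assoc[symmetric])
  finally have Cs: "C / s < e * w" using s by (simp add: pos_divide_less_eq mult_ac)
  have "2 * (lead_dec_inc N 2 * growth_scale (N + 2)) \<le> 2 * (2 * kappa\<^sup>2 * (2 * kappa) ^ N * growth_scale (N + 2))"
    using dec_gf_2_upper[of N] less_imp_le[OF growth_scale_pos] by (intro mult_left_mono mult_right_mono) auto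
  also have "\<dots> = C / s * ((2 * kappa) ^ N * growth_scale N)"
    unfolding sc C_def by simp
  also have "\<dots> < e * w * ((2 * kappa) ^ N * growth_scale N)"
    using Cs kappa_pos growth_scale_pos by (intro mult_strict_right_mono) auto
  also have "\<dots> = e * (lead_dec_inc N 0 * growth_scale N)" by (simp add: w(3))
  finally show ?thesis using that N2 by blast
qed

lemma limit_moment_pair:
  assumes "length \<rho> + length \<beta> \<ge> 1"
    and "sorted_wrt (>) \<rho> \<and> sorted_wrt (<) \<beta> \<or> sorted_wrt (<) \<rho> \<and> sorted_wrt (>) \<beta>"
  shows "limit_moment [\<rho>, \<beta>] = lead_dec_inc (length \<rho>) (length \<beta>) * growth_scale (length \<rho> + length \<beta>)
    * (fact (length \<rho>) * fact (length \<beta>))"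
proof -
  have "lead0 [map int \<rho>, map int \<beta>] = lead_dec_inc (length \<rho>) (length \<beta>)"
    using assms(2) lead0_eq[of "map int \<rho>" "map int \<beta>"] lead0_eq'[of "map int \<rho>" "map int \<beta>"]
    by (auto simp: sorted_wrt_map)
  moreover have w: "weight [map int \<rho>, map int \<beta>] = length \<rho> + length \<beta>" by (simp add: weight_def)
  ultimately have "lead [map int \<rho>, map int \<beta>] = lead_dec_inc (length \<rho>) (length \<beta>)"
    unfolding lead0_def w using assms(1) by (simp split: if_splits)
  then show ?thesis using assms(1) by (auto simp: limit_moment_def w)
qed

lemma limit_moment_pos:
  assumes "\<pi> \<in> all_perms" "separable \<pi>"
  shows "limit_moment [\<pi>] > 0"
proof -
  have p: "distinct \<pi>" "\<pi> \<noteq> []" using assms(1) by (auto simp: all_perms_def permutations_of_set_def)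
  have "order_iso (map int \<pi>) \<pi>" by (auto simp: order_iso_def)
  then have "avoiding (map int \<pi>)" using assms(2) avoiding_cong separable_iff_avoiding by blast
  then have "lead [map int \<pi>] > 0" using p by (intro lead_pos) (auto simp: distinct_map)
  then show ?thesis using p growth_scale_pos by (simp add: limit_moment_def weight_def)
qed

text \<open>The first two entries of \<pi> form an ascent or a descent \<beta>, and
  \<open>\<rho> N\<close> is monotone in the opposite direction. If all products factored,
  \<open>limit_moment [\<pi>]\<close> would be at most \<open>C\<close> times a quotient that
  becomes arbitrarily small as \<open>N\<close> grows.\<close>

lemma limit_moment_not_product:
  assumes \<pi>: "\<pi> \<in> all_perms" "separable \<pi>" "length \<pi> \<ge> 2"
  shows "\<exists>\<rho>\<in>all_perms. limit_moment [\<rho>, \<pi>] \<noteq> limit_moment [\<rho>] * limit_moment [\<pi>]"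
proof (rule ccontr)
  assume "\<not> ?thesis"
  then have eq: "limit_moment [\<rho>, \<pi>] = limit_moment [\<rho>] * limit_moment [\<pi>]" if "\<rho> \<in> all_perms" for \<rho>
    using that by blast
  obtain a b r where abr: "\<pi> = a # b # r" using \<pi>(3) by (metis Suc_le_length_iff numeral_2_eq_2)
  have "a \<noteq> b" using \<pi>(1) abr by (auto simp: all_perms_def permutations_of_set_def)
  have nab: "nths \<pi> {0, 1} = [a, b]" by (simp add: abr nths_Cons)
  define \<beta> :: "nat list" where "\<beta> = (if a < b then [1, 2] else [2, 1])"
  define \<rho> :: "nat \<Rightarrow> nat list" where "\<rho> N = (if a < b then rev [1..<Suc N] else [1..<Suc N])" for N
  have "order_iso \<beta> [a, b]" using \<open>a \<noteq> b\<close> by (auto simp: \<beta>_def order_iso_def less_Suc_eq)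
  then have "{0, 1} \<in> occs \<beta> \<pi>" using nab by (simp add: occs_def abr)
  then have occ: "occs \<beta> \<pi> \<noteq> {}" by blast
  have \<beta>: "is_perm \<beta>" "length \<beta> = 2" by (auto simp: \<beta>_def is_perm_def permutations_of_set_def)
  have \<rho>: "length (\<rho> N) = N" "is_perm (\<rho> N)" for N
    by (auto simp: \<rho>_def is_perm_def permutations_of_set_def simp del: upt_Suc)
  have \<rho>_all: "\<rho> N \<in> all_perms" if "N \<ge> 1" for N
    using \<rho>[of N] that by (auto simp: all_perms_def is_perm_def)
  have sorted: "sorted_wrt (>) (\<rho> N) \<and> sorted_wrt (<) \<beta> \<or> sorted_wrt (<) (\<rho> N) \<and> sorted_wrt (>) \<beta>"
    "sorted_wrt (>) (\<rho> N) \<and> sorted_wrt (<) ([] :: nat list) \<or> sorted_wrt (<) (\<rho> N) \<and> sorted_wrt (>) ([] :: nat list)" for N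
    by (auto simp: \<rho>_def \<beta>_def sorted_wrt_rev simp del: upt_Suc)
  define C :: real where "C = fact (length \<pi>) / (fact 2 * fact (length \<pi> - 2))"
  have C: "C > 0" by (simp add: C_def)
  have c: "limit_moment [\<pi>] > 0" by (rule limit_moment_pos[OF \<pi>(1,2)])
  obtain N where N: "N \<ge> 2"
    "2 * (lead_dec_inc N 2 * growth_scale (N + 2)) < (limit_moment [\<pi>] / C) * (lead_dec_inc N 0 * growth_scale N)"
    using lead_dec_inc_ratio[of "limit_moment [\<pi>] / C"] c C by auto
  have 1: "limit_moment [\<rho> N, \<beta>] = fact N * (2 * (lead_dec_inc N 2 * growth_scale (N + 2)))"
    using limit_moment_pair[OF _ sorted(1), of N] N \<rho> \<beta> by simp
  have 2: "limit_moment [\<rho> N] = fact N * (lead_dec_inc N 0 * growth_scale N)"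
    using limit_moment_pair[OF _ sorted(2), of N] N \<rho> limit_moment_Nil[OF \<rho>(2), of N] by simp
  have "limit_moment [\<rho> N] * limit_moment [\<pi>] = limit_moment [\<rho> N, \<pi>]" using eq \<rho>_all N by simp
  also have "\<dots> \<le> C * limit_moment [\<rho> N, \<beta>]"
    using limit_moment_le[OF \<rho>(2) is_perm_all_perms[OF \<pi>(1)] \<beta>(1) occ, of N] \<beta>(2) by (simp add: C_def)
  also have "\<dots> = C * fact N * (2 * (lead_dec_inc N 2 * growth_scale (N + 2)))" unfolding 1 by simp
  also have "\<dots> < C * fact N * ((limit_moment [\<pi>] / C) * (lead_dec_inc N 0 * growth_scale N))"
    using N(2) C by (intro mult_strict_left_mono) auto
  also have "\<dots> = limit_moment [\<rho> N] * limit_moment [\<pi>]" unfolding 2 using C by simp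
  finally show False by simp
qed

text \<open>The limit law alone fixes the two degenerate cases only almost surely; inserting the
  constants makes them hold at every point.\<close>

definition lambda_coord :: "nat list \<Rightarrow> (nat \<Rightarrow> real) \<Rightarrow> real" where
  "lambda_coord \<pi> x = (if \<not> separable \<pi> then 0 else if length \<pi> = 1 then 1 else x (to_nat \<pi>))"

lemma lambda_coord_continuous: "continuous_on A (lambda_coord \<pi>)"
proof -
  have "continuous_on A (\<lambda>x :: nat \<Rightarrow> real. x (to_nat \<pi>))"
    by (rule continuous_on_subset[OF continuous_on_product_coordinates]) simp
  then show ?thesis unfolding lambda_coord_def by (cases "separable \<pi>"; cases "length \<pi> = 1") auto
qed

text \<open>Size 0 is excluded: there the pattern of size 1 has density 0 instead of 1.\<close>

lemma lambda_coord_occ: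
  assumes "\<pi> \<in> all_perms" "\<sigma> \<in> separable_perms n" "n \<ge> 1"
  shows "lambda_coord \<pi> (\<lambda>k. occ (from_nat k) \<sigma>) = occ \<pi> \<sigma>"
  using assms occ_not_separable occ_singleton is_perm_all_perms by (auto simp: lambda_coord_def)

lemma integral_uniform_separable_cong:
  fixes f g :: "nat list \<Rightarrow> real"
  assumes "\<And>\<sigma>. \<sigma> \<in> separable_perms n \<Longrightarrow> f \<sigma> = g \<sigma>"
  shows "(\<integral>\<sigma>. f \<sigma> \<partial>uniform_separable n) = (\<integral>\<sigma>. g \<sigma> \<partial>uniform_separable n)"
  unfolding integral_uniform_separable using assms by (metis (no_types, lifting) sum.cong)

theorem theorem1p2:
  "\<exists>(M :: (nat list \<Rightarrow> real) measure) (\<Lambda> :: nat list \<Rightarrow> (nat list \<Rightarrow> real) \<Rightarrow> real).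
     prob_space M \<and>
     (\<forall>\<pi>\<in>all_perms. \<Lambda> \<pi> \<in> borel_measurable M) \<and>
     (\<forall>\<pi>\<in>all_perms. \<forall>\<omega>\<in>space M. 0 \<le> \<Lambda> \<pi> \<omega> \<and> \<Lambda> \<pi> \<omega> \<le> 1) \<and>
     (\<forall>\<pi>\<in>all_perms.
        (separable \<pi> \<and> length \<pi> \<ge> 2 \<longrightarrow> prob_space.non_deterministic M (\<Lambda> \<pi>)) \<and>
        (length \<pi> = 1 \<longrightarrow> (\<forall>\<omega>\<in>space M. \<Lambda> \<pi> \<omega> = 1)) \<and>
        (\<not> separable \<pi> \<longrightarrow> (\<forall>\<omega>\<in>space M. \<Lambda> \<pi> \<omega> = 0))) \<and>
     (\<forall>\<pi>\<in>all_perms.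
        weak_conv_m (\<lambda>n. distr (uniform_separable n) borel (occ \<pi>)) (distr M borel (\<Lambda> \<pi>))) \<and>
     (\<forall>\<pi>s. set \<pi>s \<subseteq> all_perms \<longrightarrow>
        vector_conv_in_distribution (length \<pi>s)
          (\<lambda>n. uniform_separable n) (\<lambda>n \<sigma>. \<lambda>i\<in>{..<length \<pi>s}. occ (\<pi>s ! i) \<sigma>)
          M (\<lambda>\<omega>. \<lambda>i\<in>{..<length \<pi>s}. \<Lambda> (\<pi>s ! i) \<omega>))"
proof -
  have conv: "convergent (\<lambda>n. \<integral>\<sigma>. (\<Prod>k\<leftarrow>ks. occ (from_nat k) \<sigma>) \<partial>uniform_separable n)" for ks
    using occ_moment_convergent[of "map from_nat ks"] by (simp add: occ_moment_def[abs_def] comp_def)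
  obtain N where N: "real_distribution N"
    and lim: "\<And>f :: (nat \<Rightarrow> real) \<Rightarrow> real. continuous_on cube f \<Longrightarrow>
       (\<lambda>n. \<integral>\<sigma>. f (\<lambda>k. occ (from_nat k) \<sigma>) \<partial>uniform_separable n) \<longlonglongrightarrow> (\<integral>c. f (\<lambda>k. curve k c) \<partial>N)"
  proof (rule moments_imp_joint_limit[of "\<lambda>k. occ (from_nat k)" uniform_separable, OF occ_nonneg occ_le_1 conv],
      goal_cases)
    case (1 N)
    show thesis by (rule 1(1)[OF 1(2)]) (erule 1(3))
  qed
  interpret N: real_distribution N by fact
  \<comment> \<open>The real line is embedded into the prescribed sample space by constant
    functions, and evaluation at \<open>[]\<close> recovers the parameter of the curve.\<close>
  define \<Omega> where "\<Omega> = (PiM UNIV (\<lambda>_. borel) :: (nat list \<Rightarrow> real) measure)"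
  define M where "M = distr N \<Omega> (\<lambda>c _. c)"
  define \<Lambda> where "\<Lambda> \<pi> \<omega> = lambda_coord \<pi> (\<lambda>k. curve k (\<omega> []))" for \<pi> :: "nat list" and \<omega> :: "nat list \<Rightarrow> real"
  have emb [measurable]: "(\<lambda>c _. c) \<in> measurable N \<Omega>"
    unfolding \<Omega>_def by (rule measurable_PiM_single') (auto simp: space_PiM)
  have ev [measurable]: "(\<lambda>\<omega>. \<omega> []) \<in> borel_measurable \<Omega>"
    unfolding \<Omega>_def by (rule measurable_component_singleton) simp
  have ev_M: "(\<lambda>\<omega>. \<omega> []) \<in> borel_measurable M" unfolding M_def by simp
  have prob: "prob_space M" unfolding M_def by (rule N.prob_space_distr) simp
  interpret M: prob_space M by fact
  have curve_cont: "continuous_on UNIV (\<lambda>c k. curve k c)"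
    by (intro continuous_on_coordinatewise_then_product curve_continuous)
  have curve_cube: "(\<lambda>k. curve k c) \<in> cube" for c using curve_bounds by (simp add: cube_def)
  have comp_meas: "(\<lambda>c. f (\<lambda>k. curve k c)) \<in> borel_measurable borel"
    if f: "continuous_on cube f" for f :: "_ \<Rightarrow> real"
    by (rule borel_measurable_continuous_onI, rule continuous_on_compose2[OF f curve_cont]) (use curve_cube in auto)
  have meas: "(\<lambda>\<omega>. f (\<lambda>k. curve k (\<omega> []))) \<in> borel_measurable M"
    if f: "continuous_on cube f" for f :: "_ \<Rightarrow> real"
    by (rule measurable_compose[OF ev_M comp_meas[OF f]])
  have int_M: "(\<integral>\<omega>. f (\<lambda>k. curve k (\<omega> [])) \<partial>M) = (\<integral>c. f (\<lambda>k. curve k c) \<partial>N)"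
    if f: "continuous_on cube f" for f :: "_ \<Rightarrow> real"
    unfolding M_def by (rule integral_distr[OF emb measurable_compose[OF ev comp_meas[OF f]]])
  \<comment> \<open>A common form for the three later uses (moments, single laws, vectors):
    \<open>g\<close> need agree with the cube functional only for \<open>n >= 1\<close> and on the
    support of the uniform law.\<close>
  have lim_M: "(\<lambda>n. \<integral>\<sigma>. g \<sigma> \<partial>uniform_separable n) \<longlonglongrightarrow> (\<integral>\<omega>. f (\<lambda>k. curve k (\<omega> [])) \<partial>M)"
    if f: "continuous_on cube f"
      and g: "\<And>n \<sigma>. n \<ge> 1 \<Longrightarrow> \<sigma> \<in> separable_perms n \<Longrightarrow> g \<sigma> = f (\<lambda>k. occ (from_nat k) \<sigma>)"
    for f :: "_ \<Rightarrow> real" and g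
  proof -
    have "\<forall>\<^sub>F n in sequentially. (\<integral>\<sigma>. f (\<lambda>k. occ (from_nat k) \<sigma>) \<partial>uniform_separable n)
        = (\<integral>\<sigma>. g \<sigma> \<partial>uniform_separable n)"
      using eventually_ge_at_top[of 1]
      by eventually_elim (rule integral_uniform_separable_cong, simp add: g)
    then show ?thesis
      unfolding int_M[OF f] by (rule Lim_transform_eventually[OF lim[OF f]])
  qed
  have \<Lambda>_meas [measurable]: "\<Lambda> \<pi> \<in> borel_measurable M" for \<pi>
    unfolding \<Lambda>_def[abs_def] by (rule meas[OF lambda_coord_continuous])
  have \<Lambda>_bounds: "0 \<le> \<Lambda> \<pi> \<omega>" "\<Lambda> \<pi> \<omega> \<le> 1" for \<pi> \<omega>
    using curve_bounds by (auto simp: \<Lambda>_def lambda_coord_def)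
  have moment: "(\<integral>\<omega>. (\<Prod>\<pi>\<leftarrow>q. \<Lambda> \<pi> \<omega>) \<partial>M) = limit_moment q" if q: "set q \<subseteq> all_perms" for q
  proof -
    have c: "continuous_on cube (\<lambda>x. \<Prod>\<pi>\<leftarrow>q. lambda_coord \<pi> x)" for q
      by (induction q) (auto intro!: continuous_intros lambda_coord_continuous)
    have "occ_moment q \<longlonglongrightarrow> (\<integral>\<omega>. (\<Prod>\<pi>\<leftarrow>q. \<Lambda> \<pi> \<omega>) \<partial>M)"
      unfolding \<Lambda>_def occ_moment_def[abs_def]
    proof (rule lim_M[OF c])
      fix n \<sigma> assume "n \<ge> 1" "\<sigma> \<in> separable_perms n"
      then have "map (\<lambda>\<pi>. occ \<pi> \<sigma>) q = map (\<lambda>\<pi>. lambda_coord \<pi> (\<lambda>k. occ (from_nat k) \<sigma>)) q"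
        using q lambda_coord_occ by (intro map_cong refl) fastforce
      then show "(\<Prod>\<pi>\<leftarrow>q. occ \<pi> \<sigma>) = (\<Prod>\<pi>\<leftarrow>q. lambda_coord \<pi> (\<lambda>k. occ (from_nat k) \<sigma>))"
        by (simp only:)
    qed
    then show ?thesis
      using occ_moment_tendsto[of q] q is_perm_all_perms LIMSEQ_unique by blast
  qed
  have nondet: "M.non_deterministic (\<Lambda> \<pi>)" if \<pi>: "\<pi> \<in> all_perms" "separable \<pi>" "length \<pi> \<ge> 2" for \<pi>
    unfolding M.non_deterministic_def
  proof
    assume "\<exists>c. AE \<omega> in M. \<Lambda> \<pi> \<omega> = c"
    then obtain c where c: "AE \<omega> in M. \<Lambda> \<pi> \<omega> = c" ..
    obtain \<rho> where \<rho>: "\<rho> \<in> all_perms" "limit_moment [\<rho>, \<pi>] \<noteq> limit_moment [\<rho>] * limit_moment [\<pi>]"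
      using limit_moment_not_product[OF \<pi>] by blast
    have "limit_moment [\<rho>, \<pi>] = (\<integral>\<omega>. \<Lambda> \<rho> \<omega> * \<Lambda> \<pi> \<omega> \<partial>M)"
      using moment[of "[\<rho>, \<pi>]"] \<rho>(1) \<pi>(1) by simp
    also have "\<dots> = (\<integral>\<omega>. \<Lambda> \<rho> \<omega> * c \<partial>M)"
    proof (rule integral_cong_AE)
      show "AE \<omega> in M. \<Lambda> \<rho> \<omega> * \<Lambda> \<pi> \<omega> = \<Lambda> \<rho> \<omega> * c" using c by eventually_elim simp
    qed (intro borel_measurable_times \<Lambda>_meas borel_measurable_const)+
    \<comment> \<open>With \<Lambda> almost surely constant the mixed moment factors, contradicting
      the choice of \<rho>.\<close>
    also have "\<dots> = limit_moment [\<rho>] * c" using moment[of "[\<rho>]"] \<rho>(1) by simp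
    also have "c = (\<integral>\<omega>. \<Lambda> \<pi> \<omega> \<partial>M)"
    proof -
      have "(\<integral>\<omega>. \<Lambda> \<pi> \<omega> \<partial>M) = (\<integral>\<omega>. c \<partial>M)"
        by (rule integral_cong_AE[OF \<Lambda>_meas borel_measurable_const c])
      then show ?thesis by (simp add: M.prob_space)
    qed
    also have "\<dots> = limit_moment [\<pi>]" using moment[of "[\<pi>]"] \<pi>(1) by simp
    finally show False using \<rho>(2) by simp
  qed
  have weak: "weak_conv_m (\<lambda>n. distr (uniform_separable n) borel (occ \<pi>)) (distr M borel (\<Lambda> \<pi>))"
    if \<pi>: "\<pi> \<in> all_perms" for \<pi>
  proof (rule integral_bdd_continuous_conv_imp_weak_conv)
    show "real_distribution (distr (uniform_separable n) borel (occ \<pi>))" for n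
      by (rule prob_space.real_distribution_distr) (auto intro: measure_pmf.prob_space_axioms)
    show "real_distribution (distr M borel (\<Lambda> \<pi>))"
      by (rule prob_space.real_distribution_distr[OF prob \<Lambda>_meas])
    fix f :: "real \<Rightarrow> real" assume f: "\<And>x. isCont f x" "\<And>x. \<bar>f x\<bar> \<le> 1"
    have fc: "continuous_on A f" for A by (rule continuous_at_imp_continuous_on) (simp add: f)
    have fm: "f \<in> borel_measurable borel" by (rule borel_measurable_continuous_onI[OF fc])
    have "(\<lambda>n. \<integral>\<sigma>. f (occ \<pi> \<sigma>) \<partial>uniform_separable n) \<longlonglongrightarrow> (\<integral>\<omega>. f (\<Lambda> \<pi> \<omega>) \<partial>M)"
      unfolding \<Lambda>_def
    proof (rule lim_M[of "\<lambda>x. f (lambda_coord \<pi> x)"])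
      show "continuous_on cube (\<lambda>x. f (lambda_coord \<pi> x))"
        by (rule continuous_on_compose2[OF fc lambda_coord_continuous]) auto
    qed (simp add: lambda_coord_occ[OF \<pi>])
    moreover have "integral\<^sup>L (distr (uniform_separable n) borel (occ \<pi>)) f
        = (\<integral>\<sigma>. f (occ \<pi> \<sigma>) \<partial>uniform_separable n)" for n
      by (rule integral_distr[OF _ fm]) simp
    moreover have "integral\<^sup>L (distr M borel (\<Lambda> \<pi>)) f = (\<integral>\<omega>. f (\<Lambda> \<pi> \<omega>) \<partial>M)"
      by (rule integral_distr[OF \<Lambda>_meas fm])
    ultimately show "(\<lambda>n. integral\<^sup>L (distr (uniform_separable n) borel (occ \<pi>)) f)
        \<longlonglongrightarrow> integral\<^sup>L (distr M borel (\<Lambda> \<pi>)) f"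
      by (simp only:)
  qed
  have vec: "vector_conv_in_distribution (length \<pi>s)
          (\<lambda>n. uniform_separable n) (\<lambda>n \<sigma>. \<lambda>i\<in>{..<length \<pi>s}. occ (\<pi>s ! i) \<sigma>)
          M (\<lambda>\<omega>. \<lambda>i\<in>{..<length \<pi>s}. \<Lambda> (\<pi>s ! i) \<omega>)" if \<pi>s: "set \<pi>s \<subseteq> all_perms" for \<pi>s
    unfolding vector_conv_in_distribution_def
  proof (intro allI impI)
    fix f assume f: "continuous_map (real_space (length \<pi>s)) euclideanreal f \<and> bounded (f ` topspace (real_space (length \<pi>s)))"
    \<comment> \<open>A continuous map into the finite-dimensional space, so that a test function on
      vectors becomes a test function on the cube.\<close>
    define h where "h x = (\<lambda>i\<in>{..<length \<pi>s}. lambda_coord (\<pi>s ! i) x)" for x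
    have "continuous_map euclidean (real_space (length \<pi>s)) h"
      unfolding continuous_map_componentwise h_def using lambda_coord_continuous by auto
    then have "continuous_map euclidean euclideanreal (f \<circ> h)"
      using f continuous_map_compose by blast
    then have fh: "continuous_on cube (\<lambda>x. f (h x))"
      by (auto simp: comp_def intro: continuous_on_subset)
    show "(\<lambda>n. \<integral>\<sigma>. f (\<lambda>i\<in>{..<length \<pi>s}. occ (\<pi>s ! i) \<sigma>) \<partial>uniform_separable n)
        \<longlonglongrightarrow> (\<integral>\<omega>. f (\<lambda>i\<in>{..<length \<pi>s}. \<Lambda> (\<pi>s ! i) \<omega>) \<partial>M)"
      unfolding \<Lambda>_def
    proof (rule lim_M[OF fh, unfolded h_def])
      fix n \<sigma> assume "n \<ge> 1" "\<sigma> \<in> separable_perms n"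
      then have "(\<lambda>i\<in>{..<length \<pi>s}. occ (\<pi>s ! i) \<sigma>) = h (\<lambda>k. occ (from_nat k) \<sigma>)"
        unfolding h_def using \<pi>s by (intro restrict_ext lambda_coord_occ[symmetric]) auto
      then show "f (\<lambda>i\<in>{..<length \<pi>s}. occ (\<pi>s ! i) \<sigma>)
          = f (\<lambda>i\<in>{..<length \<pi>s}. lambda_coord (\<pi>s ! i) (\<lambda>k. occ (from_nat k) \<sigma>))"
        by (simp only: h_def)
    qed
  qed
  have zero: "\<Lambda> \<pi> \<omega> = 0" if "\<not> separable \<pi>" for \<pi> \<omega>
    using that by (simp add: \<Lambda>_def lambda_coord_def)
  have one: "\<Lambda> \<pi> \<omega> = 1" if l: "length \<pi> = 1" for \<pi> \<omega>
  proof -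
    have "occs [2, 4, 1, 3 :: int] \<pi> = {}" "occs [3, 1, 4, 2 :: int] \<pi> = {}"
      by (rule occs_long; simp add: l)+
    then have "separable \<pi>" by (simp add: separable_iff_avoiding avoiding_def)
    then show ?thesis using l by (simp add: \<Lambda>_def lambda_coord_def)
  qed
  show ?thesis
    by (intro exI[of _ M] exI[of _ \<Lambda>] conjI ballI allI impI prob \<Lambda>_meas \<Lambda>_bounds weak vec zero one nondet;
        (elim conjE)?; assumption)
qed

end
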